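(* Let $(X_j)_{j\ge1}=((X_j^{(1)},\ldots,X_j^{(p)}))_{j\ge 1}$ be a $p$-dimensional stationary Gaussian process such that for all $1\le i,j\le p$ $$EX_1^{(i)}=0,\qquad EX_1^{(i)}X_1^{(j)}=\delta_{ij},\qquad r^{(i,j)}(k):=EX_1^{(i)}X_{k+1}^{(j)}=c_{ij}L(k)k^{-D}\quad(k\ge1),$$ where $c_{ij}\in\mathbb R$ are constants depending only on $i$ and $j$, $L$ is slowly varying at infinity and $0<D<1$. Let $G:\mathbb R^p\to\mathbb R^q$ be a measurable function, $Y_j:=G(X_j)$ and $F(x):=P(Y_1\le x)$. Furthermore, let $0<D<1/m$, where $m$ is the Hermite rank of $(1_{\{G(\cdot)\le x\}}-F(x))_{x\in\mathbb R^q}$. Then there exist constants $C,\kappa>0$ such that for any $0<\varepsilon\le 1$ (and all $N$) $$P\Biggl(\max_{n\le N}\ \sup_{x\in[-\infty,\infty]^q}d_N^{-1}\Bigl|\sum_{j=1}^n\Bigl(1_{\{Y_j\le x\}}-F(x)-\sum_{l_1+\cdots+l_p=m}\frac{J_{l_1,\ldots,l_p}(x)}{l_1!\cdots l_p!}H_{l_1,\ldots,l_p}(X_j)\Bigr)\Bigr|>\varepsilon\Biggr)\le CN^{-\kappa}(1+\varepsilon^{-3}),$$ where the normalization factor is given by $$d_N^2=\operatorname{Var}\Bigl(\sum_{j=1}^N H_m(X_j^{(1)})\Bigr).$$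
   Context: For vectors, $x\le y$ means coordinatewise inequality. $H_n(y)=(-1)^n e^{y^2/2}\frac{d^n}{dy^n}e^{-y^2/2}$ is the $n$-th Hermite polynomial. For nonnegative integers $l_1,\ldots,l_p$ let $H_{l_1,\ldots,l_p}(s)=H_{l_1}(s^{(1)})\cdots H_{l_p}(s^{(p)})$ and $J_{l_1,\ldots,l_p}(x)=E(1_{\{G(X_1)\le x\}}H_{l_1,\ldots,l_p}(X_1))$. The Hermite rank of $1_{\{G(\cdot)\le x\}}-F(x)$ is the largest index $k$ such that $E\bigl[(1_{\{G(X_1)\le x\}}-F(x))H_{l_1,\ldots,l_p}(X_1)\bigr]=0$ whenever $l_1+\cdots+l_p<k$; the Hermite rank of the family indexed by $x\in\mathbb R^q$ is the minimum of these pointwise Hermite ranks.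
   Formalization: The formal theorem additionally assumes c_11 ≠ 0; if c_11 = 0 the claim fails, e.g. for p = q = 1, i.i.d. standard normal X_j and G the identity, where m = 1, d_N^2 = N and the maximum has a nondegenerate limit. *)

theory Defs
  imports "HOL-Probability.Probability"
begin

text \<open>The (probabilists') Hermite polynomials and their multivariate products; a multi-index
  \<open>(l\<^sub>1, \<dots>, l\<^sub>p)\<close> is a function on the index type of the coordinates.\<close>

definition hermite :: "nat \<Rightarrow> real \<Rightarrow> real" where
  "hermite n y = (-1) ^ n * exp (y\<^sup>2 / 2) * (deriv ^^ n) (\<lambda>t. exp (- (t\<^sup>2 / 2))) y"

definition hermite_multi :: "('p::finite \<Rightarrow> nat) \<Rightarrow> real ^ 'p \<Rightarrow> real" where
  "hermite_multi l s = (\<Prod>i\<in>UNIV. hermite (l i) (s $ i))"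

text \<open>Points of \<open>[-\<infinity>, \<infinity>]\<^sup>q\<close> have type \<^typ>\<open>ereal ^ 'q\<close>, whose order is the coordinatewise one;
  \<open>evec\<close> is the inclusion of \<open>\<real>\<^sup>q\<close>.\<close>

definition evec :: "real ^ 'q \<Rightarrow> ereal ^ 'q" where
  "evec y = (\<chi> i. ereal (y $ i))"

text \<open>In the following three definitions \<open>\<xi>\<close> plays the role of \<open>X\<^sub>1\<close>.\<close>

definition ind_le :: "(real ^ 'p \<Rightarrow> real ^ 'q) \<Rightarrow> ereal ^ 'q \<Rightarrow> real ^ 'p \<Rightarrow> real" where
  "ind_le G x s = (if evec (G s) \<le> x then 1 else 0)"

definition dist_fun ::
  "'a measure \<Rightarrow> ('a \<Rightarrow> real ^ 'p) \<Rightarrow> (real ^ 'p \<Rightarrow> real ^ 'q) \<Rightarrow> ereal ^ 'q \<Rightarrow> real" where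
  "dist_fun M \<xi> G x = measure M {\<omega> \<in> space M. evec (G (\<xi> \<omega>)) \<le> x}"

definition J_coeff ::
  "'a measure \<Rightarrow> ('a \<Rightarrow> real ^ 'p) \<Rightarrow> (real ^ 'p \<Rightarrow> real ^ 'q) \<Rightarrow> ('p::finite \<Rightarrow> nat) \<Rightarrow> ereal ^ 'q \<Rightarrow> real" where
  "J_coeff M \<xi> G l x = (LINT \<omega>|M. ind_le G x (\<xi> \<omega>) * hermite_multi l (\<xi> \<omega>))"

text \<open>The set below always contains 0 and is downward closed, so its supremum is its largest
  element, or \<open>\<infinity>\<close> if all Hermite coefficients vanish.\<close>

definition hermite_rank :: "'a measure \<Rightarrow> ('a \<Rightarrow> real ^ 'p) \<Rightarrow> (real ^ 'p::finite \<Rightarrow> real) \<Rightarrow> enat" where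
  "hermite_rank M \<xi> f = Sup {enat k | k. \<forall>l. (\<Sum>i\<in>UNIV. l i) < k \<longrightarrow>
      (LINT \<omega>|M. f (\<xi> \<omega>) * hermite_multi l (\<xi> \<omega>)) = 0}"

definition hermite_rank_family ::
  "'a measure \<Rightarrow> ('a \<Rightarrow> real ^ 'p::finite) \<Rightarrow> (real ^ 'p \<Rightarrow> real ^ 'q) \<Rightarrow> enat" where
  "hermite_rank_family M \<xi> G = (INF x::real ^ 'q.
      hermite_rank M \<xi> (\<lambda>s. ind_le G (evec x) s - dist_fun M \<xi> G (evec x)))"

text \<open>Positivity and measurability are only required on a neighbourhood of \<open>\<infinity>\<close>.\<close>

definition slowly_varying :: "(real \<Rightarrow> real) \<Rightarrow> bool" where
  "slowly_varying L \<longleftrightarrow>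
     (\<exists>a. L \<in> borel_measurable (restrict_space borel {a..}) \<and> (\<forall>x\<ge>a. 0 < L x)) \<and>
     (\<forall>t>0. ((\<lambda>x. L (t * x) / L x) \<longlongrightarrow> 1) at_top)"

text \<open>Almost surely constant variables count as (degenerate) Gaussian.\<close>

definition gaussian_rv :: "'a measure \<Rightarrow> ('a \<Rightarrow> real) \<Rightarrow> bool" where
  "gaussian_rv M Z \<longleftrightarrow> Z \<in> borel_measurable M \<and>
     ((\<exists>\<mu>. AE \<omega> in M. Z \<omega> = \<mu>) \<or>
      (\<exists>\<mu> \<sigma>. 0 < \<sigma> \<and> distributed M lborel Z (\<lambda>y. ennreal (normal_density \<mu> \<sigma> y))))"

text \<open>Processes are indexed by the integers \<open>j \<ge> 1\<close>; the value at index 0 is irrelevant.\<close>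

definition gaussian_process :: "'a measure \<Rightarrow> (nat \<Rightarrow> 'a \<Rightarrow> real ^ 'p::finite) \<Rightarrow> bool" where
  "gaussian_process M X \<longleftrightarrow> (\<forall>j\<ge>1. X j \<in> borel_measurable M) \<and>
     (\<forall>T a. finite T \<and> T \<subseteq> {1..} \<longrightarrow> gaussian_rv M (\<lambda>\<omega>. \<Sum>j\<in>T. a j \<bullet> X j \<omega>))"

definition stationary_process :: "'a measure \<Rightarrow> (nat \<Rightarrow> 'a \<Rightarrow> real ^ 'p::finite) \<Rightarrow> bool" where
  "stationary_process M X \<longleftrightarrow> (\<forall>T h. finite T \<and> T \<subseteq> {1..} \<longrightarrow>
     distr M (PiM T (\<lambda>_. borel)) (\<lambda>\<omega>. \<lambda>j\<in>T. X (j + h) \<omega>) =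
     distr M (PiM T (\<lambda>_. borel)) (\<lambda>\<omega>. \<lambda>j\<in>T. X j \<omega>))"

text \<open>The argument \<open>i\<close> is the coordinate called the first one; the index type carries no order.\<close>

definition norm_factor :: "'a measure \<Rightarrow> (nat \<Rightarrow> 'a \<Rightarrow> real ^ 'p::finite) \<Rightarrow> 'p \<Rightarrow> nat \<Rightarrow> nat \<Rightarrow> real" where
  "norm_factor M X i m N = sqrt (prob_space.variance M (\<lambda>\<omega>. \<Sum>j=1..N. hermite m (X j \<omega> $ i)))"

end

theory Submission
  imports Defs "HOL-Real_Asymp.Real_Asymp"
begin

text \<open>The proof estimates second moments only. Let \<open>f\<^sub>A\<close> be the indicator of a set \<open>A\<close> minus its Hermite expansion up
  to degree \<open>m\<close>. The law of \<open>(X\<^sub>1, X\<^sub>k\<^sub>+\<^sub>1)\<close> is that of a pair with a fixed lag \<open>l\<close> after applying the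
  Ornstein--Uhlenbeck operator with parameter \<open>\<rho>\<^sup>2 = t k / t l\<close>, \<open>t k = L k k\<^sup>-\<^sup>D\<close>, to each component, and this operator
  contracts functions orthogonal to the polynomials of degree at most \<open>m\<close> by a factor of order \<open>\<rho>\<^sup>m\<^sup>+\<^sup>1\<close>.
  Hence \<open>f\<^sub>A(X\<^sub>1)\<close> and \<open>f\<^sub>A(X\<^sub>k\<^sub>+\<^sub>1)\<close> have covariance \<open>O(t k\<^sup>m\<^sup>+\<^sup>1 P(A))\<close>, while \<open>d\<^sub>N\<^sup>2\<close> grows like
  \<open>N\<^sup>2 t N\<^sup>m\<close>, which leaves a power of \<open>N\<close> to spare.

  The additivity of \<open>f\<^sub>A\<close> in \<open>A\<close> permits a chaining of Rademacher--Menshov type, simultaneously in \<open>n\<close> and in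
  the \<open>q\<close> coordinates of \<open>x\<close>: splitting into dyadic blocks of indices and dyadic cells of quantiles costs only powers
  of \<open>log N\<close>. With \<open>N\<^sup>2\<close> quantiles per coordinate the error of the final bracketing is bounded in mean.\<close>

subsection \<open>The standard Gaussian measure on a Euclidean space\<close>

text \<open>The reduction to one fixed lag works because the cross covariances at lag k form a fixed
  matrix \<open>c\<close> times the scalar \<open>t k\<close>. Shrinking a Gaussian pair by \<rho>
  and refilling it with independent standard noise multiplies this block by \<rho>^2 and keeps both
  marginals standard. Only second moments are available for a supremum over uncountably many x. The
  covariance bound is therefore linear in P(A), not in its square root: the bounds for the disjoint
  cells of one scale then add up to that of the whole space, however many cells there are.
  Indicators are monotone in x, but residuals are not, as the Hermite part has no sign. A bracket of
  mass \<delta> hence costs N sqrt \<delta> rather than N \<delta>, and N^2 quantiles are the number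
  that makes this bounded. The gain comes from the gap m D < min 1 ((m + 1) D), open because D < 1 /
  m. For \<alpha> < \<beta> inside it, the squared maximum over the grid has mean of order N^(2 -
  \<beta>) up to logarithms, while the squared norming factor is at least of order N^(2 -
  \<alpha>).\<close>

abbreviation std_normal_measure :: "real measure" ("\<phi>") where
  "\<phi> \<equiv> std_normal_distribution"

lemma
  fixes f :: "'a::euclidean_space \<Rightarrow> real \<Rightarrow> 'b::{real_normed_field,banach,second_countable_topology}"
  assumes "\<And>b. b \<in> Basis \<Longrightarrow> integrable lborel (f b)"
  shows integrable_lborel_prod: "integrable lborel (\<lambda>x. \<Prod>b\<in>Basis. f b (x \<bullet> b))"
    and integral_lborel_prod:
      "(LINT x|lborel. (\<Prod>b\<in>Basis. f b (x \<bullet> b))) = (\<Prod>b\<in>Basis. LINT x|lborel. f b x)"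
proof -
  interpret product_sigma_finite "\<lambda>_::'a. lborel :: real measure"
    by unfold_locales
  \<comment> \<open>\<open>lborel\<close> is defined as the image of a product of interval measures
    under the coordinate sum; \<open>lborel_eq_real\<close> turns the factors into
    \<open>lborel\<close> on the line.\<close>
  have eq: "lborel = distr (\<Pi>\<^sub>M b\<in>(Basis::'a set). (lborel :: real measure)) borel (\<lambda>f. \<Sum>b\<in>Basis. f b *\<^sub>R b)"
    by (subst lborel_def) (simp add: lborel_eq_real)
  have [measurable]: "f b \<in> borel_measurable borel" if "b \<in> Basis" for b
    using borel_measurable_integrable[OF assms[OF that]] by simp
  have m: "(\<lambda>x. \<Prod>b\<in>Basis. f b (x \<bullet> b)) \<in> borel_measurable borel" by measurable
  have m2: "(\<lambda>f. \<Sum>b\<in>Basis. f b *\<^sub>R b) \<in> measurable (\<Pi>\<^sub>M b\<in>(Basis::'a set). (lborel :: real measure)) borel"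
    by measurable
  have in_b: "(\<Sum>c\<in>Basis. g c *\<^sub>R c) \<bullet> b = g b" if "b \<in> Basis" for g :: "'a \<Rightarrow> real" and b
    using that by (simp add: inner_sum_left inner_Basis if_distrib cong: if_cong)
  have int: "integrable (\<Pi>\<^sub>M b\<in>(Basis::'a set). (lborel :: real measure)) (\<lambda>x. \<Prod>b\<in>Basis. f b (x b))"
    by (rule product_integrable_prod) (auto intro: assms)
  show "integrable lborel (\<lambda>x. \<Prod>b\<in>Basis. f b (x \<bullet> b))"
    apply (subst eq)
    apply (subst integrable_distr_eq[OF m2 m])
    using int by (simp add: in_b cong: prod.cong)
  show "(LINT x|lborel. (\<Prod>b\<in>Basis. f b (x \<bullet> b))) = (\<Prod>b\<in>Basis. LINT x|lborel. f b x)"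
    apply (subst eq)
    apply (subst integral_distr[OF m2 m])
    apply (simp add: in_b cong: prod.cong)
    by (rule product_integral_prod) (auto intro: assms)
qed

definition gauss_density :: "'a::euclidean_space \<Rightarrow> real" where
  "gauss_density x = (\<Prod>b\<in>Basis. std_normal_density (x \<bullet> b))"

text \<open>Polymorphic in the space: the same measure is used on the line, on
  \<open>real ^ 'p\<close> and on pairs of either, so that noise added to a pair of vectors is again
  \<open>gauss\<close>.\<close>

definition gauss :: "'a::euclidean_space measure" where
  "gauss = density lborel gauss_density"

lemma gauss_density_nonneg [simp]: "0 \<le> gauss_density x"
  by (simp add: gauss_density_def prod_nonneg)

lemma gauss_density_measurable [measurable]: "gauss_density \<in> borel_measurable borel"
  unfolding gauss_density_def by measurable

lemma gauss_density_eq: 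
  "gauss_density (x::'a::euclidean_space) = (1 / sqrt (2 * pi)) ^ DIM('a) * exp (- (norm x)\<^sup>2 / 2)"
  unfolding gauss_density_def std_normal_density_def prod.distrib
  by (simp add: exp_sum[symmetric] sum_negf sum_divide_distrib[symmetric] norm_eq_sqrt_inner
      euclidean_inner[of x x] power2_eq_square sum_nonneg)

lemma sets_gauss [measurable_cong, simp]: "sets gauss = sets borel"
  and space_gauss [simp]: "space gauss = UNIV"
  by (simp_all add: gauss_def)

lemma
  fixes f :: "'a::euclidean_space \<Rightarrow> real \<Rightarrow> 'b::{real_normed_field,banach,second_countable_topology}"
  assumes "\<And>b. b \<in> Basis \<Longrightarrow> integrable \<phi> (f b)"
  shows integrable_gauss_prod: "integrable gauss (\<lambda>x. \<Prod>b\<in>Basis. f b (x \<bullet> b))"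
    and integral_gauss_prod:
      "(LINT x|gauss. (\<Prod>b\<in>Basis. f b (x \<bullet> b))) = (\<Prod>b\<in>Basis. LINT x|\<phi>. f b x)"
proof -
  have [measurable]: "f b \<in> borel_measurable borel" if "b \<in> Basis" for b
    using borel_measurable_integrable[OF assms[OF that]] by simp
  have i: "integrable lborel (\<lambda>x. std_normal_density x *\<^sub>R f b x)" if "b \<in> Basis" for b
    using assms[OF that] that by (subst (asm) integrable_density) auto
  have e: "gauss_density x *\<^sub>R (\<Prod>b\<in>Basis. f b (x \<bullet> b)) =
     (\<Prod>b\<in>Basis. std_normal_density (x \<bullet> b) *\<^sub>R f b (x \<bullet> b))" for x
    by (simp add: gauss_density_def scaleR_conv_of_real prod.distrib)
  show "integrable gauss (\<lambda>x. \<Prod>b\<in>Basis. f b (x \<bullet> b))"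
    unfolding gauss_def
    by (subst integrable_density) (auto simp: e intro!: integrable_lborel_prod i)
  show "(LINT x|gauss. (\<Prod>b\<in>Basis. f b (x \<bullet> b))) = (\<Prod>b\<in>Basis. LINT x|\<phi>. f b x)"
    unfolding gauss_def
    apply (subst integral_density)
    apply (auto simp: e integral_lborel_prod[OF i])
    by (intro prod.cong refl, subst integral_density) auto
qed

lemma prob_space_gauss: "prob_space (gauss :: 'a::euclidean_space measure)"
proof -
  interpret S: prob_space \<phi> by (simp add: prob_space_normal_density)
  have 1: "integrable gauss (\<lambda>x::'a. \<Prod>b\<in>Basis. (\<lambda>_ _. 1::real) b (x \<bullet> b))"
    by (rule integrable_gauss_prod) simp
  have 2: "(LINT x|gauss. (\<Prod>b\<in>(Basis::'a set). (\<lambda>_ _. 1::real) b (x \<bullet> b))) = 1"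
    by (subst integral_gauss_prod) (simp_all add: S.prob_space[unfolded space_density, simplified])
  interpret finite_measure "gauss :: 'a measure"
    using 1 by (intro finite_measureI) (auto simp: integrable_iff_bounded)
  have "measure gauss (UNIV::'a set) = 1" using 2 by simp
  then show ?thesis
    by (intro prob_spaceI) (simp add: emeasure_eq_measure)
qed

interpretation gauss: prob_space "gauss :: 'a::euclidean_space measure"
  by (rule prob_space_gauss)

interpretation std_normal: prob_space \<phi>
  by (simp add: prob_space_normal_density)

text \<open>Read from right to left, this writes a Gaussian bump as an average of characters;
  \<open>gauss_smoothing_eq\<close> uses it in that direction.\<close>

lemma char_gauss: "(CLINT u|gauss. iexp (u \<bullet> z)) = exp (- (norm z)\<^sup>2 / 2)"
proof -
  have "(CLINT u|gauss. iexp (u \<bullet> z)) = (CLINT u|gauss. \<Prod>b\<in>Basis. iexp ((z \<bullet> b) * (u \<bullet> b)))"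
    by (intro Bochner_Integration.integral_cong refl)
       (simp add: exp_sum[symmetric] sum_distrib_left[symmetric] euclidean_inner[of _ z] mult.commute)
  also have "\<dots> = (\<Prod>b\<in>Basis. CLINT x|\<phi>. iexp ((z \<bullet> b) * x))"
    by (rule integral_gauss_prod) (rule std_normal.integrable_iexp, auto)
  also have "\<dots> = (\<Prod>b\<in>Basis. of_real (exp (- ((z \<bullet> b)\<^sup>2) / 2)))"
    using char_std_normal_distribution by (simp add: char_def fun_eq_iff)
  also have "\<dots> = exp (- (norm z)\<^sup>2 / 2)"
    by (simp add: exp_sum[symmetric] sum_negf sum_divide_distrib[symmetric] norm_eq_sqrt_inner
      euclidean_inner[of z z] power2_eq_square sum_nonneg of_real_prod[symmetric] del: of_real_prod)
  finally show ?thesis .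
qed

text \<open>Serves both the Gaussian smoothing of an arbitrary law and, through
  \<open>distr_gauss_affine\<close>, the Mehler kernel.\<close>

lemma nn_integral_gauss_affine:
  fixes t :: "'a::euclidean_space"
  assumes c: "0 < c" and g [measurable]: "g \<in> borel_measurable borel"
  shows "(\<integral>\<^sup>+u. g (t + c *\<^sub>R u) \<partial>gauss) =
    (\<integral>\<^sup>+x. g x * ennreal (gauss_density ((x - t) /\<^sub>R c) / c ^ DIM('a)) \<partial>lborel)"
proof -
  have "(\<integral>\<^sup>+x. g x * ennreal (gauss_density ((x - t) /\<^sub>R c) / c ^ DIM('a)) \<partial>lborel)
    = (\<integral>\<^sup>+x. \<bar>c\<bar>^DIM('a) * (g (t + c *\<^sub>R x) * ennreal (gauss_density (((t + c *\<^sub>R x) - t) /\<^sub>R c) / c ^ DIM('a))) \<partial>lborel)"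
    by (subst lborel_affine[of c t], use c in simp)
       (subst nn_integral_density; (subst nn_integral_distr)?; measurable)
  also have "\<dots> = (\<integral>\<^sup>+x. gauss_density x * g (t + c *\<^sub>R x) \<partial>lborel)"
  proof (intro nn_integral_cong)
    fix x :: 'a
    have "ennreal (gauss_density x) = ennreal (\<bar>c\<bar>^DIM('a)) * ennreal (gauss_density x / c ^ DIM('a))"
      using c by (subst ennreal_mult[symmetric]) (auto simp: field_simps)
    then show "ennreal (\<bar>c\<bar>^DIM('a)) * (g (t + c *\<^sub>R x) * ennreal (gauss_density (((t + c *\<^sub>R x) - t) /\<^sub>R c) / c ^ DIM('a)))
       = ennreal (gauss_density x) * g (t + c *\<^sub>R x)"
      using c by (simp add: mult_ac)
  qed
  also have "\<dots> = (\<integral>\<^sup>+u. g (t + c *\<^sub>R u) \<partial>gauss)"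
    unfolding gauss_def by (subst nn_integral_density) auto
  finally show ?thesis ..
qed

lemma distr_gauss_affine:
  fixes t :: "'a::euclidean_space"
  assumes c: "0 < c"
  shows "distr gauss borel (\<lambda>u. t + c *\<^sub>R u) = density lborel (\<lambda>x. ennreal (gauss_density ((x - t) /\<^sub>R c) / c ^ DIM('a)))"
proof (rule measure_eqI)
  fix A assume "A \<in> sets (distr gauss borel (\<lambda>u. t + c *\<^sub>R u))"
  then have [measurable]: "A \<in> sets borel" by simp
  have "emeasure (distr gauss borel (\<lambda>u. t + c *\<^sub>R u)) A = (\<integral>\<^sup>+x. indicator A x \<partial>distr gauss borel (\<lambda>u. t + c *\<^sub>R u))"
    by simp
  also have "\<dots> = (\<integral>\<^sup>+u. indicator A (t + c *\<^sub>R u) \<partial>gauss)"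
    by (rule nn_integral_distr) auto
  also have "\<dots> = (\<integral>\<^sup>+x. indicator A x * ennreal (gauss_density ((x - t) /\<^sub>R c) / c ^ DIM('a)) \<partial>lborel)"
    by (rule nn_integral_gauss_affine[OF c]) auto
  also have "\<dots> = emeasure (density lborel (\<lambda>x. ennreal (gauss_density ((x - t) /\<^sub>R c) / c ^ DIM('a)))) A"
    by (subst emeasure_density) (auto simp: mult.commute)
  finally show "emeasure (distr gauss borel (\<lambda>u. t + c *\<^sub>R u)) A = \<dots>" .
qed simp

subsection \<open>Uniqueness of characteristic functions\<close>

text \<open>A Gaussian bump is an average of characters; exchanging the integrals expresses its mean
  under a law through the characteristic function of that law alone.\<close>

lemma gauss_smoothing_eq:
  fixes \<mu> \<nu> :: "'a::euclidean_space measure"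
  assumes "prob_space \<mu>" "prob_space \<nu>"
    and [measurable_cong, simp]: "sets \<mu> = sets borel" "sets \<nu> = sets borel"
    and char: "\<And>u. (CLINT x|\<mu>. iexp (u \<bullet> x)) = (CLINT x|\<nu>. iexp (u \<bullet> x))"
  shows "(LINT z|\<mu>. gauss_density ((y - z) /\<^sub>R \<tau>)) = (LINT z|\<nu>. gauss_density ((y - z) /\<^sub>R \<tau>))"
proof -
  have eq: "complex_of_real (LINT z|\<mu>. exp (- (norm ((y - z) /\<^sub>R \<tau>))\<^sup>2 / 2)) =
      (CLINT u|gauss. iexp (u \<bullet> (y /\<^sub>R \<tau>)) * (CLINT z|\<mu>. iexp ((- u /\<^sub>R \<tau>) \<bullet> z)))"
    if "prob_space \<mu>" and [measurable_cong, simp]: "sets \<mu> = sets borel" for \<mu>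
  proof -
    interpret prob_space \<mu> by fact
    interpret P: pair_prob_space \<mu> "gauss :: 'a measure" by unfold_locales
    have "complex_of_real (LINT z|\<mu>. exp (- (norm ((y - z) /\<^sub>R \<tau>))\<^sup>2 / 2)) =
        (CLINT z|\<mu>. CLINT u|gauss. iexp (u \<bullet> ((y - z) /\<^sub>R \<tau>)))"
      by (simp only: char_gauss integral_complex_of_real)
    also have "\<dots> = (CLINT u|gauss. CLINT z|\<mu>. iexp (u \<bullet> ((y - z) /\<^sub>R \<tau>)))"
      by (subst P.Fubini_integral)
         (auto intro!: P.integrable_const_bound[where B=1])
    also have "\<dots> = (CLINT u|gauss. iexp (u \<bullet> (y /\<^sub>R \<tau>)) * (CLINT z|\<mu>. iexp ((- u /\<^sub>R \<tau>) \<bullet> z)))"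
      by (intro Bochner_Integration.integral_cong refl)
         (auto simp: exp_add[symmetric] algebra_simps inner_diff_right simp flip: integral_mult_right_zero
           intro!: Bochner_Integration.integral_cong)
    finally show ?thesis .
  qed
  have "complex_of_real (LINT z|\<mu>. exp (- (norm ((y - z) /\<^sub>R \<tau>))\<^sup>2 / 2)) =
        complex_of_real (LINT z|\<nu>. exp (- (norm ((y - z) /\<^sub>R \<tau>))\<^sup>2 / 2))"
    using assms by (simp only: eq char)
  then show ?thesis
    by (simp only: gauss_density_eq integral_mult_right_zero of_real_eq_iff)
qed

text \<open>After adding an independent Gaussian of width \<tau> the law has a density fixed by the
  characteristic function. Letting \<tau> tend to 0 gives equality on continuous functions with
  values in [0, 1], then on closed sets, which form an intersection-stable generator.\<close>

theorem char_unique: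
  fixes \<mu> \<nu> :: "'a::euclidean_space measure"
  assumes \<mu>: "prob_space \<mu>" and \<nu>: "prob_space \<nu>"
    and s [measurable_cong, simp]: "sets \<mu> = sets borel" "sets \<nu> = sets borel"
    and char: "\<And>u. (CLINT x|\<mu>. iexp (u \<bullet> x)) = (CLINT x|\<nu>. iexp (u \<bullet> x))"
  shows "\<mu> = \<nu>"
proof -
  have gd_bound: "gauss_density x \<le> (1 / sqrt (2 * pi)) ^ DIM('a)" for x :: 'a
    unfolding gauss_density_eq by (simp add: abs_mult)
  \<comment> \<open>The law of z + \<tau> u, with z drawn from \<open>\<mu>\<close> and u
    independent standard Gaussian, has as density the function of \<open>gauss_smoothing_eq\<close>
    divided by \<tau> to the dimension.\<close>
  have smooth: "(\<integral>\<^sup>+p. h (fst p + \<tau> *\<^sub>R snd p) \<partial>(\<mu> \<Otimes>\<^sub>M gauss)) =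
      (\<integral>\<^sup>+y. h y * ennreal ((LINT z|\<mu>. gauss_density ((y - z) /\<^sub>R \<tau>)) / \<tau> ^ DIM('a)) \<partial>lborel)"
    if "prob_space \<mu>" and [measurable_cong, simp]: "sets \<mu> = sets borel"
      and [measurable]: "h \<in> borel_measurable borel" and \<tau>: "0 < \<tau>"
    for \<mu> :: "'a measure" and h and \<tau> :: real
  proof -
    interpret prob_space \<mu> by fact
    interpret L: pair_sigma_finite \<mu> "lborel :: 'a measure" by unfold_locales
    have "(\<integral>\<^sup>+p. h (fst p + \<tau> *\<^sub>R snd p) \<partial>(\<mu> \<Otimes>\<^sub>M gauss)) = (\<integral>\<^sup>+z. \<integral>\<^sup>+u. h (z + \<tau> *\<^sub>R u) \<partial>gauss \<partial>\<mu>)"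
      by (subst gauss.nn_integral_fst[symmetric]) auto
    also have "\<dots> = (\<integral>\<^sup>+z. \<integral>\<^sup>+y. h y * ennreal (gauss_density ((y - z) /\<^sub>R \<tau>) / \<tau> ^ DIM('a)) \<partial>lborel \<partial>\<mu>)"
      by (simp add: nn_integral_gauss_affine[OF \<tau>])
    also have "\<dots> = (\<integral>\<^sup>+y. \<integral>\<^sup>+z. h y * ennreal (gauss_density ((y - z) /\<^sub>R \<tau>) / \<tau> ^ DIM('a)) \<partial>\<mu> \<partial>lborel)"
      by (subst L.Fubini') auto
    also have "\<dots> = (\<integral>\<^sup>+y. h y * (\<integral>\<^sup>+z. ennreal (gauss_density ((y - z) /\<^sub>R \<tau>) / \<tau> ^ DIM('a)) \<partial>\<mu>) \<partial>lborel)"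
      by (simp add: nn_integral_cmult)
    also have "\<dots> = (\<integral>\<^sup>+y. h y * ennreal ((LINT z|\<mu>. gauss_density ((y - z) /\<^sub>R \<tau>)) / \<tau> ^ DIM('a)) \<partial>lborel)"
    proof (intro nn_integral_cong arg_cong2[where f="(*)"] refl)
      fix y
      have "integrable \<mu> (\<lambda>z. gauss_density ((y - z) /\<^sub>R \<tau>))"
        by (rule integrable_const_bound[where B="(1 / sqrt (2 * pi)) ^ DIM('a)"])
           (auto intro: gd_bound)
      then show "(\<integral>\<^sup>+z. ennreal (gauss_density ((y - z) /\<^sub>R \<tau>) / \<tau> ^ DIM('a)) \<partial>\<mu>)
        = ennreal ((LINT z|\<mu>. gauss_density ((y - z) /\<^sub>R \<tau>)) / \<tau> ^ DIM('a))"
        using \<tau> by (subst nn_integral_eq_integral) auto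
    qed
    finally show ?thesis .
  qed
  have lim: "(\<lambda>n. LINT p|(\<mu> \<Otimes>\<^sub>M gauss). h (fst p + (1 / real (Suc n)) *\<^sub>R snd p)) \<longlonglongrightarrow> (LINT z|\<mu>. h z)"
    if "prob_space \<mu>" and [measurable_cong, simp]: "sets \<mu> = sets borel"
      and h: "continuous_on UNIV h" and b: "\<And>x. 0 \<le> h x" "\<And>x. h x \<le> 1"
    for \<mu> :: "'a measure" and h :: "'a \<Rightarrow> real"
  proof -
    interpret prob_space \<mu> by fact
    interpret P: pair_prob_space \<mu> "gauss :: 'a measure" by unfold_locales
    have [measurable]: "h \<in> borel_measurable borel" using h by (rule borel_measurable_continuous_onI)
    have "(\<lambda>n. LINT p|(\<mu> \<Otimes>\<^sub>M gauss). h (fst p + (1 / real (Suc n)) *\<^sub>R snd p))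
      \<longlonglongrightarrow> (LINT p|(\<mu> \<Otimes>\<^sub>M (gauss :: 'a measure)). h (fst p))"
    proof (rule integral_dominated_convergence[where w="\<lambda>_. 1"])
      show "AE p in \<mu> \<Otimes>\<^sub>M gauss. (\<lambda>n. h (fst p + (1 / real (Suc n)) *\<^sub>R snd p)) \<longlonglongrightarrow> h (fst p)"
      proof (intro AE_I2)
        fix p :: "'a \<times> 'a"
        have "(\<lambda>n. fst p + (1 / real (Suc n)) *\<^sub>R snd p) \<longlonglongrightarrow> fst p + 0 *\<^sub>R snd p"
          by (intro tendsto_intros LIMSEQ_Suc lim_1_over_n)
        moreover have "isCont h (fst p + 0 *\<^sub>R snd p)" using h by (simp add: continuous_on_eq_continuous_at)
        ultimately show "(\<lambda>n. h (fst p + (1 / real (Suc n)) *\<^sub>R snd p)) \<longlonglongrightarrow> h (fst p)"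
          using isCont_tendsto_compose by fastforce
      qed
    qed (use b in auto)
    also have "(LINT p|(\<mu> \<Otimes>\<^sub>M (gauss :: 'a measure)). h (fst p)) = (LINT z|\<mu>. LINT u|(gauss :: 'a measure). h z)"
      by (rule P.integral_fst'[of "\<lambda>p. h (fst p)", simplified fst_conv, symmetric])
         (auto intro!: P.integrable_const_bound[where B=1] simp: b)
    also have "\<dots> = (LINT z|\<mu>. h z)" by (simp add: gauss.prob_space[simplified])
    finally show ?thesis .
  qed
  have eqh: "(LINT z|\<mu>. h z) = (LINT z|\<nu>. h z)"
    if h: "continuous_on UNIV h" and b: "\<And>x. 0 \<le> h x" "\<And>x. h x \<le> 1" for h :: "'a \<Rightarrow> real"
  proof -
    have [measurable]: "h \<in> borel_measurable borel" using h by (rule borel_measurable_continuous_onI)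
    have "(LINT p|(\<mu> \<Otimes>\<^sub>M gauss). h (fst p + (1 / real (Suc n)) *\<^sub>R snd p)) =
        (LINT p|(\<nu> \<Otimes>\<^sub>M gauss). h (fst p + (1 / real (Suc n)) *\<^sub>R snd p))" for n
    proof -
      have "(\<integral>\<^sup>+p. ennreal (h (fst p + (1 / real (Suc n)) *\<^sub>R snd p)) \<partial>(\<mu> \<Otimes>\<^sub>M gauss)) =
        (\<integral>\<^sup>+p. ennreal (h (fst p + (1 / real (Suc n)) *\<^sub>R snd p)) \<partial>(\<nu> \<Otimes>\<^sub>M gauss))"
      proof -
        have m: "(\<lambda>x. ennreal (h x)) \<in> borel_measurable borel" by measurable
        have p: "0 < 1 / real (Suc n)" by simp
        show ?thesis
          by (simp only: smooth[OF \<mu> s(1) m p] smooth[OF \<nu> s(2) m p] gauss_smoothing_eq[OF \<mu> \<nu> s char])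
      qed
      then show ?thesis
        by (subst (1 2) integral_eq_nn_integral) (auto simp: b)
    qed
    with lim[OF \<mu> s(1) h b] lim[OF \<nu> s(2) h b] show ?thesis
      by (simp add: LIMSEQ_unique)
  qed
  have closed: "measure \<mu> C = measure \<nu> C" if C: "closed C" for C
  proof (cases "C = {}")
    case False
    \<comment> \<open>Continuous functions decreasing to the indicator of \<open>C\<close>. For
      empty \<open>C\<close> the value of \<open>infdist\<close> is 0 by convention, hence the
      separate case.\<close>
    define h where "h n x = max 0 (1 - real n * infdist x C)" for n and x :: 'a
    have hc: "continuous_on UNIV (h n)" for n
      unfolding h_def by (intro continuous_intros)
    have hb: "0 \<le> h n x" "h n x \<le> 1" for n x
      by (auto simp: h_def infdist_nonneg)
    have hl: "(\<lambda>n. h n x) \<longlonglongrightarrow> indicator C x" for x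
    proof (cases "x \<in> C")
      case True
      then have "h n x = 1" for n by (simp add: h_def)
      with True show ?thesis by simp
    next
      case nx: False
      then have d: "0 < infdist x C"
        using C False infdist_pos_not_in_closed by blast
      obtain N where N: "1 < real N * infdist x C" using reals_Archimedean3[OF d] by blast
      have "\<forall>\<^sub>F n in sequentially. h n x = 0"
        using eventually_ge_at_top[of N]
      proof eventually_elim
        case (elim n)
        then have "real N * infdist x C \<le> real n * infdist x C"
          using d by (intro mult_right_mono) auto
        with N show ?case by (simp add: h_def)
      qed
      then show ?thesis using nx by (simp add: tendsto_eventually)
    qed
    have "(\<lambda>n. LINT x|\<mu>. h n x) \<longlonglongrightarrow> (LINT x|\<mu>. indicator C x)"
      if "prob_space \<mu>" and [measurable_cong, simp]: "sets \<mu> = sets borel" for \<mu> :: "'a measure"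
    proof -
      interpret prob_space \<mu> by fact
      have [measurable]: "h n \<in> borel_measurable borel" for n using hc by (rule borel_measurable_continuous_onI)
      have [measurable]: "C \<in> sets borel" using C by simp
      show ?thesis
        by (rule integral_dominated_convergence[where w="\<lambda>_. 1"]) (use hb hl in auto)
    qed
    from this[OF \<mu> s(1)] this[OF \<nu> s(2)] have "(LINT x|\<mu>. indicator C x :: real) = (LINT x|\<nu>. indicator C x)"
      by (simp add: eqh[OF hc hb] LIMSEQ_unique)
    then show ?thesis using C by (simp add: sets_eq_imp_space_eq[OF s(1)] sets_eq_imp_space_eq[OF s(2)])
  qed simp
  interpret \<mu>: prob_space \<mu> by fact
  interpret \<nu>: prob_space \<nu> by fact
  show ?thesis
  proof (rule measure_eqI_generator_eq[where E="Collect closed" and \<Omega>=UNIV and A="\<lambda>_. UNIV"])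
    show "Int_stable (Collect closed :: 'a set set)" by (auto simp: Int_stable_def)
    show "sets \<mu> = sigma_sets UNIV (Collect closed)" "sets \<nu> = sigma_sets UNIV (Collect closed)"
      by (simp_all add: borel_eq_closed)
    show "emeasure \<mu> X = emeasure \<nu> X" if "X \<in> Collect closed" for X
      using that closed by (simp add: \<mu>.emeasure_eq_measure \<nu>.emeasure_eq_measure)
  qed auto
qed

subsection \<open>Hermite polynomials\<close>

text \<open>The three-term recurrence in the type of polynomials, where integrals against the normal
  law reduce to moments; \<open>hermite_eq\<close> ties it to the Rodrigues formula of
  \<open>hermite\<close>.\<close>

fun herm :: "nat \<Rightarrow> real poly" where
  "herm 0 = 1"
| "herm (Suc 0) = [:0, 1:]"
| "herm (Suc (Suc n)) = [:0, 1:] * herm (Suc n) - smult (real (Suc n)) (herm n)"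

lemma pderiv_herm_Suc: "pderiv (herm (Suc n)) = smult (real (Suc n)) (herm n)"
proof (induction n rule: induct_nat_012)
  case (ge2 n)
  have "pderiv (herm (Suc (Suc (Suc n)))) = herm (Suc (Suc n)) +
     ([:0, 1:] * smult (real (Suc (Suc n))) (herm (Suc n)) - smult (real (Suc (Suc n))) (smult (real (Suc n)) (herm n)))"
    by (simp only: herm.simps(3)[of "Suc n"] pderiv_diff pderiv_mult pderiv_smult ge2 pderiv_pCons) (simp add: pderiv_pCons)
  also have "\<dots> = herm (Suc (Suc n)) + smult (real (Suc (Suc n))) ([:0, 1:] * herm (Suc n) - smult (real (Suc n)) (herm n))"
    by (simp add: smult_diff_right)
  also have "\<dots> = smult (real (Suc (Suc (Suc n)))) (herm (Suc (Suc n)))"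
    by (simp only: herm.simps(3)[symmetric]) (simp add: poly_eq_poly_eq_iff[symmetric] fun_eq_iff algebra_simps)
  finally show ?case .
qed (simp_all add: pderiv_pCons numeral_2_eq_2 pderiv_diff pderiv_mult pderiv_smult)

text \<open>The raising operator x - d/dx, which is what differentiating a polynomial times exp
  (-t^2 / 2) produces up to sign.\<close>

lemma herm_Suc: "herm (Suc n) = [:0, 1:] * herm n - pderiv (herm n)"
  by (cases n) (simp_all add: pderiv_herm_Suc del: herm.simps(3), simp)

lemma hermite_eq: "hermite n y = poly (herm n) y"
proof -
  have "(deriv ^^ n) (\<lambda>t. exp (- (t\<^sup>2 / 2))) = (\<lambda>t. (-1) ^ n * poly (herm n) t * exp (- (t\<^sup>2 / 2)))"
  proof (induction n)
    case (Suc n)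
    have "deriv (\<lambda>t. (-1) ^ n * poly (herm n) t * exp (- (t\<^sup>2 / 2))) t =
      (-1) ^ Suc n * poly (herm (Suc n)) t * exp (- (t\<^sup>2 / 2))" for t :: real
      by (rule DERIV_imp_deriv)
         (auto intro!: derivative_eq_intros simp: herm_Suc algebra_simps)
    with Suc show ?case by simp
  qed simp
  then have "hermite n y = ((-1) ^ n * (-1) ^ n) * (exp (y\<^sup>2 / 2) * exp (- (y\<^sup>2 / 2))) * poly (herm n) y"
    by (simp add: hermite_def mult_ac)
  also have "(-1) ^ n * (-1) ^ n = (1::real)" by (simp add: power_mult_distrib[symmetric])
  finally show ?thesis by (simp add: exp_minus)
qed

lemma hermite_measurable [measurable]: "hermite n \<in> borel_measurable borel"
  by (simp add: hermite_eq[abs_def] borel_measurable_continuous_onI continuous_intros)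

lemma hermite_0 [simp]: "hermite 0 y = 1"
  by (simp add: hermite_eq)

lemma integrable_std_normal_poly: "integrable \<phi> (poly p)"
proof -
  have "poly p = (\<lambda>x. \<Sum>i\<le>degree p. coeff p i * x ^ i)" by (simp add: poly_altdef fun_eq_iff)
  then show ?thesis
    by (auto intro!: integrable_std_normal_distribution_moment)
qed

text \<open>Stein's identity on monomials, read off from the closed formulas for the moments. At
  \<open>k = 0\<close> the truncated \<open>k - 1\<close> is harmless because of the factor
  0.\<close>

lemma std_normal_moment_Suc:
  "(LINT x|\<phi>. x ^ Suc k) = real k * (LINT x|\<phi>. x ^ (k - 1))"
proof (cases "even k")
  case True
  then obtain j where j: "k = 2 * j" by (elim evenE)
  show ?thesis
  proof (cases j)
    case 0
    then show ?thesis using integral_std_normal_distribution_moment_odd[of 1] j by simp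
  next
    case (Suc i)
    then have "odd (k - 1)" "odd (Suc k)" using j by auto
    then show ?thesis
      using integral_std_normal_distribution_moment_odd[of "k - 1"]
        integral_std_normal_distribution_moment_odd[of "Suc k"] by simp
  qed
next
  case False
  then obtain j where j: "k = 2 * j + 1" by (elim oddE)
  have "(LINT x|\<phi>. x ^ Suc k) = fact (2 * Suc j) / (2 ^ Suc j * fact (Suc j))"
    using std_normal_distribution_even_moments(1)[of "Suc j"] j by simp
  also have "\<dots> = real k * (fact (2 * j) / (2 ^ j * fact j))"
  proof -
    have "fact (2 * Suc j) = (2 * (real j + 1)) * ((2 * real j + 1) * fact (2 * j))"
      by (simp add: algebra_simps)
    moreover have "2 ^ Suc j * fact (Suc j) = (2 * (real j + 1)) * (2 ^ j * fact j)"
      by (simp add: algebra_simps)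
    ultimately have "fact (2 * Suc j) / (2 ^ Suc j * fact (Suc j)) = ((2 * real j + 1) * fact (2 * j)) / (2 ^ j * fact j)"
      by (simp only: mult_divide_mult_cancel_left_if) simp
    then show ?thesis by (simp add: j)
  qed
  also have "(fact (2 * j) / (2 ^ j * fact j)) = (LINT x|\<phi>. x ^ (k - 1))"
    using std_normal_distribution_even_moments(1)[of j] j by simp
  finally show ?thesis .
qed

lemma pderiv_sum: "pderiv (\<Sum>i\<in>A. f i) = (\<Sum>i\<in>A. pderiv (f i))"
  by (induction A rule: infinite_finite_induct) (auto simp: pderiv_add)

lemma stein_poly:
  "(LINT x|\<phi>. x * poly p x) = (LINT x|\<phi>. poly (pderiv p) x)"
proof -
  have i: "integrable \<phi> (\<lambda>x. x ^ k :: real)" for k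
    by (rule integrable_std_normal_distribution_moment)
  have 1: "(LINT x|\<phi>. x * poly (monom a k) x) = (LINT x|\<phi>. poly (pderiv (monom a k)) x)"
    for a k
  proof -
    have "(LINT x|\<phi>. x * poly (monom a k) x) = (LINT x|\<phi>. a * x ^ Suc k)"
      by (intro Bochner_Integration.integral_cong refl) (simp add: poly_monom)
    also have "\<dots> = (LINT x|\<phi>. poly (pderiv (monom a k)) x)"
      by (simp only: integral_mult_right_zero std_normal_moment_Suc pderiv_monom poly_monom) simp
    finally show ?thesis .
  qed
  have 2: "integrable \<phi> (\<lambda>x. x * poly q x)" for q
  proof -
    have "poly ([:0, 1:] * q) = (\<lambda>x. x * poly q x)" by (simp add: fun_eq_iff)
    then show ?thesis using integrable_std_normal_poly[of "[:0, 1:] * q"] by metis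
  qed
  have "(LINT x|\<phi>. x * poly p x) =
      (LINT x|\<phi>. (\<Sum>i\<le>degree p. x * poly (monom (coeff p i) i) x))"
    by (subst poly_as_sum_of_monoms[of p, symmetric]) (simp only: poly_sum sum_distrib_left)
  also have "\<dots> = (\<Sum>i\<le>degree p. LINT x|\<phi>. poly (pderiv (monom (coeff p i) i)) x)"
    by (subst Bochner_Integration.integral_sum) (simp_all only: 1 2)
  also have "\<dots> = (LINT x|\<phi>. (\<Sum>i\<le>degree p. poly (pderiv (monom (coeff p i) i)) x))"
    by (rule Bochner_Integration.integral_sum[symmetric]) (rule integrable_std_normal_poly)
  also have "\<dots> = (LINT x|\<phi>. poly (pderiv p) x)"
    using arg_cong[OF poly_as_sum_of_monoms[of p], of pderiv]
    by (simp only: poly_sum[symmetric] pderiv_sum)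
  finally show ?thesis .
qed

lemma stein_poly_affine:
  "(LINT w|\<phi>. w * poly p (a + c * w)) = c * (LINT w|\<phi>. poly (pderiv p) (a + c * w))"
proof -
  have "(LINT w|\<phi>. w * poly p (a + c * w)) = (LINT w|\<phi>. w * poly (pcompose p [:a, c:]) w)"
    by (simp add: poly_pcompose mult.commute)
  also have "\<dots> = (LINT w|\<phi>. poly (pderiv (pcompose p [:a, c:])) w)"
    by (rule stein_poly)
  also have "\<dots> = (LINT w|\<phi>. c * poly (pderiv p) (a + c * w))"
    by (intro Bochner_Integration.integral_cong refl) (simp add: pderiv_pcompose poly_pcompose pderiv_pCons mult.commute)
  finally show ?thesis by simp
qed

lemma integrable_std_normal_poly_affine: "integrable \<phi> (\<lambda>w. poly p (a + c * w))"
proof -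
  have "(\<lambda>w. poly p (a + c * w)) = poly (pcompose p [:a, c:])" by (simp add: fun_eq_iff poly_pcompose mult.commute)
  then show ?thesis by (simp add: integrable_std_normal_poly)
qed

text \<open>Hermite polynomials are eigenfunctions of the Ornstein--Uhlenbeck operator. In the
  induction Stein's identity produces c^2 = 1 - \<rho>^2 times the lower term, and its part 1
  cancels against the last term of the recurrence.\<close>

lemma integral_herm_affine:
  assumes "\<rho>\<^sup>2 + c\<^sup>2 = 1"
  shows "(LINT w|\<phi>. poly (herm n) (\<rho> * z + c * w)) = \<rho> ^ n * poly (herm n) z"
proof (induction n rule: induct_nat_012)
  case 0
  show ?case using std_normal.prob_space by simp
next
  case 1
  have "(LINT w|\<phi>. c * w) = 0"
    using integral_std_normal_distribution_moment_odd[of 1] by simp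
  moreover have "integrable \<phi> (\<lambda>w. c * w)"
    using integrable_std_normal_distribution_moment[of 1] by (intro integrable_mult_right) simp
  ultimately show ?case using std_normal.prob_space by simp
next
  case (ge2 n)
  let ?E = "\<lambda>f. LINT w|\<phi>. f w"
  note I = integrable_std_normal_poly_affine[of _ "\<rho> * z" c]
  have i: "integrable \<phi> (\<lambda>w. w * poly p (\<rho> * z + c * w))" for p
  proof -
    have "(\<lambda>w. w * poly p (\<rho> * z + c * w)) = poly ([:0, 1:] * pcompose p [:\<rho> * z, c:])"
      by (simp add: fun_eq_iff poly_pcompose mult.commute)
    then show ?thesis using integrable_std_normal_poly by metis
  qed
  have "?E (\<lambda>w. poly (herm (Suc (Suc n))) (\<rho> * z + c * w)) =
     ?E (\<lambda>w. \<rho> * z * poly (herm (Suc n)) (\<rho> * z + c * w) + c * (w * poly (herm (Suc n)) (\<rho> * z + c * w))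
        - real (Suc n) * poly (herm n) (\<rho> * z + c * w))"
    by (intro Bochner_Integration.integral_cong refl) (simp add: algebra_simps)
  also have "\<dots> = \<rho> * z * ?E (\<lambda>w. poly (herm (Suc n)) (\<rho> * z + c * w))
      + c * ?E (\<lambda>w. w * poly (herm (Suc n)) (\<rho> * z + c * w))
      - real (Suc n) * ?E (\<lambda>w. poly (herm n) (\<rho> * z + c * w))"
    using I i by simp
  also have "\<dots> = \<rho> * z * (\<rho> ^ Suc n * poly (herm (Suc n)) z) + c\<^sup>2 * real (Suc n) * (\<rho> ^ n * poly (herm n) z)
      - real (Suc n) * (\<rho> ^ n * poly (herm n) z)"
    by (simp only: stein_poly_affine pderiv_herm_Suc poly_smult integral_mult_right_zero ge2 power2_eq_square)
  also have "c\<^sup>2 = 1 - \<rho>\<^sup>2" using assms by simp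
  finally show ?case by (simp add: algebra_simps power2_eq_square)
qed

text \<open>The raising operator x - d/dx is the adjoint of d/dx under the normal law. Applied to a
  Hermite polynomial it lowers both indices by one and leaves one factor of the factorial.\<close>

lemma integral_herm_Suc_mult:
  "(LINT x|\<phi>. poly (herm (Suc n)) x * poly p x) =
   (LINT x|\<phi>. poly (herm n) x * poly (pderiv p) x)"
proof -
  have "(LINT x|\<phi>. poly (herm (Suc n)) x * poly p x) =
    (LINT x|\<phi>. x * poly (herm n * p) x - poly (pderiv (herm n) * p) x)"
    by (intro Bochner_Integration.integral_cong refl) (simp add: herm_Suc algebra_simps)
  also have "\<dots> = (LINT x|\<phi>. x * poly (herm n * p) x) -
      (LINT x|\<phi>. poly (pderiv (herm n) * p) x)"
  proof (rule Bochner_Integration.integral_diff)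
    show "integrable \<phi> (\<lambda>x. x * poly (herm n * p) x)"
    proof -
      have "poly ([:0, 1:] * (herm n * p)) = (\<lambda>x. x * poly (herm n * p) x)" by (simp add: fun_eq_iff)
      then show ?thesis using integrable_std_normal_poly by metis
    qed
  qed (rule integrable_std_normal_poly)
  also have "\<dots> = (LINT x|\<phi>. poly (pderiv (herm n * p)) x - poly (pderiv (herm n) * p) x)"
    by (simp only: stein_poly) (rule Bochner_Integration.integral_diff[symmetric]; rule integrable_std_normal_poly)
  also have "\<dots> = (LINT x|\<phi>. poly (herm n) x * poly (pderiv p) x)"
    by (intro Bochner_Integration.integral_cong refl) (simp add: pderiv_mult algebra_simps)
  finally show ?thesis .
qed

lemma integral_herm_mult_herm:
  "(LINT x|\<phi>. poly (herm j) x * poly (herm k) x) = (if j = k then fact j else 0)"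
proof (induction j arbitrary: k)
  case 0
  show ?case
  proof (cases k)
    case 0
    then show ?thesis using std_normal.prob_space by simp
  next
    case (Suc n)
    then show ?thesis using integral_herm_Suc_mult[of n 1] by (simp add: pderiv_1)
  qed
next
  case (Suc j)
  show ?case
  proof (cases k)
    case 0
    then show ?thesis using integral_herm_Suc_mult[of j 1] by (simp add: pderiv_1)
  next
    case k: (Suc n)
    have "(LINT x|\<phi>. poly (herm (Suc j)) x * poly (herm k) x) =
       (LINT x|\<phi>. real (Suc n) * (poly (herm j) x * poly (herm n) x))"
      unfolding integral_herm_Suc_mult k pderiv_herm_Suc
      by (intro Bochner_Integration.integral_cong refl) simp
    then show ?thesis using Suc[of n] k by simp
  qed
qed

section \<open>Hermite polynomials in several variables\<close>

lemma prod_Basis_vec: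
  fixes g :: "real ^ 'p \<Rightarrow> 'b::comm_monoid_mult"
  shows "(\<Prod>b\<in>Basis. g b) = (\<Prod>i\<in>UNIV. g (axis i 1))"
proof -
  have inj: "inj_on (\<lambda>i::'p. axis i (1::real)) UNIV" by (auto intro!: injI simp: axis_eq_axis)
  have B: "(Basis :: (real ^ 'p) set) = (\<lambda>i. axis i 1) ` UNIV" by (auto simp: Basis_vec_def)
  show ?thesis unfolding B by (subst prod.reindex[OF inj]) (simp add: o_def)
qed

lemma
  fixes h :: "'p::finite \<Rightarrow> real \<Rightarrow> 'b::{real_normed_field,banach,second_countable_topology}"
  assumes "\<And>i. integrable \<phi> (h i)"
  shows integrable_gauss_vec_prod: "integrable gauss (\<lambda>s::real ^ 'p. \<Prod>i\<in>UNIV. h i (s $ i))"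
    and integral_gauss_vec_prod:
      "(LINT s|gauss. (\<Prod>i\<in>UNIV. h i ((s::real ^ 'p) $ i))) = (\<Prod>i\<in>UNIV. LINT x|\<phi>. h i x)"
proof -
  \<comment> \<open>Products for \<open>gauss\<close> run over basis vectors, those of
    \<open>hermite_multi\<close> over indices; \<open>ix\<close> inverts
    \<open>axis i 1\<close>.\<close>
  define ix where "ix b = (SOME i. b = axis i (1::real))" for b :: "real ^ 'p"
  have ix: "ix (axis i 1) = i" for i by (simp add: ix_def axis_eq_axis)
  have *: "(\<Prod>i\<in>UNIV. h i (s $ i)) = (\<Prod>b\<in>Basis. h (ix b) (s \<bullet> b))" for s
    by (simp add: prod_Basis_vec ix inner_axis)
  show "integrable gauss (\<lambda>s::real ^ 'p. \<Prod>i\<in>UNIV. h i (s $ i))"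
    unfolding * by (rule integrable_gauss_prod) (rule assms)
  show "(LINT s|gauss. (\<Prod>i\<in>UNIV. h i ((s::real ^ 'p) $ i))) = (\<Prod>i\<in>UNIV. LINT x|\<phi>. h i x)"
    unfolding * by (subst integral_gauss_prod) (simp_all add: assms prod_Basis_vec ix)
qed

lemma vec_nth_measurable [measurable]: "(\<lambda>x::real ^ 'p::finite. x $ i) \<in> borel_measurable borel"
  by (intro borel_measurable_continuous_onI continuous_intros)

lemma hermite_multi_measurable [measurable]: "hermite_multi l \<in> borel_measurable borel"
  unfolding hermite_multi_def by measurable

lemma hermite_multi_single: "hermite_multi (\<lambda>i'. if i' = i then n else 0) x = hermite n (x $ i)"
proof -
  have "hermite_multi (\<lambda>i'. if i' = i then n else 0) x = (\<Prod>i'\<in>UNIV. if i' = i then hermite n (x $ i) else 1)"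
    unfolding hermite_multi_def by (intro prod.cong) auto
  then show ?thesis by simp
qed

lemma hermite_multi_0 [simp]: "hermite_multi (\<lambda>_. 0) s = 1"
  by (simp add: hermite_multi_def)

lemma
  shows integrable_hermite_multi_mult: "integrable gauss (\<lambda>s. hermite_multi l s * hermite_multi l' s)"
    and integral_hermite_multi_mult: "(LINT s|gauss. hermite_multi l s * hermite_multi l' s) =
      (if l = l' then (\<Prod>i\<in>UNIV. fact (l i)) else 0)"
proof -
  have *: "hermite_multi l s * hermite_multi l' s = (\<Prod>i\<in>UNIV. poly (herm (l i) * herm (l' i)) (s $ i))" for s
    by (simp add: hermite_multi_def hermite_eq prod.distrib)
  show "integrable gauss (\<lambda>s. hermite_multi l s * hermite_multi l' s)"
    unfolding * by (rule integrable_gauss_vec_prod) (rule integrable_std_normal_poly)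
  have "(LINT s|gauss. hermite_multi l s * hermite_multi l' s) =
      (\<Prod>i\<in>UNIV. if l i = l' i then fact (l i) else 0)"
  proof -
    have "poly (p * q) = (\<lambda>x. poly p x * poly q x)" for p q :: "real poly" by (simp add: fun_eq_iff)
    then have E: "(LINT x|\<phi>. poly (herm (l i) * herm (l' i)) x) =
        (if l i = l' i then fact (l i) else 0)" for i
      by (simp only: integral_herm_mult_herm)
    show ?thesis
      unfolding * integral_gauss_vec_prod[of "\<lambda>i. poly (herm (l i) * herm (l' i))", OF integrable_std_normal_poly] E ..
  qed
  also have "\<dots> = (if l = l' then (\<Prod>i\<in>UNIV. fact (l i)) else 0)"
    by (auto simp: fun_eq_iff intro: prod_zero)
  finally show "(LINT s|gauss. hermite_multi l s * hermite_multi l' s) =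
      (if l = l' then (\<Prod>i\<in>UNIV. fact (l i)) else 0)" .
qed

lemma integrable_hermite_multi: "integrable gauss (hermite_multi l)"
  using integrable_hermite_multi_mult[of l "\<lambda>_. 0"] by simp

text \<open>The eigenvalue depends on the multi-index only through its total degree, which is why
  all truncations below are by total degree.\<close>

lemma integral_hermite_multi_affine:
  assumes "\<rho>\<^sup>2 + c\<^sup>2 = 1"
  shows "(LINT u|gauss. hermite_multi l (\<rho> *\<^sub>R s + c *\<^sub>R u)) = \<rho> ^ (\<Sum>i\<in>UNIV. l i) * hermite_multi l s"
proof -
  have "(LINT u|gauss. hermite_multi l (\<rho> *\<^sub>R s + c *\<^sub>R u)) = (\<Prod>i\<in>UNIV. \<rho> ^ l i * hermite (l i) (s $ i))"
    using integral_gauss_vec_prod[of "\<lambda>i x. poly (herm (l i)) (\<rho> * s $ i + c * x)"]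
    by (simp add: hermite_multi_def hermite_eq integrable_std_normal_poly_affine integral_herm_affine[OF assms])
  then show ?thesis by (simp add: hermite_multi_def prod.distrib power_sum)
qed

subsection \<open>The Ornstein--Uhlenbeck semigroup\<close>

lemma integrable_mult_sq:
  fixes f g :: "'a \<Rightarrow> real"
  assumes [measurable]: "f \<in> borel_measurable M" "g \<in> borel_measurable M"
    and "integrable M (\<lambda>x. (f x)\<^sup>2)" "integrable M (\<lambda>x. (g x)\<^sup>2)"
  shows "integrable M (\<lambda>x. f x * g x)"
proof (rule Bochner_Integration.integrable_bound)
  show "integrable M (\<lambda>x. (f x)\<^sup>2 + (g x)\<^sup>2)" using assms by simp
  have "\<bar>f x * g x\<bar> \<le> (f x)\<^sup>2 + (g x)\<^sup>2" for x
  proof -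
    have "0 \<le> (\<bar>f x\<bar> - \<bar>g x\<bar>)\<^sup>2" "0 \<le> \<bar>f x\<bar> * \<bar>g x\<bar>" by simp_all
    then have "2 * (\<bar>f x\<bar> * \<bar>g x\<bar>) \<le> (f x)\<^sup>2 + (g x)\<^sup>2" by (simp add: power2_diff)
    then show ?thesis using \<open>0 \<le> \<bar>f x\<bar> * \<bar>g x\<bar>\<close> unfolding abs_mult by linarith
  qed
  then show "AE x in M. norm (f x * g x) \<le> norm ((f x)\<^sup>2 + (g x)\<^sup>2)" by simp
qed measurable

lemma integral_Cauchy_Schwarz:
  fixes f g :: "'a \<Rightarrow> real"
  assumes [measurable]: "f \<in> borel_measurable M" "g \<in> borel_measurable M"
    and f: "integrable M (\<lambda>x. (f x)\<^sup>2)" and g: "integrable M (\<lambda>x. (g x)\<^sup>2)"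
  shows "(LINT x|M. f x * g x)\<^sup>2 \<le> (LINT x|M. (f x)\<^sup>2) * (LINT x|M. (g x)\<^sup>2)"
proof -
  define a b c where "a = (LINT x|M. (f x)\<^sup>2)" "b = (LINT x|M. (g x)\<^sup>2)" "c = (LINT x|M. f x * g x)"
  note fg = integrable_mult_sq[OF assms]
  have *: "0 \<le> a - 2 * t * c + t\<^sup>2 * b" for t
  proof -
    have "0 \<le> (LINT x|M. (f x - t * g x)\<^sup>2)" by simp
    also have "\<dots> = (LINT x|M. (f x)\<^sup>2 - 2 * t * (f x * g x) + t\<^sup>2 * (g x)\<^sup>2)"
      by (simp add: power2_diff power_mult_distrib algebra_simps)
    also have "\<dots> = a - 2 * t * c + t\<^sup>2 * b"
      using f g fg by (simp add: a_b_c_def)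
    finally show ?thesis .
  qed
  have "0 \<le> b" by (simp add: a_b_c_def)
  show ?thesis
  proof (cases "b = 0")
    case True
    have "c = 0"
    proof (rule ccontr)
      assume "c \<noteq> 0"
      \<comment> \<open>With \<open>b = 0\<close> the quadratic is linear in \<open>t\<close>, and
        this \<open>t\<close> gives it the value -1.\<close>
      then show False using *[of "(a + 1) / (2 * c)"] True by simp
    qed
    then show ?thesis using True by (simp add: a_b_c_def)
  next
    case False
    with \<open>0 \<le> b\<close> have "0 < b" by simp
    with *[of "c / b"] have "c\<^sup>2 / b \<le> a" by (simp add: power2_eq_square field_simps)
    with \<open>0 < b\<close> show ?thesis by (simp add: a_b_c_def field_simps)
  qed
qed

text \<open>The density of the normal law with mean \<rho> s and variance c^2 relative to the
  standard normal law; for \<rho>^2 + c^2 = 1 this is the Mehler kernel.\<close>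

definition mehler1 :: "real \<Rightarrow> real \<Rightarrow> real \<Rightarrow> real \<Rightarrow> real" where
  "mehler1 \<rho> c s x = exp (x\<^sup>2 / 2 - (x - \<rho> * s)\<^sup>2 / (2 * c\<^sup>2)) / c"

definition mehler :: "real \<Rightarrow> real \<Rightarrow> real ^ 'p \<Rightarrow> real ^ 'p \<Rightarrow> real" where
  "mehler \<rho> c s x = (\<Prod>i\<in>UNIV. mehler1 \<rho> c (s $ i) (x $ i))"

lemma mehler1_measurable [measurable]: "mehler1 \<rho> c s \<in> borel_measurable borel"
  unfolding mehler1_def[abs_def] by measurable

lemma mehler_measurable [measurable]:
  "(\<lambda>p. mehler \<rho> c (fst p) (snd p)) \<in> borel_measurable (borel \<Otimes>\<^sub>M borel)"
  "mehler \<rho> c s \<in> borel_measurable borel"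
  unfolding mehler_def[abs_def] mehler1_def by measurable

lemma mehler_nonneg: "0 < c \<Longrightarrow> 0 \<le> mehler \<rho> c s x"
  by (auto simp: mehler_def mehler1_def intro!: prod_nonneg)

lemma mehler_gauss_density:
  fixes s x :: "real ^ 'p"
  assumes "0 < c"
  shows "gauss_density ((x - \<rho> *\<^sub>R s) /\<^sub>R c) / c ^ DIM(real ^ 'p) = mehler \<rho> c s x * gauss_density x"
proof -
  have "std_normal_density (((x - \<rho> *\<^sub>R s) /\<^sub>R c) $ i) / c = mehler1 \<rho> c (s $ i) (x $ i) * std_normal_density (x $ i)" for i
  proof -
    have "- (((x - \<rho> *\<^sub>R s) /\<^sub>R c) $ i)\<^sup>2 / 2 = ((x $ i)\<^sup>2 / 2 - (x $ i - \<rho> * s $ i)\<^sup>2 / (2 * c\<^sup>2)) + - (x $ i)\<^sup>2 / 2"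
      by (simp add: power_mult_distrib power_inverse field_simps)
         (simp add: diff_divide_distrib[symmetric] power_divide)
    then show ?thesis
      unfolding std_normal_density_def mehler1_def by (simp only: exp_add) simp
  qed
  then show ?thesis
    by (simp add: gauss_density_def mehler_def prod_Basis_vec inner_axis prod.distrib[symmetric]
        prod_dividef[symmetric] flip: prod_constant)
qed

lemma distr_gauss_mehler:
  fixes s :: "real ^ 'p"
  assumes "0 < c"
  shows "distr gauss borel (\<lambda>u. \<rho> *\<^sub>R s + c *\<^sub>R u) = density gauss (\<lambda>x. ennreal (mehler \<rho> c s x))"
  unfolding distr_gauss_affine[OF assms] mehler_gauss_density[OF assms]
  unfolding gauss_def by (subst density_density_eq) (auto simp: ennreal_mult mehler_nonneg assms mult.commute)

lemma integral_gauss_mehler: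
  fixes s :: "real ^ 'p" and f :: "real ^ 'p \<Rightarrow> real"
  assumes c: "0 < c" and [measurable]: "f \<in> borel_measurable borel"
  shows "(LINT u|gauss. f (\<rho> *\<^sub>R s + c *\<^sub>R u)) = (LINT x|gauss. mehler \<rho> c s x * f x)"
proof -
  have "(LINT u|gauss. f (\<rho> *\<^sub>R s + c *\<^sub>R u)) = (LINT x|distr gauss borel (\<lambda>u. \<rho> *\<^sub>R s + c *\<^sub>R u). f x)"
    by (rule integral_distr[symmetric]) auto
  also have "\<dots> = (LINT x|gauss. mehler \<rho> c s x * f x)"
    unfolding distr_gauss_mehler[OF c]
    by (rule integral_real_density) (auto simp: mehler_nonneg c)
  finally show ?thesis .
qed

lemma
  assumes c: "0 < c" "\<rho>\<^sup>2 + c\<^sup>2 = 1"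
  shows integrable_mehler1_sq: "integrable \<phi> (\<lambda>x. (mehler1 \<rho> c s x)\<^sup>2)"
    and integral_mehler1_sq: "(LINT x|\<phi>. (mehler1 \<rho> c s x)\<^sup>2) =
      exp (\<rho>\<^sup>2 * s\<^sup>2 / (1 + \<rho>\<^sup>2)) / (c * sqrt (1 + \<rho>\<^sup>2))"
proof -
  \<comment> \<open>Standard deviation and, in the next line, mean found by completing the square in
    x: the normal density times the squared kernel is \<open>K\<close> times a normal
    density.\<close>
  define \<sigma> where "\<sigma> = c / sqrt (1 + \<rho>\<^sup>2)"
  define \<mu> where "\<mu> = 2 * \<rho> * s / (1 + \<rho>\<^sup>2)"
  define K where "K = exp (\<rho>\<^sup>2 * s\<^sup>2 / (1 + \<rho>\<^sup>2)) / (c * sqrt (1 + \<rho>\<^sup>2))"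
  have r: "0 < 1 + \<rho>\<^sup>2" by (simp add: add_pos_nonneg)
  have \<sigma>: "0 < \<sigma>" "\<sigma>\<^sup>2 = c\<^sup>2 / (1 + \<rho>\<^sup>2)" using c r by (auto simp: \<sigma>_def power_divide)
  have c2: "c\<^sup>2 = 1 - \<rho>\<^sup>2" "0 < 1 - \<rho>\<^sup>2" using c zero_less_power[of c 2] by linarith+
  have eq: "std_normal_density x * (mehler1 \<rho> c s x)\<^sup>2 = K * normal_density \<mu> \<sigma> x" for x
  proof -
    have e: "- x\<^sup>2 / 2 + 2 * (x\<^sup>2 / 2 - (x - \<rho> * s)\<^sup>2 / (2 * c\<^sup>2)) =
      \<rho>\<^sup>2 * s\<^sup>2 / (1 + \<rho>\<^sup>2) + (- (x - \<mu>)\<^sup>2 / (2 * \<sigma>\<^sup>2))"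
      using c2 r unfolding \<sigma>(2) \<mu>_def c2(1)
      by (simp add: divide_simps) (simp add: algebra_simps power2_eq_square)
    have "std_normal_density x * (mehler1 \<rho> c s x)\<^sup>2 = 1 / (sqrt (2 * pi) * c\<^sup>2) *
       exp (- x\<^sup>2 / 2 + 2 * (x\<^sup>2 / 2 - (x - \<rho> * s)\<^sup>2 / (2 * c\<^sup>2)))"
      unfolding std_normal_density_def mehler1_def exp_add exp_double by (simp add: power_divide)
    also have "1 / (sqrt (2 * pi) * c\<^sup>2) = 1 / (c * sqrt (1 + \<rho>\<^sup>2)) * (1 / sqrt (2 * pi * \<sigma>\<^sup>2))"
    proof -
      have "sqrt (2 * pi * \<sigma>\<^sup>2) = sqrt (2 * pi) * \<sigma>" using \<sigma>(1) by (simp add: real_sqrt_mult)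
      moreover have "0 < sqrt (1 + \<rho>\<^sup>2)" using r by simp
      ultimately show ?thesis using c by (simp add: \<sigma>_def power2_eq_square)
    qed
    finally show ?thesis
      unfolding e exp_add normal_density_def K_def by simp
  qed
  show "integrable \<phi> (\<lambda>x. (mehler1 \<rho> c s x)\<^sup>2)"
    by (subst integrable_real_density) (use \<sigma> in \<open>auto simp: eq\<close>)
  show "(LINT x|\<phi>. (mehler1 \<rho> c s x)\<^sup>2) = exp (\<rho>\<^sup>2 * s\<^sup>2 / (1 + \<rho>\<^sup>2)) / (c * sqrt (1 + \<rho>\<^sup>2))"
    by (subst integral_real_density) (use \<sigma> in \<open>auto simp: eq K_def\<close>)
qed

text \<open>\<open>h s\<close> is the squared norm of the kernel section at \<open>s\<close>, so its
  mean is the squared Hilbert--Schmidt norm in dimension one. The value is the sum of the squared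
  eigenvalues \<rho>^(2 n).\<close>

lemma
  assumes c: "0 < c" "\<rho>\<^sup>2 + c\<^sup>2 = 1"
  defines "h \<equiv> \<lambda>s. exp (\<rho>\<^sup>2 * s\<^sup>2 / (1 + \<rho>\<^sup>2)) / (c * sqrt (1 + \<rho>\<^sup>2))"
  shows integrable_mehler1_diag: "integrable \<phi> h"
    and integral_mehler1_diag: "(LINT s|\<phi>. h s) = 1 / (1 - \<rho>\<^sup>2)"
proof -
  define \<sigma> where "\<sigma> = sqrt (1 + \<rho>\<^sup>2) / c"
  have r: "0 < 1 + \<rho>\<^sup>2" by (simp add: add_pos_nonneg)
  have \<sigma>: "0 < \<sigma>" "\<sigma>\<^sup>2 = (1 + \<rho>\<^sup>2) / c\<^sup>2" using c r by (auto simp: \<sigma>_def power_divide)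
  have c2: "c\<^sup>2 = 1 - \<rho>\<^sup>2" "0 < 1 - \<rho>\<^sup>2" using c zero_less_power[of c 2] by linarith+
  have eq: "std_normal_density x * h x = 1 / (1 - \<rho>\<^sup>2) * normal_density 0 \<sigma> x" for x
  proof -
    have e: "- x\<^sup>2 / 2 + \<rho>\<^sup>2 * x\<^sup>2 / (1 + \<rho>\<^sup>2) = - (x - 0)\<^sup>2 / (2 * \<sigma>\<^sup>2)"
      using c2 r unfolding \<sigma>(2) c2(1)
      by (simp add: divide_simps) (simp add: algebra_simps power2_eq_square)
    have "std_normal_density x * h x = 1 / (sqrt (2 * pi) * (c * sqrt (1 + \<rho>\<^sup>2))) *
       exp (- x\<^sup>2 / 2 + \<rho>\<^sup>2 * x\<^sup>2 / (1 + \<rho>\<^sup>2))"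
      unfolding std_normal_density_def h_def exp_add by simp
    also have "1 / (sqrt (2 * pi) * (c * sqrt (1 + \<rho>\<^sup>2))) = 1 / (1 - \<rho>\<^sup>2) * (1 / sqrt (2 * pi * \<sigma>\<^sup>2))"
      
    proof -
      have "sqrt (2 * pi * \<sigma>\<^sup>2) = sqrt (2 * pi) * \<sigma>" using \<sigma>(1) by (simp add: real_sqrt_mult)
      moreover have "0 < sqrt (1 + \<rho>\<^sup>2)" using r by simp
      ultimately show ?thesis unfolding c2(1)[symmetric] using c by (simp add: \<sigma>_def power2_eq_square)
    qed
    finally show ?thesis
      unfolding e normal_density_def by simp
  qed
  have [measurable]: "h \<in> borel_measurable borel" unfolding h_def by measurable
  show "integrable \<phi> h"
    by (subst integrable_real_density) (use \<sigma> in \<open>auto simp: eq\<close>)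
  show "(LINT s|\<phi>. h s) = 1 / (1 - \<rho>\<^sup>2)"
    by (subst integral_real_density) (use \<sigma> in \<open>auto simp: eq\<close>)
qed

section \<open>The Mehler kernel minus its low-degree Hermite expansion\<close>

lemma finite_multi_index: "finite {l::'p::finite \<Rightarrow> nat. (\<Sum>i\<in>UNIV. l i) \<le> m}"
proof (rule finite_subset)
  show "{l::'p \<Rightarrow> nat. (\<Sum>i\<in>UNIV. l i) \<le> m} \<subseteq> PiE UNIV (\<lambda>_. {..m})"
    by (auto intro: order_trans[OF member_le_sum[of _ UNIV]])
qed (simp add: finite_PiE)

text \<open>In one variable the series splits into a head \<open>A\<close> of degree at most m and a
  tail \<open>B\<close> of size at most 2 q^(m + 1). The first summand of the constant bounds (A +
  B)^p - A^p by the mean value estimate \<open>pow\<close>. Expanding A^p gives the cube of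
  multi-indices with entries at most m; the second summand counts those of total degree above
  m.\<close>

lemma geometric_power_tail:
  fixes q :: real
  assumes q: "0 \<le> q" "q \<le> 1 / 2"
  shows "(1 / (1 - q)) ^ CARD('p::finite) - (\<Sum>l | (\<Sum>i\<in>UNIV. l (i::'p)) \<le> m. q ^ (\<Sum>i\<in>UNIV. l i))
    \<le> (real CARD('p) * 2 ^ CARD('p) + (real m + 1) ^ CARD('p)) * q ^ Suc m"
proof -
  let ?p = "CARD('p)"
  define A where "A = (\<Sum>k\<le>m. q ^ k)"
  define B where "B = q ^ Suc m / (1 - q)"
  have AB: "1 / (1 - q) = A + B"
    using q unfolding A_def B_def by (subst sum_gp0) (auto simp: field_simps)
  have A: "0 \<le> A" and B: "0 \<le> B" using q by (auto simp: A_def B_def intro!: sum_nonneg)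
  have le2: "1 / (1 - q) \<le> 2" using q by (simp add: field_simps)
  have B2: "B \<le> 2 * q ^ Suc m"
    using mult_left_mono[OF le2, of "q ^ Suc m"] q by (simp add: B_def)
  have pow: "x ^ n - y ^ n \<le> real n * x ^ (n - 1) * (x - y)" if "0 \<le> y" "y \<le> x" for x y :: real and n
  proof (induction n)
    case (Suc n)
    have "x ^ Suc n - y ^ Suc n = x ^ n * (x - y) + y * (x ^ n - y ^ n)" by (simp add: algebra_simps)
    also have "\<dots> \<le> x ^ n * (x - y) + x * (real n * x ^ (n - 1) * (x - y))"
      using Suc that by (intro add_left_mono mult_mono) (auto intro!: power_mono)
    also have "\<dots> = real (Suc n) * x ^ (Suc n - 1) * (x - y)"
      by (cases n) (auto simp: algebra_simps)
    finally show ?case .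
  qed simp
  have "(1 / (1 - q)) ^ ?p - A ^ ?p \<le> real ?p * (1 / (1 - q)) ^ (?p - 1) * (1 / (1 - q) - A)"
    using A B by (intro pow) (auto simp: AB)
  also have "\<dots> \<le> real ?p * 2 ^ (?p - 1) * (2 * q ^ Suc m)"
    using q A B B2 by (intro mult_mono power_mono le2) (auto simp: AB)
  also have "\<dots> = real ?p * 2 ^ ?p * q ^ Suc m"
    by (cases ?p) (auto simp: algebra_simps)
  finally have 1: "(1 / (1 - q)) ^ ?p \<le> A ^ ?p + real ?p * 2 ^ ?p * q ^ Suc m" by simp
  let ?L = "{l::'p \<Rightarrow> nat. (\<Sum>i\<in>UNIV. l i) \<le> m}" and ?C = "PiE (UNIV::'p set) (\<lambda>_. {..m})"
  have "A ^ ?p = (\<Prod>i\<in>(UNIV::'p set). \<Sum>k\<le>m. q ^ k)" by (simp add: A_def)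
  also have "\<dots> = (\<Sum>l\<in>?C. \<Prod>i\<in>UNIV. q ^ l i)" by (subst prod_sum_PiE) auto
  also have "\<dots> = (\<Sum>l\<in>?C. q ^ (\<Sum>i\<in>UNIV. l i))" by (simp add: power_sum)
  \<comment> \<open>An index of the cube outside \<open>?L\<close> has total degree at least m + 1,
    and q \<le> 1.\<close>
  also have "\<dots> \<le> (\<Sum>l\<in>?C. (if l \<in> ?L then q ^ (\<Sum>i\<in>UNIV. l i) else 0) + q ^ Suc m)"
    using q by (intro sum_mono) (auto simp del: power_Suc intro!: power_decreasing)
  also have "\<dots> = (\<Sum>l\<in>?C. (if l \<in> ?L then q ^ (\<Sum>i\<in>UNIV. l i) else 0)) + (real m + 1) ^ ?p * q ^ Suc m"
    by (simp add: sum.distrib card_PiE add.commute)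
  also have "(\<Sum>l\<in>?C. (if l \<in> ?L then q ^ (\<Sum>i\<in>UNIV. l i) else 0)) \<le> (\<Sum>l\<in>?L. q ^ (\<Sum>i\<in>UNIV. l i))"
    using q by (subst sum.inter_restrict[symmetric])
      (auto intro!: sum_mono2 finite_multi_index finite_PiE)
  finally show ?thesis using 1 by (simp add: algebra_simps)
qed


lemma
  fixes s :: "real ^ 'p::finite"
  assumes c: "0 < c" "\<rho>\<^sup>2 + c\<^sup>2 = 1"
  shows integrable_mehler_sq: "integrable gauss (\<lambda>x. (mehler \<rho> c s x)\<^sup>2)"
    and integral_mehler_sq: "(LINT x|gauss. (mehler \<rho> c s x)\<^sup>2) =
      (\<Prod>i\<in>UNIV. exp (\<rho>\<^sup>2 * (s $ i)\<^sup>2 / (1 + \<rho>\<^sup>2)) / (c * sqrt (1 + \<rho>\<^sup>2)))"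
  using integrable_gauss_vec_prod[of "\<lambda>i x. (mehler1 \<rho> c (s $ i) x)\<^sup>2", OF integrable_mehler1_sq[OF c]]
    integral_gauss_vec_prod[of "\<lambda>i x. (mehler1 \<rho> c (s $ i) x)\<^sup>2", OF integrable_mehler1_sq[OF c]]
  by (simp_all add: mehler_def prod_power_distrib integral_mehler1_sq[OF c])

text \<open>Subtracting from the Mehler kernel its Hermite expansion up to order \<open>m\<close> does not change the
  integral operator on functions without low order Hermite coefficients, and the squared
  Hilbert--Schmidt norm of the difference is
  \<open>(1 - \<rho>\<^sup>2)\<^sup>-\<^sup>p\<close> minus the beginning of its own power series.\<close>

lemma ornstein_uhlenbeck_contraction:
  fixes f :: "real ^ 'p::finite \<Rightarrow> real"
  assumes f [measurable]: "f \<in> borel_measurable borel" and f2: "integrable gauss (\<lambda>x. (f x)\<^sup>2)"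
    and orth: "\<And>l. (\<Sum>i\<in>UNIV. l i) \<le> m \<Longrightarrow> (LINT x|gauss. f x * hermite_multi l x) = 0"
    and \<rho>: "\<rho>\<^sup>2 \<le> 1 / 2"
  defines "T \<equiv> \<lambda>s. LINT u|gauss. f (\<rho> *\<^sub>R s + sqrt (1 - \<rho>\<^sup>2) *\<^sub>R u)"
  shows "integrable gauss (\<lambda>s. (T s)\<^sup>2)"
    and "(LINT s|gauss. (T s)\<^sup>2) \<le>
      (real CARD('p) * 2 ^ CARD('p) + (real m + 1) ^ CARD('p)) * (\<rho>\<^sup>2) ^ Suc m * (LINT x|gauss. (f x)\<^sup>2)"
proof -
  define c where "c = sqrt (1 - \<rho>\<^sup>2)"
  have c: "0 < c" "\<rho>\<^sup>2 + c\<^sup>2 = 1" using \<rho> by (auto simp: c_def)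
  let ?L = "{l::'p \<Rightarrow> nat. (\<Sum>i\<in>UNIV. l i) \<le> m}"
  define d where "d l = (\<Sum>i\<in>UNIV. l i)" for l :: "'p \<Rightarrow> nat"
  define F where "F l = (\<Prod>i\<in>UNIV. fact (l i) :: real)" for l :: "'p \<Rightarrow> nat"
  have F: "0 < F l" for l by (auto simp: F_def intro!: prod_pos)
  define P where "P s x = (\<Sum>l\<in>?L. \<rho> ^ d l / F l * hermite_multi l s * hermite_multi l x)" for s x :: "real ^ 'p"
  \<comment> \<open>\<open>W s\<close> and \<open>R s\<close> are the squared norms in x of the
    kernel section at \<open>s\<close> and of its difference from \<open>P s\<close>.\<close>
  define W where "W s = (\<Prod>i\<in>UNIV. exp (\<rho>\<^sup>2 * (s $ i)\<^sup>2 / (1 + \<rho>\<^sup>2)) / (c * sqrt (1 + \<rho>\<^sup>2)))" for s :: "real ^ 'p"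
  define R where "R s = W s - (\<Sum>l\<in>?L. (\<rho>\<^sup>2) ^ d l / F l * (hermite_multi l s * hermite_multi l s))" for s :: "real ^ 'p"
  note [measurable] = mehler_measurable(2)
  have [measurable]: "P s \<in> borel_measurable borel" for s unfolding P_def by measurable
  have H2: "integrable gauss (\<lambda>x. (hermite_multi l x)\<^sup>2)" for l :: "'p \<Rightarrow> nat"
    using integrable_hermite_multi_mult[of l l] by (simp add: power2_eq_square)
  have HH: "(LINT s|gauss. hermite_multi l s * hermite_multi l' s) = (if l = l' then F l else 0)" for l l' :: "'p \<Rightarrow> nat"
    by (simp add: integral_hermite_multi_mult F_def)
  have P2: "integrable gauss (\<lambda>x. (P s x)\<^sup>2)"
    and P2_int: "(LINT x|gauss. (P s x)\<^sup>2) = (\<Sum>l\<in>?L. (\<rho>\<^sup>2) ^ d l / F l * (hermite_multi l s * hermite_multi l s))" for s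
  proof -
    have e: "(P s x)\<^sup>2 = (\<Sum>l\<in>?L. \<Sum>l'\<in>?L. (\<rho> ^ d l / F l * hermite_multi l s) * (\<rho> ^ d l' / F l' * hermite_multi l' s)
       * (hermite_multi l x * hermite_multi l' x))" for x
      by (simp add: P_def power2_eq_square sum_product mult_ac)
    show "integrable gauss (\<lambda>x. (P s x)\<^sup>2)"
      unfolding e by (intro Bochner_Integration.integrable_sum integrable_mult_right integrable_hermite_multi_mult)
    have "(LINT x|gauss. (P s x)\<^sup>2) =
      (\<Sum>l\<in>?L. \<Sum>l'\<in>?L. (\<rho> ^ d l / F l * hermite_multi l s) * (\<rho> ^ d l' / F l' * hermite_multi l' s) * (if l = l' then F l else 0))"
      unfolding e
      by (simp add: Bochner_Integration.integral_sum integrable_hermite_multi_mult HH)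
    also have "\<dots> = (\<Sum>l\<in>?L. (\<rho> ^ d l / F l * hermite_multi l s) * (\<rho> ^ d l / F l * hermite_multi l s) * F l)"
      by (intro sum.cong refl) (simp add: finite_multi_index if_distrib[of "(*) _"] cong: if_cong)
    also have "\<dots> = (\<Sum>l\<in>?L. (\<rho>\<^sup>2) ^ d l / F l * (hermite_multi l s * hermite_multi l s))"
      using F[THEN less_imp_neq, THEN not_sym]
      by (intro sum.cong refl) (simp add: power2_eq_square power_mult_distrib)
    finally show "(LINT x|gauss. (P s x)\<^sup>2) = (\<Sum>l\<in>?L. (\<rho>\<^sup>2) ^ d l / F l * (hermite_multi l s * hermite_multi l s))" .
  qed
  have M2: "integrable gauss (\<lambda>x. (mehler \<rho> c s x)\<^sup>2)" for s :: "real ^ 'p" by (rule integrable_mehler_sq[OF c])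
  have MH: "integrable gauss (\<lambda>x. mehler \<rho> c s x * hermite_multi l x)" for s and l :: "'p \<Rightarrow> nat"
    by (rule integrable_mult_sq) (auto intro: M2 H2)
  have MP: "integrable gauss (\<lambda>x. mehler \<rho> c s x * P s x)" for s
    by (rule integrable_mult_sq) (auto intro: M2 P2)
  \<comment> \<open>By the eigenfunction identity \<open>P s\<close> is the orthogonal projection of
    the kernel section onto the polynomials of degree at most m, so the mixed term equals the
    squared norm of \<open>P s\<close>.\<close>
  have MP_int: "(LINT x|gauss. mehler \<rho> c s x * P s x) = (LINT x|gauss. (P s x)\<^sup>2)" for s
  proof -
    have "(LINT x|gauss. mehler \<rho> c s x * P s x) =
        (LINT x|gauss. (\<Sum>l\<in>?L. \<rho> ^ d l / F l * hermite_multi l s * (mehler \<rho> c s x * hermite_multi l x)))"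
      by (simp add: P_def sum_distrib_left mult_ac)
    also have "\<dots> = (\<Sum>l\<in>?L. \<rho> ^ d l / F l * hermite_multi l s * (LINT x|gauss. mehler \<rho> c s x * hermite_multi l x))"
      using MH by simp
    also have "\<dots> = (LINT x|gauss. (P s x)\<^sup>2)"
      unfolding P2_int
      by (intro sum.cong refl, subst integral_gauss_mehler[OF c(1), symmetric])
         (simp_all add: integral_hermite_multi_affine[OF c(2)] d_def power2_eq_square power_mult_distrib)
    finally show ?thesis .
  qed
  have MP2: "integrable gauss (\<lambda>x. (mehler \<rho> c s x - P s x)\<^sup>2)" for s
    unfolding power2_diff using M2 P2 MP by (auto simp: mult.assoc)
  have MP2_int: "(LINT x|gauss. (mehler \<rho> c s x - P s x)\<^sup>2) = R s" for s
  proof -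
    have "(LINT x|gauss. (mehler \<rho> c s x - P s x)\<^sup>2) =
      (LINT x|gauss. (mehler \<rho> c s x)\<^sup>2) + (LINT x|gauss. (P s x)\<^sup>2) - 2 * (LINT x|gauss. mehler \<rho> c s x * P s x)"
      unfolding power2_diff using M2 P2 MP by (simp add: mult.assoc)
    then show ?thesis
      by (simp add: MP_int integral_mehler_sq[OF c] R_def W_def P2_int)
  qed
  have R0: "0 \<le> R s" for s unfolding MP2_int[symmetric] by simp
  have fH: "integrable gauss (\<lambda>x. f x * hermite_multi l x)" for l
    by (rule integrable_mult_sq) (auto intro: f2 H2)
  have bound: "(T s)\<^sup>2 \<le> R s * (LINT x|gauss. (f x)\<^sup>2)" for s
  proof -
    have "T s = (LINT x|gauss. mehler \<rho> c s x * f x)"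
      unfolding T_def c_def[symmetric] by (rule integral_gauss_mehler[OF c(1) f])
    \<comment> \<open>Every subtracted term is 0 by \<open>orth\<close>; this is what replaces the
      kernel by its remainder before Cauchy--Schwarz.\<close>
    also have "\<dots> = (LINT x|gauss. mehler \<rho> c s x * f x) - (\<Sum>l\<in>?L. \<rho> ^ d l / F l * hermite_multi l s * (LINT x|gauss. f x * hermite_multi l x))"
      by (simp add: orth)
    also have "\<dots> = (LINT x|gauss. mehler \<rho> c s x * f x - (\<Sum>l\<in>?L. \<rho> ^ d l / F l * hermite_multi l s * (f x * hermite_multi l x)))"
      using fH integrable_mult_sq[OF _ _ M2[of s] f2] by simp
    also have "\<dots> = (LINT x|gauss. (mehler \<rho> c s x - P s x) * f x)"
      by (simp add: P_def sum_distrib_left sum_distrib_right right_diff_distrib left_diff_distrib mult_ac)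
    also have "\<dots>\<^sup>2 \<le> (LINT x|gauss. (mehler \<rho> c s x - P s x)\<^sup>2) * (LINT x|gauss. (f x)\<^sup>2)"
      by (rule integral_Cauchy_Schwarz[OF _ _ MP2 f2]) auto
    finally show ?thesis by (simp add: MP2_int)
  qed
  have h: "integrable \<phi> (\<lambda>s. exp (\<rho>\<^sup>2 * s\<^sup>2 / (1 + \<rho>\<^sup>2)) / (c * sqrt (1 + \<rho>\<^sup>2)))"
    by (rule integrable_mehler1_diag[OF c])
  have Wi: "integrable gauss W"
    using integrable_gauss_vec_prod[of "\<lambda>i::'p. \<lambda>s. exp (\<rho>\<^sup>2 * s\<^sup>2 / (1 + \<rho>\<^sup>2)) / (c * sqrt (1 + \<rho>\<^sup>2))", OF h]
    unfolding W_def[abs_def] .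
  have "(LINT s|gauss. W s) = (1 / (1 - \<rho>\<^sup>2)) ^ CARD('p)"
    using integral_gauss_vec_prod[of "\<lambda>i::'p. \<lambda>s. exp (\<rho>\<^sup>2 * s\<^sup>2 / (1 + \<rho>\<^sup>2)) / (c * sqrt (1 + \<rho>\<^sup>2))", OF h]
    unfolding W_def[abs_def] integral_mehler1_diag[OF c] by simp
  then have R_int: "(LINT s|gauss. R s) = (1 / (1 - \<rho>\<^sup>2)) ^ CARD('p) - (\<Sum>l\<in>?L. (\<rho>\<^sup>2) ^ d l)"
    unfolding R_def using Wi F[THEN less_imp_neq, THEN not_sym]
    by (simp add: integrable_hermite_multi_mult integral_hermite_multi_mult F_def[symmetric])
  have Ri: "integrable gauss R"
    unfolding R_def[abs_def] by (intro Bochner_Integration.integrable_diff Wi Bochner_Integration.integrable_sum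
      integrable_mult_right integrable_hermite_multi_mult)
  have Rf: "integrable gauss (\<lambda>s. R s * (LINT x|gauss. (f x)\<^sup>2))" using Ri by simp
  have [measurable]: "T \<in> borel_measurable borel"
    unfolding T_def by measurable
  show Ti: "integrable gauss (\<lambda>s. (T s)\<^sup>2)"
    by (rule Bochner_Integration.integrable_bound[OF Rf]) (use bound R0 in auto)
  have "(LINT s|gauss. (T s)\<^sup>2) \<le> (LINT s|gauss. R s * (LINT x|gauss. (f x)\<^sup>2))"
    by (rule integral_mono[OF Ti Rf bound])
  also have "\<dots> = (LINT s|gauss. R s) * (LINT x|gauss. (f x)\<^sup>2)" by simp
  also have "\<dots> \<le> ((real CARD('p) * 2 ^ CARD('p) + (real m + 1) ^ CARD('p)) * (\<rho>\<^sup>2) ^ Suc m) * (LINT x|gauss. (f x)\<^sup>2)"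
    unfolding R_int d_def
    by (rule mult_right_mono[OF geometric_power_tail[where 'p='p]]) (use \<rho> in auto)
  finally show "(LINT s|gauss. (T s)\<^sup>2) \<le>
      (real CARD('p) * 2 ^ CARD('p) + (real m + 1) ^ CARD('p)) * (\<rho>\<^sup>2) ^ Suc m * (LINT x|gauss. (f x)\<^sup>2)" .
qed

subsection \<open>Laws of pairs in a stationary Gaussian process\<close>

lemma (in prob_space) gaussian_rv_integrable:
  assumes "gaussian_rv M Z"
  shows "integrable M Z" "integrable M (\<lambda>w. (Z w)\<^sup>2)"
proof -
  have [measurable]: "Z \<in> borel_measurable M" using assms by (simp add: gaussian_rv_def)
  have "integrable M Z \<and> integrable M (\<lambda>w. (Z w)\<^sup>2)"
    using assms unfolding gaussian_rv_def
  proof (elim conjE disjE exE)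
    fix \<mu> assume "AE w in M. Z w = \<mu>"
    then have "AE w in M. norm (Z w) \<le> \<bar>\<mu>\<bar>" "AE w in M. norm ((Z w)\<^sup>2) \<le> \<mu>\<^sup>2" by auto
    then show ?thesis
      by (intro conjI integrable_const_bound[where B="\<bar>\<mu>\<bar>"] integrable_const_bound[where B="\<mu>\<^sup>2"]) auto
  next
    fix \<mu> \<sigma> assume \<sigma>: "0 < \<sigma>" and D: "distributed M lborel Z (\<lambda>y. ennreal (normal_density \<mu> \<sigma> y))"
    have 1: "integrable M (\<lambda>w. (Z w - \<mu>) ^ k)" for k
      using integrable_normal_moment[OF \<sigma>, of \<mu> k] distributed_integrable[OF D, of "\<lambda>x. (x - \<mu>) ^ k"] by simp
    have i: "integrable M Z"
    proof -
      have "integrable M (\<lambda>w. (Z w - \<mu>) ^ 1 + \<mu>)" by (intro Bochner_Integration.integrable_add 1) simp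
      then show ?thesis by simp
    qed
    have "integrable M (\<lambda>w. (Z w - \<mu>) ^ 2 + 2 * \<mu> * Z w - \<mu>\<^sup>2)" using 1 i by simp
    moreover have "(\<lambda>w. (Z w - \<mu>) ^ 2 + 2 * \<mu> * Z w - \<mu>\<^sup>2) = (\<lambda>w. (Z w)\<^sup>2)"
      by (simp add: fun_eq_iff power2_eq_square algebra_simps)
    ultimately show ?thesis using i by simp
  qed
  then show "integrable M Z" "integrable M (\<lambda>w. (Z w)\<^sup>2)" by simp_all
qed

text \<open>The degenerate case is an almost surely vanishing variable with \<open>v = 0\<close>,
  for which the same formula holds; linear combinations of the process may be of this kind.\<close>

lemma (in prob_space) char_gaussian_rv:
  assumes Z: "gaussian_rv M Z" and mean: "expectation Z = 0" and var: "expectation (\<lambda>w. (Z w)\<^sup>2) = v"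
  shows "(CLINT w|M. iexp (Z w)) = exp (- v / 2)"
proof -
  have Zm [measurable]: "Z \<in> borel_measurable M" using Z by (simp add: gaussian_rv_def)
  show ?thesis
    using Z unfolding gaussian_rv_def
  proof (elim conjE disjE exE)
    fix \<mu> assume ae: "AE w in M. Z w = \<mu>"
    have "expectation Z = expectation (\<lambda>_. \<mu>)" by (rule integral_cong_AE) (use ae in auto)
    then have \<mu>: "\<mu> = 0" using mean by (simp add: prob_space)
    have "v = expectation (\<lambda>_. 0)"
      unfolding var[symmetric] by (rule integral_cong_AE) (use ae \<mu> in auto)
    moreover have "(CLINT w|M. iexp (Z w)) = (CLINT w|M. 1)"
      by (rule integral_cong_AE) (use ae \<mu> in auto)
    ultimately show ?thesis by (simp add: prob_space)
  next
    fix \<mu> \<sigma> assume \<sigma>: "0 < \<sigma>" and D: "distributed M lborel Z (\<lambda>y. ennreal (normal_density \<mu> \<sigma> y))"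
    have \<mu>: "\<mu> = 0" using normal_distributed_expectation[OF \<sigma> D] mean by simp
    have v: "v = \<sigma>\<^sup>2" using normal_distributed_variance[OF \<sigma> D] mean var by simp
    have D1: "distributed M lborel (\<lambda>w. (Z w - \<mu>) / \<sigma>) std_normal_density"
      using normal_standard_normal_convert[OF \<sigma>, of Z \<mu>] D by simp
    have "(CLINT w|M. iexp (Z w)) = (CLINT w|M. iexp (\<sigma> * ((Z w - \<mu>) / \<sigma>)))"
      using \<sigma> \<mu> by simp
    also have "\<dots> = (CLINT x|distr M lborel (\<lambda>w. (Z w - \<mu>) / \<sigma>). iexp (\<sigma> * x))"
      by (subst integral_distr) (auto intro: distributed_measurable[OF D1])
    also have "\<dots> = char \<phi> \<sigma>"
      unfolding distributed_distr_eq_density[OF D1] char_def ..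
    finally show ?thesis by (simp add: char_std_normal_distribution v)
  qed
qed

text \<open>Splits the standard noise on a pair of vectors into two independent standard noises, by
  comparing characteristic functions.\<close>

lemma gauss_prod: "gauss = (gauss :: 'a::euclidean_space measure) \<Otimes>\<^sub>M (gauss :: 'b::euclidean_space measure)"
proof (rule char_unique)
  interpret P: pair_prob_space "gauss :: 'a measure" "gauss :: 'b measure" by unfold_locales
  show "prob_space ((gauss :: 'a measure) \<Otimes>\<^sub>M (gauss :: 'b measure))" by unfold_locales
  show s: "sets ((gauss :: 'a measure) \<Otimes>\<^sub>M (gauss :: 'b measure)) = sets borel"
    by (simp add: borel_prod[symmetric] cong: sets_pair_measure_cong)
  fix u :: "'a \<times> 'b"
  have "(CLINT x|(gauss \<Otimes>\<^sub>M gauss). iexp (u \<bullet> x)) = (CLINT x|gauss. CLINT y|gauss. iexp (x \<bullet> fst u) * iexp (y \<bullet> snd u))"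
    by (subst P.integral_fst'[symmetric])
       (auto intro!: P.integrable_const_bound[where B=1] Bochner_Integration.integral_cong
         simp: inner_prod_def exp_add[symmetric] algebra_simps inner_commute)
  also have "\<dots> = exp (- (norm (fst u))\<^sup>2 / 2) * exp (- (norm (snd u))\<^sup>2 / 2)"
    by (simp only: integral_mult_right_zero integral_mult_left_zero char_gauss of_real_mult)
  also have "\<dots> = (CLINT x|gauss. iexp (x \<bullet> u))"
    by (simp only: char_gauss exp_add[symmetric] of_real_mult[symmetric])
       (simp add: norm_prod_def add_divide_distrib power2_eq_square)
  finally show "(CLINT x|gauss. iexp (u \<bullet> x)) = (CLINT x|(gauss \<Otimes>\<^sub>M gauss). iexp (u \<bullet> x))"
    by (simp add: inner_commute)
qed (simp_all add: prob_space_gauss)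

lemma gauss_real: "gauss = \<phi>"
  by (simp add: gauss_def gauss_density_def)

text \<open>\<open>t\<close> is left abstract: slow variation and the exponent \<open>D\<close>
  enter later only through eventual power bounds on \<open>t k\<close>.\<close>

locale stationary_gaussian = prob_space M for M :: "'a measure" +
  fixes X :: "nat \<Rightarrow> 'a \<Rightarrow> real ^ 'p::finite" and c :: "'p \<Rightarrow> 'p \<Rightarrow> real" and t :: "nat \<Rightarrow> real"
  assumes gaussian: "gaussian_process M X"
    and stationary: "stationary_process M X"
    and mean: "\<And>i. expectation (\<lambda>w. X 1 w $ i) = 0"
    and cov: "\<And>i j. expectation (\<lambda>w. X 1 w $ i * X 1 w $ j) = (if i = j then 1 else 0)"
    and cross: "\<And>i j k. 1 \<le> k \<Longrightarrow> expectation (\<lambda>w. X 1 w $ i * X (k + 1) w $ j) = c i j * t k"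
begin

lemma X_measurable: "1 \<le> j \<Longrightarrow> X j \<in> borel_measurable M"
  using gaussian by (simp add: gaussian_process_def)

lemma pair_measurable: "1 \<le> j \<Longrightarrow> 1 \<le> k \<Longrightarrow> (\<lambda>w. (X j w, X k w)) \<in> borel_measurable M"
  by (simp add: borel_prod[symmetric] X_measurable measurable_Pair)

definition pair_law :: "nat \<Rightarrow> ((real ^ 'p) \<times> (real ^ 'p)) measure" where
  "pair_law k = distr M borel (\<lambda>w. (X 1 w, X (k + 1) w))"

lemma prob_space_pair_law: "prob_space (pair_law k)"
  unfolding pair_law_def by (rule prob_space_distr) (simp add: pair_measurable)

lemma sets_pair_law [measurable_cong, simp]: "sets (pair_law k) = sets borel"
  by (simp add: pair_law_def)

text \<open>Stationarity on the index set \<open>{1, k + 1}\<close> with shift \<open>j - 1\<close>,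
  projected to the two values.\<close>

lemma distr_pair:
  assumes "1 \<le> j" "1 \<le> k"
  shows "distr M borel (\<lambda>w. (X j w, X (j + k) w)) = pair_law k"
proof -
  let ?T = "{1, k + 1}" and ?P = "\<lambda>f::nat \<Rightarrow> real ^ 'p. (f 1, f (k + 1))"
  have m: "(\<lambda>w. \<lambda>i\<in>?T. X (i + h) w) \<in> measurable M (PiM ?T (\<lambda>_. borel))" for h
    by (intro measurable_restrict X_measurable) auto
  have P: "?P \<in> measurable (PiM ?T (\<lambda>_. borel)) borel"
    unfolding borel_prod[symmetric] by (intro measurable_Pair measurable_component_singleton) auto
  have "distr (distr M (PiM ?T (\<lambda>_. borel)) (\<lambda>w. \<lambda>i\<in>?T. X (i + (j - 1)) w)) borel ?P =
        distr (distr M (PiM ?T (\<lambda>_. borel)) (\<lambda>w. \<lambda>i\<in>?T. X i w)) borel ?P"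
    by (rule arg_cong[where f="\<lambda>N. distr N borel ?P"], rule stationary[unfolded stationary_process_def, rule_format]) auto
  then show ?thesis
    using assms unfolding pair_law_def distr_distr[OF P m] distr_distr[OF P m[of 0, unfolded add_0_right]]
    by (simp add: o_def add.commute)
qed

lemma distr_X:
  assumes "1 \<le> j"
  shows "distr M borel (X j) = distr M borel (X 1)"
proof -
  have [measurable]: "fst \<in> measurable (borel :: ((real ^ 'p) \<times> (real ^ 'p)) measure) borel"
    by (simp add: borel_prod[symmetric])
  have "distr (distr M borel (\<lambda>w. (X j w, X (j + 1) w))) borel fst = distr (distr M borel (\<lambda>w. (X 1 w, X (1 + 1) w))) borel fst"
    using distr_pair[OF assms, of 1] distr_pair[of 1 1] by simp
  then show ?thesis
    using assms by (subst (asm) (1 2) distr_distr) (auto simp: pair_measurable o_def)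
qed

lemma gaussian_pair:
  assumes "1 \<le> k"
  shows "gaussian_rv M (\<lambda>w. a \<bullet> X 1 w + b \<bullet> X (k + 1) w)"
proof -
  have "gaussian_rv M (\<lambda>w. \<Sum>j\<in>{1, k + 1}. (if j = 1 then a else b) \<bullet> X j w)"
    using gaussian unfolding gaussian_process_def by (elim conjE allE[of _ "{1, k + 1}"]) auto
  then show ?thesis using assms by simp
qed

lemma component_integrable:
  assumes "1 \<le> k"
  shows "integrable M (\<lambda>w. X k w $ i)" "integrable M (\<lambda>w. (X k w $ i)\<^sup>2)"
    "(\<lambda>w. X k w $ i) \<in> borel_measurable M"
proof -
  have "gaussian_rv M (\<lambda>w. \<Sum>j\<in>{k}. axis i 1 \<bullet> X j w)"
    using gaussian assms unfolding gaussian_process_def by (elim conjE allE[of _ "{k}"]) auto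
  then have g: "gaussian_rv M (\<lambda>w. X k w $ i)" by (simp add: inner_axis')
  then show "integrable M (\<lambda>w. X k w $ i)" "integrable M (\<lambda>w. (X k w $ i)\<^sup>2)"
    "(\<lambda>w. X k w $ i) \<in> borel_measurable M"
    using gaussian_rv_integrable[OF g] by (auto simp: gaussian_rv_def)
qed

lemma component_mult_integrable:
  "1 \<le> k \<Longrightarrow> 1 \<le> l \<Longrightarrow> integrable M (\<lambda>w. X k w $ i * X l w $ j)"
  by (rule integrable_mult_sq) (auto intro: component_integrable)

lemma mean_X:
  assumes "1 \<le> k"
  shows "expectation (\<lambda>w. X k w $ i) = 0"
proof -
  have "expectation (\<lambda>w. X k w $ i) = (LINT x|distr M borel (X k). x $ i)"
    by (rule integral_distr[symmetric]) (simp_all add: X_measurable[OF assms])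
  also have "\<dots> = expectation (\<lambda>w. X 1 w $ i)"
    unfolding distr_X[OF assms] by (rule integral_distr) (auto simp: X_measurable)
  finally show ?thesis by (simp only: mean)
qed

lemma cov_X:
  assumes "1 \<le> k"
  shows "expectation (\<lambda>w. X k w $ i * X k w $ j) = (if i = j then 1 else 0)"
proof -
  have "expectation (\<lambda>w. X k w $ i * X k w $ j) = (LINT x|distr M borel (X k). x $ i * x $ j)"
    by (rule integral_distr[symmetric]) (simp_all add: X_measurable[OF assms])
  also have "\<dots> = expectation (\<lambda>w. X 1 w $ i * X 1 w $ j)"
    unfolding distr_X[OF assms] by (rule integral_distr) (auto simp: X_measurable)
  finally show ?thesis by (simp only: cov)
qed

text \<open>\<open>t k * bil a b\<close> is the covariance of \<open>a \<bullet> X 1\<close> and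
  \<open>b \<bullet> X (k + 1)\<close>.\<close>

definition bil :: "real ^ 'p \<Rightarrow> real ^ 'p \<Rightarrow> real" where
  "bil a b = (\<Sum>i\<in>UNIV. \<Sum>j\<in>UNIV. a $ i * b $ j * c i j)"

lemma bil_scaleR: "bil (x *\<^sub>R a) (y *\<^sub>R b) = x * y * bil a b"
  by (simp add: bil_def sum_distrib_left mult_ac)

lemma
  assumes "1 \<le> k" "1 \<le> l"
  shows integrable_inner_mult: "integrable M (\<lambda>w. (a \<bullet> X k w) * (b \<bullet> X l w))"
    and expectation_inner_mult: "expectation (\<lambda>w. (a \<bullet> X k w) * (b \<bullet> X l w)) =
      (\<Sum>i\<in>UNIV. \<Sum>j\<in>UNIV. a $ i * b $ j * expectation (\<lambda>w. X k w $ i * X l w $ j))"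
proof -
  have e: "(a \<bullet> X k w) * (b \<bullet> X l w) = (\<Sum>i\<in>UNIV. \<Sum>j\<in>UNIV. a $ i * b $ j * (X k w $ i * X l w $ j))" for w
    by (simp add: inner_vec_def sum_product mult_ac)
  show "integrable M (\<lambda>w. (a \<bullet> X k w) * (b \<bullet> X l w))"
    unfolding e by (intro Bochner_Integration.integrable_sum integrable_mult_right component_mult_integrable assms)
  show "expectation (\<lambda>w. (a \<bullet> X k w) * (b \<bullet> X l w)) =
      (\<Sum>i\<in>UNIV. \<Sum>j\<in>UNIV. a $ i * b $ j * expectation (\<lambda>w. X k w $ i * X l w $ j))"
    unfolding e
    by (simp add: component_mult_integrable[OF assms])
qed

lemma variance_pair:
  assumes k: "1 \<le> k"
  shows "expectation (\<lambda>w. (a \<bullet> X 1 w + b \<bullet> X (k + 1) w)\<^sup>2) = (norm a)\<^sup>2 + (norm b)\<^sup>2 + 2 * t k * bil a b"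
proof -
  have n: "(\<Sum>i\<in>UNIV. \<Sum>j\<in>UNIV. a $ i * a $ j * (if i = j then 1 else 0)) = (norm a)\<^sup>2" for a :: "real ^ 'p"
    by (simp add: norm_vec_def L2_set_def sum_nonneg power2_eq_square if_distrib[of "(*) _"] cong: if_cong)
  have "expectation (\<lambda>w. (a \<bullet> X 1 w + b \<bullet> X (k + 1) w)\<^sup>2) =
    expectation (\<lambda>w. (a \<bullet> X 1 w) * (a \<bullet> X 1 w) + (b \<bullet> X (k + 1) w) * (b \<bullet> X (k + 1) w) +
      2 * ((a \<bullet> X 1 w) * (b \<bullet> X (k + 1) w)))"
    by (simp add: power2_eq_square algebra_simps)
  also have "\<dots> = expectation (\<lambda>w. (a \<bullet> X 1 w) * (a \<bullet> X 1 w)) + expectation (\<lambda>w. (b \<bullet> X (k + 1) w) * (b \<bullet> X (k + 1) w)) +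
      2 * expectation (\<lambda>w. (a \<bullet> X 1 w) * (b \<bullet> X (k + 1) w))"
    by (simp add: integrable_inner_mult)
  also have "\<dots> = (norm a)\<^sup>2 + (norm b)\<^sup>2 + 2 * (\<Sum>i\<in>UNIV. \<Sum>j\<in>UNIV. a $ i * b $ j * (c i j * t k))"
    by (subst (1 2 3) expectation_inner_mult) (simp_all only: order_refl le_add2 cov_X cross[OF k] n)
  finally show ?thesis by (simp add: bil_def sum_distrib_left mult_ac)
qed

lemma char_pair_law:
  assumes k: "1 \<le> k"
  shows "(CLINT x|pair_law k. iexp (u \<bullet> x)) =
    exp (- ((norm u)\<^sup>2 + 2 * t k * bil (fst u) (snd u)) / 2)"
proof -
  have "(CLINT x|pair_law k. iexp (u \<bullet> x)) = (CLINT w|M. iexp (u \<bullet> (X 1 w, X (k + 1) w)))"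
    unfolding pair_law_def by (rule integral_distr) (auto simp: pair_measurable)
  also have "\<dots> = (CLINT w|M. iexp (fst u \<bullet> X 1 w + snd u \<bullet> X (k + 1) w))"
    by (simp add: inner_prod_def)
  also have "\<dots> = exp (- ((norm (fst u))\<^sup>2 + (norm (snd u))\<^sup>2 + 2 * t k * bil (fst u) (snd u)) / 2)"
  proof (rule char_gaussian_rv[OF gaussian_pair[OF k] _ variance_pair[OF k]])
    have "expectation (\<lambda>w. a \<bullet> X j w) = 0" "integrable M (\<lambda>w. a \<bullet> X j w)" if "1 \<le> j" for a j
      using that by (simp_all add: inner_vec_def component_integrable mean_X)
    then show "expectation (\<lambda>w. fst u \<bullet> X 1 w + snd u \<bullet> X (k + 1) w) = 0" by simp
  qed
  finally show ?thesis by (simp add: norm_prod_def)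
qed

lemma fst_snd_measurable [measurable]:
  "fst \<in> measurable (borel :: ((real ^ 'p) \<times> (real ^ 'p)) measure) borel"
  "snd \<in> measurable (borel :: ((real ^ 'p) \<times> (real ^ 'p)) measure) borel"
  by (simp_all add: borel_prod[symmetric])

lemma distr_X_gauss:
  assumes "1 \<le> k"
  shows "distr M borel (X k) = gauss"
proof -
  have "distr M borel (X 1) = gauss"
  proof (rule char_unique)
    fix u :: "real ^ 'p"
    have "(CLINT x|distr M borel (X 1). iexp (u \<bullet> x)) = (CLINT w|M. iexp (u \<bullet> X 1 w))"
      by (rule integral_distr) (auto simp: X_measurable)
    also have "\<dots> = (CLINT x|pair_law 1. iexp ((u, 0) \<bullet> x))"
      unfolding pair_law_def by (subst integral_distr) (auto simp: pair_measurable inner_prod_def)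
    also have "\<dots> = (CLINT x|gauss. iexp (u \<bullet> x))"
      using char_gauss[of u] by (subst char_pair_law) (simp_all add: bil_def inner_commute norm_prod_def)
    finally show "(CLINT x|distr M borel (X 1). iexp (u \<bullet> x)) = (CLINT x|gauss. iexp (u \<bullet> x))" .
  qed (auto simp: prob_space_distr X_measurable prob_space_gauss)
  then show ?thesis using distr_X[OF assms] by simp
qed

lemma distr_pair_law:
  shows "distr (pair_law k) borel fst = gauss" "distr (pair_law k) borel snd = gauss"
  unfolding pair_law_def
  by (simp_all add: distr_distr pair_measurable o_def distr_X_gauss)

text \<open>The law of \<open>(X\<^sub>1, X\<^sub>k\<^sub>+\<^sub>1)\<close> depends on \<open>k\<close> only through \<open>t k\<close>, so for small \<open>t k\<close> it arises from
  the law belonging to a fixed lag \<open>l\<close> by adding independent noise to both components.\<close>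

lemma pair_law_mixture:
  assumes "1 \<le> k" "1 \<le> l" and \<rho>: "t k = \<rho>\<^sup>2 * t l" "\<rho>\<^sup>2 \<le> 1"
  shows "pair_law k = distr (pair_law l \<Otimes>\<^sub>M gauss) borel (\<lambda>(z, w). \<rho> *\<^sub>R z + sqrt (1 - \<rho>\<^sup>2) *\<^sub>R w)"
proof (rule char_unique)
  interpret L: prob_space "pair_law l" by (rule prob_space_pair_law)
  interpret P: pair_prob_space "pair_law l" "gauss :: ((real ^ 'p) \<times> (real ^ 'p)) measure" by unfold_locales
  let ?f = "\<lambda>(z, w). \<rho> *\<^sub>R z + sqrt (1 - \<rho>\<^sup>2) *\<^sub>R (w :: (real ^ 'p) \<times> (real ^ 'p))"
  have f [measurable]: "?f \<in> borel_measurable (pair_law l \<Otimes>\<^sub>M gauss)"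
    unfolding split_beta' by (intro borel_measurable_add borel_measurable_scaleR) auto
  show "prob_space (distr (pair_law l \<Otimes>\<^sub>M gauss) borel ?f)" by (rule P.prob_space_distr) (rule f)
  fix u :: "(real ^ 'p) \<times> (real ^ 'p)"
  have "(CLINT x|distr (pair_law l \<Otimes>\<^sub>M gauss) borel ?f. iexp (u \<bullet> x)) =
      (CLINT p|(pair_law l \<Otimes>\<^sub>M gauss). iexp ((\<rho> *\<^sub>R u) \<bullet> fst p) * iexp (snd p \<bullet> (sqrt (1 - \<rho>\<^sup>2) *\<^sub>R u)))"
  proof -
    have "iexp (u \<bullet> ?f p) = iexp ((\<rho> *\<^sub>R u) \<bullet> fst p) * iexp (snd p \<bullet> (sqrt (1 - \<rho>\<^sup>2) *\<^sub>R u))" for p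
      unfolding exp_add[symmetric] by (simp add: split_beta' inner_add_right inner_commute[of u] distrib_left)
    then show ?thesis by (subst integral_distr[OF f]) simp_all
  qed
  also have "\<dots> = (CLINT z|pair_law l. CLINT w|gauss. iexp ((\<rho> *\<^sub>R u) \<bullet> z) * iexp (w \<bullet> (sqrt (1 - \<rho>\<^sup>2) *\<^sub>R u)))"
    by (subst P.integral_fst'[symmetric])
       (auto intro!: P.integrable_const_bound[where B=1] simp: norm_mult)
  also have "\<dots> = exp (- ((norm (\<rho> *\<^sub>R u))\<^sup>2 + 2 * t l * bil (fst (\<rho> *\<^sub>R u)) (snd (\<rho> *\<^sub>R u))) / 2) *
      exp (- (norm (sqrt (1 - \<rho>\<^sup>2) *\<^sub>R u))\<^sup>2 / 2)"
    by (simp only: integral_mult_right_zero integral_mult_left_zero char_gauss char_pair_law[OF assms(2)] of_real_mult)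
  \<comment> \<open>The noise restores the share 1 - \<rho>^2 of the squared norm, while the mixed
    term keeps the factor \<rho>^2, which turns \<open>t l\<close> into \<open>t k\<close>.\<close>
  also have "\<dots> = exp (- ((norm u)\<^sup>2 + 2 * t k * bil (fst u) (snd u)) / 2)"
  proof -
    have "(norm (\<rho> *\<^sub>R u))\<^sup>2 = \<rho>\<^sup>2 * (norm u)\<^sup>2" by (simp add: power_mult_distrib)
    moreover have "(norm (sqrt (1 - \<rho>\<^sup>2) *\<^sub>R u))\<^sup>2 = (1 - \<rho>\<^sup>2) * (norm u)\<^sup>2"
      using \<rho>(2) by (simp add: power_mult_distrib)
    moreover have "bil (fst (\<rho> *\<^sub>R u)) (snd (\<rho> *\<^sub>R u)) = \<rho>\<^sup>2 * bil (fst u) (snd u)"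
      by (simp add: bil_scaleR power2_eq_square)
    ultimately show ?thesis
      unfolding of_real_mult[symmetric] exp_add[symmetric] \<rho>(1) by (simp add: field_simps)
  qed
  finally show "(CLINT x|pair_law k. iexp (u \<bullet> x)) = (CLINT x|distr (pair_law l \<Otimes>\<^sub>M gauss) borel ?f. iexp (u \<bullet> x))"
    by (simp only: char_pair_law[OF assms(1)])
qed (simp_all add: prob_space_pair_law)

end

section \<open>Covariances of functions of the process\<close>

context stationary_gaussian begin

lemma
  fixes f :: "real ^ 'p \<Rightarrow> real"
  assumes f [measurable]: "f \<in> borel_measurable borel" and f2: "integrable gauss (\<lambda>x. (f x)\<^sup>2)"
  shows integrable_pair_law_mult: "integrable (pair_law k) (\<lambda>x. f (fst x) * f (snd x))"
    and pair_law_Cauchy_Schwarz: "\<bar>LINT x|pair_law k. f (fst x) * f (snd x)\<bar> \<le> (LINT x|gauss. (f x)\<^sup>2)"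
proof -
  have i: "integrable (pair_law k) (\<lambda>x. (f (fst x))\<^sup>2)" "integrable (pair_law k) (\<lambda>x. (f (snd x))\<^sup>2)"
    using f2 distr_pair_law[of k]
      integrable_distr_eq[of fst "pair_law k" borel "\<lambda>x. (f x)\<^sup>2"]
      integrable_distr_eq[of snd "pair_law k" borel "\<lambda>x. (f x)\<^sup>2"] by simp_all
  show "integrable (pair_law k) (\<lambda>x. f (fst x) * f (snd x))"
    by (rule integrable_mult_sq) (use i in auto)
  have e: "(LINT x|pair_law k. (f (fst x))\<^sup>2) = (LINT x|gauss. (f x)\<^sup>2)" "(LINT x|pair_law k. (f (snd x))\<^sup>2) = (LINT x|gauss. (f x)\<^sup>2)"
    using distr_pair_law[of k]
      integral_distr[of fst "pair_law k" borel "\<lambda>x. (f x)\<^sup>2"]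
      integral_distr[of snd "pair_law k" borel "\<lambda>x. (f x)\<^sup>2"] by simp_all
  have "(LINT x|pair_law k. f (fst x) * f (snd x))\<^sup>2 \<le> (LINT x|pair_law k. (f (fst x))\<^sup>2) * (LINT x|pair_law k. (f (snd x))\<^sup>2)"
    by (rule integral_Cauchy_Schwarz) (use i in auto)
  then show "\<bar>LINT x|pair_law k. f (fst x) * f (snd x)\<bar> \<le> (LINT x|gauss. (f x)\<^sup>2)"
    unfolding e power2_eq_square[symmetric] by (rule abs_le_square_iff[THEN iffD2, THEN order_trans]) simp
qed

lemma expectation_pair:
  fixes g :: "(real ^ 'p) \<times> (real ^ 'p) \<Rightarrow> real"
  assumes "g \<in> borel_measurable borel" "1 \<le> j" "1 \<le> k"
  shows "expectation (\<lambda>w. g (X j w, X (j + k) w)) = (LINT x|pair_law k. g x)"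
  unfolding distr_pair[OF assms(2,3), symmetric]
  by (rule integral_distr[symmetric]) (use assms in \<open>auto intro!: pair_measurable\<close>)

text \<open>Given the pair z at lag \<open>l\<close>, the noises of the two components are
  independent, so the conditional mean of the product is \<open>T (fst z) * T (snd z)\<close>. Both
  marginals of z are standard, and Cauchy--Schwarz leaves the squared norm of \<open>T\<close>, to
  which the contraction applies. The correlation at lag \<open>l\<close> itself is never
  estimated.\<close>

lemma pair_law_covariance_bound:
  fixes f :: "real ^ 'p \<Rightarrow> real"
  assumes f [measurable]: "f \<in> borel_measurable borel" and f2: "integrable gauss (\<lambda>x. (f x)\<^sup>2)"
    and orth: "\<And>l. (\<Sum>i\<in>UNIV. l i) \<le> m \<Longrightarrow> (LINT x|gauss. f x * hermite_multi l x) = 0"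
    and kl: "1 \<le> k" "1 \<le> l" and \<rho>: "t k = \<rho>\<^sup>2 * t l" "\<rho>\<^sup>2 \<le> 1 / 2"
  shows "\<bar>LINT x|pair_law k. f (fst x) * f (snd x)\<bar> \<le>
    (real CARD('p) * 2 ^ CARD('p) + (real m + 1) ^ CARD('p)) * (\<rho>\<^sup>2) ^ Suc m * (LINT x|gauss. (f x)\<^sup>2)"
proof -
  interpret L: prob_space "pair_law l" by (rule prob_space_pair_law)
  interpret P: pair_prob_space "pair_law l" "gauss :: ((real ^ 'p) \<times> (real ^ 'p)) measure" by unfold_locales
  interpret G: pair_prob_space "gauss :: (real ^ 'p) measure" "gauss :: (real ^ 'p) measure" by unfold_locales
  define s where "s = sqrt (1 - \<rho>\<^sup>2)"
  define T where "T z = (LINT u|gauss. f (\<rho> *\<^sub>R z + s *\<^sub>R u))" for z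
  have \<rho>1: "\<rho>\<^sup>2 \<le> 1" using \<rho> by simp
  note contr = ornstein_uhlenbeck_contraction[where m=m, OF f f2 orth \<rho>(2), folded s_def, folded T_def]
  have [measurable]: "T \<in> borel_measurable borel" unfolding T_def by measurable
  let ?H = "\<lambda>p. \<rho> *\<^sub>R fst p + s *\<^sub>R snd p"
  have h: "?H \<in> borel_measurable (pair_law l \<Otimes>\<^sub>M (gauss :: ((real ^ 'p) \<times> (real ^ 'p)) measure))"
    by (intro borel_measurable_add borel_measurable_scaleR) auto
  have mix: "pair_law k = distr (pair_law l \<Otimes>\<^sub>M gauss) borel ?H"
    unfolding pair_law_mixture[OF kl \<rho>(1) \<rho>1] s_def[symmetric] by (simp add: split_beta')
  have ff: "(\<lambda>x. f (fst x) * f (snd x)) \<in> borel_measurable borel" by measurable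
  define F where "F p = f (\<rho> *\<^sub>R fst (fst p) + s *\<^sub>R fst (snd p)) * f (\<rho> *\<^sub>R snd (fst p) + s *\<^sub>R snd (snd p))"
    for p :: "((real ^ 'p) \<times> (real ^ 'p)) \<times> (real ^ 'p) \<times> (real ^ 'p)"
  have Fi: "integrable (pair_law l \<Otimes>\<^sub>M gauss) F"
    using integrable_pair_law_mult[OF f f2, of k]
    unfolding mix integrable_distr_eq[OF h ff] by (simp add: F_def[abs_def])
  have "(LINT x|pair_law k. f (fst x) * f (snd x)) = (LINT p|(pair_law l \<Otimes>\<^sub>M gauss). F p)"
    unfolding mix integral_distr[OF h ff] by (simp add: F_def[abs_def])
  also have "\<dots> = (LINT z|pair_law l. LINT w|gauss. F (z, w))"
    by (rule P.integral_fst'[OF Fi, symmetric])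
  also have "\<dots> = (LINT z|pair_law l. T (fst z) * T (snd z))"
  proof (rule integral_cong_AE)
    show "(\<lambda>z. LINT w|gauss. F (z, w)) \<in> borel_measurable (pair_law l)"
      by (rule borel_measurable_integrable[OF P.integrable_fst'[OF Fi]])
    \<comment> \<open>Only almost every section is known to be integrable, so the splitting by
      \<open>gauss_prod\<close> is done almost everywhere.\<close>
    have "AE z in pair_law l. integrable gauss (\<lambda>w. F (z, w))"
      by (rule P.AE_integrable_fst'[OF Fi])
    then show "AE z in pair_law l. (LINT w|gauss. F (z, w)) = T (fst z) * T (snd z)"
    proof eventually_elim
      case (elim z)
      then have "(LINT w|gauss. F (z, w)) = (LINT u|gauss. LINT v|gauss. F (z, (u, v)))"
        unfolding gauss_prod by (rule G.integral_fst'[symmetric])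
      then show ?case by (simp add: F_def T_def)
    qed
  qed measurable
  finally have "\<bar>LINT x|pair_law k. f (fst x) * f (snd x)\<bar> \<le> (LINT s|gauss. (T s)\<^sup>2)"
    using pair_law_Cauchy_Schwarz[OF _ contr(1), of l] by simp
  also note contr(2)
  finally show ?thesis .
qed

text \<open>The variances of the sum and of the difference of the two coordinates are
  nonnegative.\<close>

lemma correlation_le_1:
  assumes k: "1 \<le> k"
  shows "\<bar>c i i * t k\<bar> \<le> 1"
proof -
  have b: "bil (axis i 1) (axis i x) = x * c i i" for x
    by (simp add: bil_def axis_def if_distrib[of "\<lambda>y. y * _"] if_distrib[of "(*) _"] cong: if_cong)
  have "0 \<le> expectation (\<lambda>w. (axis i 1 \<bullet> X 1 w + axis i x \<bullet> X (k + 1) w)\<^sup>2)" for x by simp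
  then have "0 \<le> 1 + x\<^sup>2 + 2 * t k * (x * c i i)" for x
    unfolding variance_pair[OF k] b by (simp add: norm_eq_sqrt_inner inner_axis_axis)
  from this[of 1] this[of "-1"] show ?thesis by (simp add: abs_le_iff algebra_simps)
qed

text \<open>The two coordinates have the joint law of (z, r z + s w) with z, w independent standard
  normal. Integrating out w multiplies the Hermite polynomial by r^m, and orthogonality gives the
  factorial.\<close>

lemma expectation_hermite_pair:
  assumes "1 \<le> j" and k: "1 \<le> k"
  shows "expectation (\<lambda>w. hermite m (X j w $ i) * hermite m (X (j + k) w $ i)) = fact m * (c i i * t k) ^ m"
proof -
  define r where "r = c i i * t k"
  define s where "s = sqrt (1 - r\<^sup>2)"
  have r: "\<bar>r\<bar> \<le> 1" unfolding r_def by (rule correlation_le_1[OF k])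
  then have rs: "r\<^sup>2 + s\<^sup>2 = 1" by (simp add: s_def abs_square_le_1)
  let ?A = "distr (pair_law k) borel (\<lambda>x. (fst x $ i, snd x $ i))"
  let ?B = "distr (gauss :: (real \<times> real) measure) borel (\<lambda>x. (fst x, r * fst x + s * snd x))"
  have mA: "(\<lambda>x. (fst x $ i, snd x $ i)) \<in> borel_measurable (pair_law k)"
    unfolding borel_prod[symmetric] by (intro measurable_Pair) measurable
  have [measurable]: "fst \<in> borel_measurable (borel :: (real \<times> real) measure)" "snd \<in> borel_measurable (borel :: (real \<times> real) measure)"
    by (simp_all add: borel_prod[symmetric])
  have mB: "(\<lambda>x. (fst x, r * fst x + s * snd x)) \<in> borel_measurable (gauss :: (real \<times> real) measure)"
    unfolding borel_prod[symmetric] by (intro measurable_Pair) measurable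
  have AB: "?A = ?B"
  proof (rule char_unique)
    interpret L: prob_space "pair_law k" by (rule prob_space_pair_law)
    show "prob_space ?A" "prob_space ?B"
      by (rule L.prob_space_distr[OF mA], rule gauss.prob_space_distr[OF mB])
    fix u :: "real \<times> real"
    have b: "bil (axis i a) (axis i b) = a * b * c i i" for a b
      by (simp add: bil_def axis_def if_distrib[of "\<lambda>y. y * _"] if_distrib[of "(*) _"] cong: if_cong)
    have "(CLINT x|?A. iexp (u \<bullet> x)) = (CLINT x|pair_law k. iexp ((axis i (fst u), axis i (snd u)) \<bullet> x))"
      by (subst integral_distr[OF mA]) (simp_all add: inner_prod_def inner_axis')
    also have "\<dots> = exp (- ((fst u)\<^sup>2 + (snd u)\<^sup>2 + 2 * r * fst u * snd u) / 2)"
      by (subst char_pair_law[OF k]) (simp add: b norm_prod_def norm_eq_sqrt_inner inner_axis_axis r_def mult_ac)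
    also have "(fst u)\<^sup>2 + (snd u)\<^sup>2 + 2 * r * fst u * snd u = (fst u + r * snd u)\<^sup>2 + (r\<^sup>2 + s\<^sup>2 - r\<^sup>2) * (snd u)\<^sup>2"
      unfolding rs by (simp add: power2_eq_square algebra_simps)
    also have "\<dots> = (norm (fst u + r * snd u, s * snd u))\<^sup>2"
      by (simp add: norm_prod_def power_mult_distrib)
    also have "complex_of_real (exp (- (norm (fst u + r * snd u, s * snd u))\<^sup>2 / 2)) = (CLINT x|gauss. iexp (x \<bullet> (fst u + r * snd u, s * snd u)))"
      by (rule char_gauss[symmetric])
    also have "\<dots> = (CLINT x|?B. iexp (u \<bullet> x))"
      by (subst integral_distr[OF mB]) (simp_all add: inner_prod_def algebra_simps)
    finally show "(CLINT x|?A. iexp (u \<bullet> x)) = (CLINT x|?B. iexp (u \<bullet> x))" .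
  qed simp_all
  interpret G: pair_prob_space "gauss :: real measure" "gauss :: real measure" by unfold_locales
  let ?h = "\<lambda>x. hermite m (fst x) * hermite m (snd x)"
  have hm: "?h \<in> borel_measurable borel" by measurable
  have "expectation (\<lambda>w. hermite m (X j w $ i) * hermite m (X (j + k) w $ i)) =
      (LINT x|pair_law k. hermite m (fst x $ i) * hermite m (snd x $ i))"
    using expectation_pair[of "\<lambda>x. hermite m (fst x $ i) * hermite m (snd x $ i)" j k] assms by simp
  also have "\<dots> = (LINT x|?A. ?h x)" by (subst integral_distr[OF mA hm]) simp
  also have "\<dots> = (LINT x|gauss. hermite m (fst x) * hermite m (r * fst x + s * snd x))"
    unfolding AB by (subst integral_distr[OF mB hm]) simp
  also have "\<dots> = (LINT z|gauss. LINT w|gauss. hermite m z * hermite m (r * z + s * w))"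
  proof -
    \<comment> \<open>A Hermite polynomial of one coordinate is a product polynomial, so the
      integrability that Fubini requires comes from \<open>integrable_pair_law_mult\<close>.\<close>
    define l where "l = (\<lambda>i'. if i' = i then m else 0)"
    have hl: "hermite_multi l x = hermite m (x $ i)" for x :: "real ^ 'p"
      unfolding l_def by (rule hermite_multi_single)
    have "integrable (pair_law k) (\<lambda>x. hermite_multi l (fst x) * hermite_multi l (snd x))"
      using integrable_hermite_multi_mult[of l l] by (intro integrable_pair_law_mult) (auto simp: power2_eq_square)
    then have "integrable ?A ?h"
      by (subst integrable_distr_eq[OF mA hm]) (simp add: hl)
    then have "integrable gauss (\<lambda>x. hermite m (fst x) * hermite m (r * fst x + s * snd x))"
      unfolding AB by (subst (asm) integrable_distr_eq[OF mB hm]) simp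
    then show ?thesis
      unfolding gauss_prod by (subst G.integral_fst'[symmetric]) simp_all
  qed
  also have "\<dots> = (LINT z|gauss. r ^ m * (hermite m z * hermite m z))"
    by (simp add: gauss_real hermite_eq integral_herm_affine[OF rs] mult.left_commute)
  also have "\<dots> = fact m * r ^ m"
    by (simp add: gauss_real hermite_eq integral_herm_mult_herm)
  finally show ?thesis by (simp add: r_def)
qed

end

subsection \<open>Slowly varying functions\<close>

text \<open>In the additive form \<open>h x = ln (L (exp x))\<close>. If uniform convergence on \<open>[0, 1]\<close> failed along \<open>x\<^sub>n\<close>, then for
  large \<open>n\<close> the sets of good increments for \<open>x\<^sub>n\<close> and for \<open>x\<^sub>n + u\<^sub>n\<close> would both have almost full measure
  in \<open>[0, 2]\<close>, so that a common point exists after the shift by \<open>u\<^sub>n\<close>.\<close>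

lemma uniform_increments:
  fixes h :: "real \<Rightarrow> real"
  assumes [measurable]: "h \<in> borel_measurable borel"
    and lim: "\<And>u. 0 \<le> u \<Longrightarrow> ((\<lambda>x. h (x + u) - h x) \<longlongrightarrow> 0) at_top"
    and \<epsilon>: "0 < \<epsilon>"
  shows "\<exists>A. \<forall>x\<ge>A. \<forall>u\<in>{0..1}. \<bar>h (x + u) - h x\<bar> < \<epsilon>"
proof (rule ccontr)
  assume "\<not> ?thesis"
  then have "\<forall>n::nat. \<exists>x u. real n \<le> x \<and> u \<in> {0..1} \<and> \<epsilon> \<le> \<bar>h (x + u) - h x\<bar>"
    by (metis not_less)
  then obtain x u where xu: "\<And>n::nat. real n \<le> x n" "\<And>n. u n \<in> {0..1}" "\<And>n. \<epsilon> \<le> \<bar>h (x n + u n) - h (x n)\<bar>"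
    by metis
  define good where "good y n = {v\<in>{0..2}. \<forall>k\<ge>n. \<bar>h (y k + v) - h (y k)\<bar> < \<epsilon> / 2}" for y :: "nat \<Rightarrow> real" and n :: nat
  have [measurable, simp]: "good y n \<in> sets borel" for y n
    unfolding good_def by measurable
  have meas: "(\<lambda>n. measure lborel (good y n)) \<longlonglongrightarrow> 2" if y: "\<And>n. real n \<le> y n" for y
  proof -
    \<comment> \<open>Pointwise convergence makes each increment good from some index on. The good
      sets increase, so their measures tend to that of [0, 2].\<close>
    have un: "(\<Union>n. good y n) = {0..2}"
    proof (intro equalityI subsetI)
      fix v :: real assume v: "v \<in> {0..2}"
      have "filterlim y at_top sequentially"
        by (rule filterlim_at_top_mono[OF filterlim_real_sequentially]) (simp add: y)
      then have "(\<lambda>n. h (y n + v) - h (y n)) \<longlonglongrightarrow> 0"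
        using lim[of v] v by (auto intro: filterlim_compose)
      then have "\<forall>\<^sub>F n in sequentially. \<bar>h (y n + v) - h (y n)\<bar> < \<epsilon> / 2"
        using \<epsilon> by (auto dest: tendstoD[where e="\<epsilon>/2"] simp: dist_real_def)
      then show "v \<in> (\<Union>n. good y n)" using v by (auto simp: good_def eventually_sequentially)
    qed (auto simp: good_def)
    have "(\<lambda>n. emeasure lborel (good y n)) \<longlonglongrightarrow> emeasure lborel (\<Union>n. good y n)"
      by (rule Lim_emeasure_incseq) (auto simp: incseq_def good_def)
    then have "(\<lambda>n. emeasure lborel (good y n)) \<longlonglongrightarrow> ennreal 2" by (simp add: un)
    then show ?thesis
      unfolding measure_def by (rule tendsto_enn2real) simp
  qed
  have "\<And>n. real n \<le> x n + u n" using xu(1,2) by (metis add_increasing2 atLeastAtMost_iff)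
  then have "\<forall>\<^sub>F n in sequentially. 3/2 < measure lborel (good (\<lambda>n. x n + u n) n)"
    using meas by (intro order_tendstoD[where y=2]) auto
  moreover have "\<forall>\<^sub>F n in sequentially. 3/2 < measure lborel (good x n)"
    using meas[of x] xu(1) by (intro order_tendstoD[where y=2]) auto
  ultimately have "\<forall>\<^sub>F n in sequentially. 3/2 < measure lborel (good (\<lambda>n. x n + u n) n) \<and> 3/2 < measure lborel (good x n)"
    by (rule eventually_conj)
  then obtain n where n: "3/2 < measure lborel (good (\<lambda>n. x n + u n) n)" "3/2 < measure lborel (good x n)"
    by (auto simp: eventually_sequentially)
  let ?V = "good x n" and ?W = "(+) (- u n) -` good (\<lambda>n. x n + u n) n"
  have W: "?W \<in> sets lborel" "measure lborel ?W = measure lborel (good (\<lambda>n. x n + u n) n)"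
  proof -
    show "?W \<in> sets lborel"
      using measurable_sets[of "(+) (- u n)" lborel borel "good (\<lambda>n. x n + u n) n"] by simp
    have "measure lborel (good (\<lambda>n. x n + u n) n) = measure (distr lborel borel ((+) (- u n))) (good (\<lambda>n. x n + u n) n)"
      by (simp only: lborel_distr_plus)
    also have "\<dots> = measure lborel ?W" by (subst measure_distr) auto
    finally show "measure lborel ?W = measure lborel (good (\<lambda>n. x n + u n) n)" ..
  qed
  \<comment> \<open>Both sets lie in an interval of length 3 because \<open>u n\<close> is in
    [0, 1]; having measure above 3/2 each, they must meet.\<close>
  have sub: "?V \<union> ?W \<subseteq> {0..3}" using xu(2)[of n] by (auto simp: good_def)
  have "?V \<inter> ?W \<noteq> {}"
  proof
    assume disj: "?V \<inter> ?W = {}"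
    have I: "{0..3::real} \<in> fmeasurable lborel" by (simp add: fmeasurable_def)
    have fm: "?V \<in> fmeasurable lborel" "?W \<in> fmeasurable lborel"
      using sub W(1) by (auto intro: fmeasurableI2[OF I])
    have "measure lborel (?V \<union> ?W) = measure lborel ?V + measure lborel ?W"
      using measure_Un3[OF fm] disj by simp
    moreover have "measure lborel (?V \<union> ?W) \<le> measure lborel {0..3::real}"
      using W(1) sub I by (intro measure_mono_fmeasurable) auto
    ultimately show False using n W(2) by simp
  qed
  \<comment> \<open>Increment \<open>w\<close> from \<open>x n\<close> and increment
    \<open>w - u n\<close> from \<open>x n + u n\<close> end at the same point, so the increment
    \<open>u n\<close> changes \<open>h\<close> by less than \<epsilon>.\<close>
  then obtain w where "w \<in> ?V" "w \<in> ?W" by auto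
  then obtain v where v: "v \<in> good (\<lambda>n. x n + u n) n" "u n + v \<in> good x n"
    by (intro that[of "w - u n"]) auto
  then have "\<bar>h (x n + u n + v) - h (x n + u n)\<bar> < \<epsilon> / 2" "\<bar>h (x n + (u n + v)) - h (x n)\<bar> < \<epsilon> / 2"
    by (auto simp: good_def)
  with xu(3)[of n] show False by (simp add: add.assoc abs_if split: if_splits)
qed

text \<open>Unit steps are added up; the summand 1 on the right pays for the remaining fractional
  step.\<close>

lemma linear_growth_bound:
  fixes h :: "real \<Rightarrow> real"
  assumes u: "\<And>x u. A \<le> x \<Longrightarrow> u \<in> {0..1} \<Longrightarrow> \<bar>h (x + u) - h x\<bar> < \<epsilon>" and x: "A \<le> x"
  shows "\<bar>h x - h A\<bar> \<le> \<epsilon> * (x - A + 1)"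
proof -
  have \<epsilon>: "0 < \<epsilon>" using u[of A 0] by simp
  have nat: "\<bar>h (A + real n) - h A\<bar> \<le> \<epsilon> * real n" for n
  proof (induction n)
    case (Suc n)
    with u[of "A + real n" 1] show ?case by (simp add: algebra_simps)
  qed simp
  define n where "n = nat \<lfloor>x - A\<rfloor>"
  have n: "real n \<le> x - A" "x - A < real n + 1" using x by (auto simp: n_def)
  have "\<bar>h (A + real n + (x - A - real n)) - h (A + real n)\<bar> < \<epsilon>"
    using n by (intro u) auto
  then have "\<bar>h x - h A\<bar> \<le> \<epsilon> * real n + \<epsilon>" using nat[of n] by simp
  also have "\<dots> = \<epsilon> * (real n + 1)" by (simp add: algebra_simps)
  also have "\<dots> \<le> \<epsilon> * (x - A + 1)" using n \<epsilon> by (intro mult_left_mono) auto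
  finally show ?thesis .
qed

text \<open>In logarithmic coordinates, increments over unit steps are eventually below \<delta> /
  2, hence growth is at most linear with slope \<delta> / 2. The other half of \<delta> absorbs the
  constant.\<close>

lemma slowly_varying_bounds:
  assumes L: "slowly_varying L" and \<delta>: "0 < \<delta>"
  shows "\<forall>\<^sub>F x in at_top. x powr (- \<delta>) \<le> L x \<and> L x \<le> x powr \<delta>"
proof -
  obtain a where meas: "L \<in> borel_measurable (restrict_space borel {a..})" and pos: "\<And>x. a \<le> x \<Longrightarrow> 0 < L x"
    using L by (auto simp: slowly_varying_def)
  have lim: "((\<lambda>x. L (s * x) / L x) \<longlongrightarrow> 1) at_top" if "0 < s" for s
    using L that by (simp add: slowly_varying_def)
  \<comment> \<open>The value 0 is a filler where \<open>L\<close> need not be positive or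
    measurable; it corresponds to extending \<open>L\<close> by 1.\<close>
  define h where "h x = (if a \<le> exp x then ln (L (exp x)) else 0)" for x
  have m: "(\<lambda>y. if a \<le> y then L y else 1) \<in> borel_measurable borel"
    using meas measurable_restrict_space_iff[of "{a..}" borel 1 borel L] by simp
  have hm: "h \<in> borel_measurable borel"
  proof -
    have "(\<lambda>x. ln (if a \<le> exp x then L (exp x) else 1)) \<in> borel_measurable borel"
      using measurable_compose[OF _ m, of exp borel] by measurable
    moreover have "(\<lambda>x. ln (if a \<le> exp x then L (exp x) else 1)) = h" by (auto simp: h_def fun_eq_iff)
    ultimately show ?thesis by simp
  qed
  have ev: "\<forall>\<^sub>F x in at_top. a \<le> exp (x::real)"
    using exp_at_top by (auto simp: filterlim_at_top)
  have hlim: "((\<lambda>x. h (x + u) - h x) \<longlongrightarrow> 0) at_top" if "0 \<le> u" for u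
  proof -
    have "((\<lambda>x. ln (L (exp u * exp x) / L (exp x))) \<longlongrightarrow> ln 1) at_top"
      by (intro tendsto_ln filterlim_compose[OF lim exp_at_top]) auto
    moreover have "\<forall>\<^sub>F x in at_top. ln (L (exp u * exp x) / L (exp x)) = h (x + u) - h x"
      using ev
    proof eventually_elim
      case (elim x)
      have "exp x \<le> exp (x + u)" using that by simp
      then have "a \<le> exp (x + u)" using elim by linarith
      then show ?case using elim pos[of "exp x"] pos[of "exp (x + u)"]
        by (simp add: h_def ln_div exp_add mult.commute)
    qed
    ultimately show ?thesis using tendsto_cong by force
  qed
  obtain A0 where A0: "\<And>x u. A0 \<le> x \<Longrightarrow> u \<in> {0..1} \<Longrightarrow> \<bar>h (x + u) - h x\<bar> < \<delta> / 2"
    using uniform_increments[OF hm hlim half_gt_zero[OF \<delta>]] by blast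
  have g: "\<bar>h x\<bar> \<le> \<bar>h A0\<bar> + \<delta> / 2 * (x - A0 + 1)" if "A0 \<le> x" for x
    using linear_growth_bound[OF A0 that] by linarith
  \<comment> \<open>From here on x exceeds the constant of the linear bound, once that constant is
    expressed in units of \<delta> / 2.\<close>
  define B where "B = max A0 (2 * \<bar>h A0\<bar> / \<delta> - A0 + 1)"
  have hB: "\<bar>h x\<bar> \<le> \<delta> * x" if "B \<le> x" for x
  proof -
    have "\<bar>h A0\<bar> + \<delta> / 2 * (x - A0 + 1) = \<delta> / 2 * (2 * \<bar>h A0\<bar> / \<delta> - A0 + 1 + x)"
      using \<delta> by (simp add: field_simps)
    also have "\<dots> \<le> \<delta> / 2 * (x + x)"
      using that \<delta> by (intro mult_left_mono add_right_mono) (auto simp: B_def)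
    finally show ?thesis using g[of x] that by (simp add: B_def)
  qed
  have "\<forall>\<^sub>F x in at_top. 1 < x \<and> a \<le> x \<and> B \<le> ln x"
    using ln_at_top by (auto simp: filterlim_at_top intro!: eventually_conj eventually_gt_at_top eventually_ge_at_top)
  then show ?thesis
  proof eventually_elim
    case (elim x)
    have "h (ln x) = ln (L x)" using elim by (simp add: h_def)
    with hB[of "ln x"] elim have "- (\<delta> * ln x) \<le> ln (L x)" "ln (L x) \<le> \<delta> * ln x" by auto
    then have "exp (- (\<delta> * ln x)) \<le> exp (ln (L x))" "exp (ln (L x)) \<le> exp (\<delta> * ln x)"
      by (simp_all only: exp_le_cancel_iff)
    then show ?case using elim pos[of x] by (simp add: powr_def)
  qed
qed

subsection \<open>Residuals of indicators\<close>

text \<open>One block for every binary digit 1 of \<open>n\<close>.\<close>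

definition dyad :: "nat \<Rightarrow> nat \<Rightarrow> nat set" where
  "dyad k n = {v. Suc (v div 2 ^ k) = n div 2 ^ k \<and> odd (n div 2 ^ k)}"

text \<open>Halving \<open>v\<close> and \<open>n\<close> removes the lowest digit: v < n holds if v
  div 2 < n div 2, or else if v = n - 1 and \<open>n\<close> is odd. The second case is the block of
  scale 0.\<close>

lemma lessThan_dyad:
  "n < 2 ^ K \<Longrightarrow> (of_bool (v < n) :: real) = (\<Sum>k<K. of_bool (v \<in> dyad k n))"
proof (induction K arbitrary: n v)
  case (Suc K)
  have "(\<Sum>k<Suc K. of_bool (v \<in> dyad k n) :: real) =
      of_bool (v \<in> dyad 0 n) + (\<Sum>k<K. of_bool (v \<in> dyad (Suc k) n))"
    by (rule sum.lessThan_Suc_shift)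
  also have "(\<Sum>k<K. of_bool (v \<in> dyad (Suc k) n) :: real) = (\<Sum>k<K. of_bool (v div 2 \<in> dyad k (n div 2)))"
    by (simp add: dyad_def div_mult2_eq)
  also have "\<dots> = of_bool (v div 2 < n div 2)"
    using Suc.prems by (intro Suc.IH[symmetric]) auto
  also have "of_bool (v \<in> dyad 0 n) + of_bool (v div 2 < n div 2) = (of_bool (v < n) :: real)"
  proof -
    have "v < n \<longleftrightarrow> v div 2 < n div 2 \<or> (Suc v = n \<and> odd n)" "\<not> (v div 2 < n div 2 \<and> Suc v = n \<and> odd n)"
      by (presburger, presburger)
    then show ?thesis by (auto simp: dyad_def)
  qed
  finally show ?case ..
qed simp

lemma dyad_block: "dyad k n \<noteq> {} \<Longrightarrow> dyad k n = {v. v div 2 ^ k = n div 2 ^ k - 1}"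
  by (auto simp: dyad_def)

text \<open>Subtracting all Hermite terms of degree at most \<open>m\<close>, not only those of degree \<open>m\<close>, makes the residual
  orthogonal to low degrees for every set \<open>A\<close>. On the sets \<open>{s. evec (G s) \<le> x}\<close> the additional coefficients
  are the probability, in degree 0, and 0 in the degrees between.\<close>

definition coef :: "('p \<Rightarrow> nat) \<Rightarrow> (real ^ 'p::finite) set \<Rightarrow> real" where
  "coef l A = (LINT x|gauss. indicator A x * hermite_multi l x)"

definition multi_indices :: "nat \<Rightarrow> ('p::finite \<Rightarrow> nat) set" where
  "multi_indices m = {l. (\<Sum>i\<in>UNIV. l i) \<le> m}"

definition mfact :: "('p::finite \<Rightarrow> nat) \<Rightarrow> real" where
  "mfact l = (\<Prod>i\<in>UNIV. fact (l i))"

definition residual :: "nat \<Rightarrow> (real ^ 'p::finite) set \<Rightarrow> real ^ 'p \<Rightarrow> real" where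
  "residual m A s = indicator A s - (\<Sum>l\<in>multi_indices m. coef l A / mfact l * hermite_multi l s)"

lemma finite_multi_indices [simp]: "finite (multi_indices m)"
  unfolding multi_indices_def by (rule finite_multi_index)

lemma mfact_ge_1: "1 \<le> mfact l"
  unfolding mfact_def by (intro prod_ge_1) simp

lemma residual_measurable [measurable]:
  assumes [measurable]: "A \<in> sets borel"
  shows "residual m A \<in> borel_measurable borel"
  unfolding residual_def[abs_def] by measurable

lemma integrable_hermite_multi_sq: "integrable gauss (\<lambda>x. (hermite_multi l x)\<^sup>2)"
  using integrable_hermite_multi_mult[of l l] by (simp add: power2_eq_square)

lemma integrable_indicator_hermite:
  "A \<in> sets borel \<Longrightarrow> integrable gauss (\<lambda>x. indicator A x * hermite_multi l x)"
  by (rule Bochner_Integration.integrable_bound[OF integrable_hermite_multi[of l]])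
     (auto simp: abs_mult split: split_indicator)

lemma coef_sum:
  assumes "finite I" and A: "\<And>i. i \<in> I \<Longrightarrow> A i \<in> sets borel"
    and B: "\<And>x. (indicator B x :: real) = (\<Sum>i\<in>I. indicator (A i) x)"
  shows "coef l B = (\<Sum>i\<in>I. coef l (A i))"
  unfolding coef_def B sum_distrib_right
  by (rule Bochner_Integration.integral_sum) (rule integrable_indicator_hermite, rule A)

text \<open>Disjointness enters as an identity between indicators, the form in which the binary
  expansion provides it.\<close>

lemma residual_sum:
  assumes "finite I" and A: "\<And>i. i \<in> I \<Longrightarrow> A i \<in> sets borel"
    and B: "\<And>x. (indicator B x :: real) = (\<Sum>i\<in>I. indicator (A i) x)"
  shows "residual m B s = (\<Sum>i\<in>I. residual m (A i) s)"
proof -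
  have c: "coef l B = (\<Sum>i\<in>I. coef l (A i))" for l by (rule coef_sum[OF assms])
  show ?thesis
    by (simp add: residual_def sum_subtractf B c sum_distrib_right sum_divide_distrib) (rule sum.swap)
qed

text \<open>The residual is the projection of the indicator onto the orthogonal complement of the
  polynomials of degree at most m. So its squared norm equals its inner product with the indicator,
  and Cauchy--Schwarz bounds it by the squared norm of the indicator, which is the measure of
  \<open>A\<close>.\<close>

lemma
  assumes A [measurable]: "A \<in> sets borel"
  shows residual_orthogonal: "l \<in> multi_indices m \<Longrightarrow> (LINT x|gauss. residual m A x * hermite_multi l x) = 0"
    and integrable_residual_sq: "integrable gauss (\<lambda>x. (residual m A x)\<^sup>2)"
    and integral_residual_sq: "(LINT x|gauss. (residual m A x)\<^sup>2) \<le> measure gauss A"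
proof -
  have e: "residual m A x * hermite_multi l x = indicator A x * hermite_multi l x -
      (\<Sum>l'\<in>multi_indices m. coef l' A / mfact l' * (hermite_multi l' x * hermite_multi l x))" for l x
    by (simp add: residual_def left_diff_distrib right_diff_distrib sum_distrib_left sum_distrib_right mult_ac)
  note I = integrable_indicator_hermite[OF A] integrable_hermite_multi_mult
  show orth: "(LINT x|gauss. residual m A x * hermite_multi l x) = 0" if l: "l \<in> multi_indices m" for l
  proof -
    have "(LINT x|gauss. residual m A x * hermite_multi l x) = coef l A -
      (\<Sum>l'\<in>multi_indices m. coef l' A / mfact l' * (if l' = l then mfact l else 0))"
    proof -
      have "(LINT x|gauss. hermite_multi l' x * hermite_multi l x) = (if l' = l then mfact l else 0)" for l'
        by (simp add: integral_hermite_multi_mult mfact_def)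
      moreover have "(LINT x|gauss. indicator A x * hermite_multi l x) = coef l A" by (simp add: coef_def)
      moreover have "(LINT x|gauss. residual m A x * hermite_multi l x) = (LINT x|gauss. indicator A x * hermite_multi l x) -
        (\<Sum>l'\<in>multi_indices m. coef l' A / mfact l' * (LINT x|gauss. hermite_multi l' x * hermite_multi l x))"
      proof -
        have "(LINT x|gauss. (\<Sum>l'\<in>multi_indices m. coef l' A / mfact l' * (hermite_multi l' x * hermite_multi l x))) =
          (\<Sum>l'\<in>multi_indices m. LINT x|gauss. coef l' A / mfact l' * (hermite_multi l' x * hermite_multi l x))"
          by (rule Bochner_Integration.integral_sum) (intro integrable_mult_right I)
        then show ?thesis
          unfolding e integral_mult_right_zero
          by (subst Bochner_Integration.integral_diff)
             (auto intro!: I Bochner_Integration.integrable_sum integrable_mult_right simp del: times_divide_eq_left)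
      qed
      ultimately show ?thesis by simp
    qed
    also have "\<dots> = 0"
      using l mfact_ge_1[of l] by (simp add: if_distrib[of "(*) _"] cong: if_cong)
    finally show ?thesis .
  qed
  have rH: "integrable gauss (\<lambda>x. residual m A x * hermite_multi l x)" for l
    unfolding e by (intro Bochner_Integration.integrable_diff Bochner_Integration.integrable_sum integrable_mult_right I)
  have iA: "integrable gauss (indicator A :: _ \<Rightarrow> real)"
    by (rule gauss.integrable_const_bound[where B=1]) (auto split: split_indicator)
  have rA: "integrable gauss (\<lambda>x. residual m A x * indicator A x)"
  proof -
    have "residual m A x * indicator A x = indicator A x -
      (\<Sum>l\<in>multi_indices m. coef l A / mfact l * (indicator A x * hermite_multi l x))" for x
      by (auto simp: residual_def split: split_indicator)
    then show ?thesis
      by (simp only:) (intro Bochner_Integration.integrable_diff Bochner_Integration.integrable_sum integrable_mult_right I iA)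
  qed
  have sq: "(residual m A x)\<^sup>2 = residual m A x * indicator A x -
      (\<Sum>l\<in>multi_indices m. coef l A / mfact l * (residual m A x * hermite_multi l x))" for x
  proof -
    define P where "P = (\<Sum>l\<in>multi_indices m. coef l A / mfact l * hermite_multi l x)"
    have "(residual m A x)\<^sup>2 = residual m A x * indicator A x - residual m A x * P"
      unfolding power2_eq_square right_diff_distrib[symmetric] by (simp add: residual_def P_def)
    also have "residual m A x * P = (\<Sum>l\<in>multi_indices m. coef l A / mfact l * (residual m A x * hermite_multi l x))"
      unfolding P_def sum_distrib_left by (intro sum.cong refl) (simp add: mult_ac)
    finally show ?thesis .
  qed
  show i2: "integrable gauss (\<lambda>x. (residual m A x)\<^sup>2)"
    unfolding sq by (intro Bochner_Integration.integrable_diff Bochner_Integration.integrable_sum integrable_mult_right rA rH)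
  have r: "(LINT x|gauss. (residual m A x)\<^sup>2) = (LINT x|gauss. residual m A x * indicator A x)"
  proof -
    have "(LINT x|gauss. (\<Sum>l\<in>multi_indices m. coef l A / mfact l * (residual m A x * hermite_multi l x))) =
      (\<Sum>l\<in>multi_indices m. LINT x|gauss. coef l A / mfact l * (residual m A x * hermite_multi l x))"
      by (rule Bochner_Integration.integral_sum) (intro integrable_mult_right rH)
    also have "\<dots> = 0" by (intro sum.neutral ballI) (simp only: integral_mult_right_zero orth mult_zero_right)
    finally have z: "(LINT x|gauss. (\<Sum>l\<in>multi_indices m. coef l A / mfact l * (residual m A x * hermite_multi l x))) = 0" .
    have i: "integrable gauss (\<lambda>x. \<Sum>l\<in>multi_indices m. coef l A / mfact l * (residual m A x * hermite_multi l x))"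
      by (intro Bochner_Integration.integrable_sum integrable_mult_right rH)
    show ?thesis unfolding sq Bochner_Integration.integral_diff[OF rA i] z by simp
  qed
  have "(LINT x|gauss. residual m A x * indicator A x)\<^sup>2 \<le>
      (LINT x|gauss. (residual m A x)\<^sup>2) * (LINT x|gauss. (indicator A x)\<^sup>2)"
  proof (rule integral_Cauchy_Schwarz[OF _ _ i2])
    have "(indicator A x :: real)\<^sup>2 = indicator A x" for x by (simp split: split_indicator)
    then show "integrable gauss (\<lambda>x. (indicator A x :: real)\<^sup>2)" using iA by simp
  qed auto
  also have "(LINT x|gauss. (indicator A x :: real)\<^sup>2) = measure gauss A"
  proof -
    have "(indicator A x :: real)\<^sup>2 = indicator A x" for x by (simp split: split_indicator)
    then show ?thesis by simp
  qed
  finally have *: "(LINT x|gauss. (residual m A x)\<^sup>2)\<^sup>2 \<le> (LINT x|gauss. (residual m A x)\<^sup>2) * measure gauss A"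
    unfolding r[symmetric] .
  show "(LINT x|gauss. (residual m A x)\<^sup>2) \<le> measure gauss A"
  proof (rule ccontr)
    assume less: "\<not> ?thesis"
    then have "0 < (LINT x|gauss. (residual m A x)\<^sup>2)" using measure_nonneg[of gauss A] by linarith
    then show False using * less by (simp add: power2_eq_square[of "integral\<^sup>L _ _"])
  qed
qed

lemma coef_bound:
  assumes A [measurable]: "A \<in> sets borel"
  shows "\<bar>coef l A\<bar> \<le> sqrt (measure gauss A) * sqrt (mfact l)"
proof -
  have i: "(indicator A x :: real)\<^sup>2 = indicator A x" for x by (simp split: split_indicator)
  have "(coef l A)\<^sup>2 \<le> (LINT x|gauss. (indicator A x)\<^sup>2) * (LINT x|gauss. (hermite_multi l x)\<^sup>2)"
    unfolding coef_def
    by (rule integral_Cauchy_Schwarz) (auto simp: i integrable_hermite_multi_sq intro: gauss.integrable_const_bound[where B=1] split: split_indicator)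
  also have "\<dots> = measure gauss A * mfact l"
    using integral_hermite_multi_mult[of l l] by (simp add: i power2_eq_square[of "hermite_multi l _"] mfact_def)
  finally have "sqrt ((coef l A)\<^sup>2) \<le> sqrt (measure gauss A * mfact l)" by (rule real_sqrt_le_mono)
  then show ?thesis by (simp add: real_sqrt_mult)
qed

text \<open>Indicators are monotone in the set; Hermite parts are not. Passing from \<open>E\<close>
  to a bracket changes the Hermite coefficients by those of a set of mass at most \<delta>, each at
  most sqrt \<delta> after division by the factorial. Summing up to \<open>N\<close> on the right
  makes the bound uniform in \<open>n\<close>.\<close>

lemma residual_bracket:
  fixes z :: "nat \<Rightarrow> real ^ 'p::finite"
  assumes [measurable]: "A \<in> sets borel" "E \<in> sets borel" "B \<in> sets borel"
    and AB: "A \<subseteq> E" "E \<subseteq> B" and \<delta>: "measure gauss (B - A) \<le> \<delta>" and n: "n \<le> N"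
    and a: "\<bar>\<Sum>j<n. residual m A (z j)\<bar> \<le> y" and b: "\<bar>\<Sum>j<n. residual m B (z j)\<bar> \<le> y"
  shows "\<bar>\<Sum>j<n. residual m E (z j)\<bar> \<le> y + sqrt \<delta> * (\<Sum>l\<in>multi_indices m. \<Sum>j<N. \<bar>hermite_multi l (z j)\<bar>)"
proof -
  let ?R = "sqrt \<delta> * (\<Sum>l\<in>multi_indices m. \<Sum>j<N. \<bar>hermite_multi l (z j)\<bar>)"
  have diff: "\<bar>\<Sum>j<n. \<Sum>l\<in>multi_indices m. coef l C / mfact l * hermite_multi l (z j)\<bar> \<le> ?R"
    if C [measurable]: "C \<in> sets borel" and CB: "C \<subseteq> B - A" for C
  proof -
    have mC: "measure gauss C \<le> \<delta>"
      using gauss.finite_measure_mono[OF CB] \<delta> by (simp add: order_trans)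
    have c: "\<bar>coef l C / mfact l\<bar> \<le> sqrt \<delta>" for l
    proof -
      have F: "1 \<le> mfact l" by (rule mfact_ge_1)
      have "\<bar>coef l C\<bar> \<le> sqrt \<delta> * mfact l"
      proof (rule order_trans[OF coef_bound[OF C] mult_mono])
        show "sqrt (measure gauss C) \<le> sqrt \<delta>" using mC by simp
        show "sqrt (mfact l) \<le> mfact l"
          using F by (intro real_le_lsqrt) (auto simp: power2_eq_square)
      qed (use F mC order_trans[OF measure_nonneg mC] in auto)
      then show ?thesis using F by (simp add: field_simps)
    qed
    have "\<bar>\<Sum>j<n. \<Sum>l\<in>multi_indices m. coef l C / mfact l * hermite_multi l (z j)\<bar> \<le>
        (\<Sum>j<n. \<Sum>l\<in>multi_indices m. sqrt \<delta> * \<bar>hermite_multi l (z j)\<bar>)"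
    proof -
      have "\<bar>coef l C / mfact l * h\<bar> \<le> sqrt \<delta> * \<bar>h\<bar>" for l h
        unfolding abs_mult by (intro mult_right_mono c) simp
      then show ?thesis by (intro order_trans[OF sum_abs] sum_mono) auto
    qed
    also have "\<dots> \<le> (\<Sum>j<N. \<Sum>l\<in>multi_indices m. sqrt \<delta> * \<bar>hermite_multi l (z j)\<bar>)"
      using n order_trans[OF measure_nonneg \<delta>] by (intro sum_mono2) (auto intro!: sum_nonneg)
    also have "\<dots> = ?R" by (subst sum.swap) (simp add: sum_distrib_left)
    finally show ?thesis .
  qed
  have add: "coef l D = coef l C + coef l (D - C)" if [measurable]: "C \<in> sets borel" "D \<in> sets borel" and "C \<subseteq> D" for l and C D :: "(real ^ 'p) set"
  proof -
    have "coef l D = (\<Sum>i\<in>(UNIV::bool set). coef l (if i then C else D - C))"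
      by (rule coef_sum) (use that in \<open>auto simp: UNIV_bool split: split_indicator\<close>)
    then show ?thesis by (simp add: UNIV_bool)
  qed
  have up: "(\<Sum>j<n. residual m E (z j)) \<le> y + ?R"
  proof -
    have "residual m E s \<le> residual m B s + (\<Sum>l\<in>multi_indices m. coef l (B - E) / mfact l * hermite_multi l s)" for s
      using AB add[of E B] by (auto simp: residual_def add_divide_distrib distrib_right sum.distrib split: split_indicator)
    then have "(\<Sum>j<n. residual m E (z j)) \<le>
       (\<Sum>j<n. residual m B (z j)) + (\<Sum>j<n. \<Sum>l\<in>multi_indices m. coef l (B - E) / mfact l * hermite_multi l (z j))"
      unfolding sum.distrib[symmetric] by (rule sum_mono)
    then show ?thesis using b diff[of "B - E"] AB by fastforce
  qed
  have lo: "- (y + ?R) \<le> (\<Sum>j<n. residual m E (z j))"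
  proof -
    have "residual m A s - (\<Sum>l\<in>multi_indices m. coef l (E - A) / mfact l * hermite_multi l s) \<le> residual m E s" for s
      using AB add[of A E] by (auto simp: residual_def add_divide_distrib distrib_right sum.distrib split: split_indicator)
    then have "(\<Sum>j<n. residual m A (z j)) - (\<Sum>j<n. \<Sum>l\<in>multi_indices m. coef l (E - A) / mfact l * hermite_multi l (z j))
       \<le> (\<Sum>j<n. residual m E (z j))"
      unfolding sum_subtractf[symmetric] by (rule sum_mono)
    then show ?thesis using a diff[of "E - A"] AB by fastforce
  qed
  show ?thesis using up lo by (simp add: abs_le_iff)
qed

subsection \<open>Dyadic chaining\<close>

text \<open>\<open>R i s\<close> is the rank of coordinate \<open>i\<close>. Every coordinate has
  its own scale, so cells are preimages of boxes with dyadic sides of different lengths.\<close>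

definition dyadic_cell :: "('q \<Rightarrow> 's \<Rightarrow> nat) \<Rightarrow> ('q \<Rightarrow> nat) \<Rightarrow> ('q \<Rightarrow> nat) \<Rightarrow> 's set" where
  "dyadic_cell R \<kappa> \<beta> = {s. \<forall>i. R i s div 2 ^ \<kappa> i = \<beta> i}"

text \<open>The sum runs over all scales, time blocks and cells, so that a single random variable
  dominates the partial sums for every \<open>n\<close> and every grid point at once.\<close>

definition dyadic_energy ::
  "nat \<Rightarrow> ('q::finite \<Rightarrow> real ^ 'p::finite \<Rightarrow> nat) \<Rightarrow> nat \<Rightarrow> nat \<Rightarrow> (nat \<Rightarrow> real ^ 'p) \<Rightarrow> real" where
  "dyadic_energy m R K N z = (\<Sum>a<K. \<Sum>\<kappa>\<in>PiE UNIV (\<lambda>_. {..<K}). \<Sum>b<2 ^ K. \<Sum>\<beta>\<in>PiE UNIV (\<lambda>_. {..<2 ^ K}).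
     (\<Sum>j | j < N \<and> j div 2 ^ a = b. residual m (dyadic_cell R \<kappa> \<beta>) (z j))\<^sup>2)"

lemma dyadic_cell_measurable:
  fixes R :: "'q::finite \<Rightarrow> real ^ 'p::finite \<Rightarrow> nat"
  assumes [measurable]: "\<And>i. R i \<in> measurable borel (count_space UNIV)"
  shows "dyadic_cell R \<kappa> \<beta> \<in> sets borel"
  unfolding dyadic_cell_def by measurable

text \<open>The binary digits of \<open>n\<close> and of the \<open>v i\<close> cut the region into
  at most one block per combination of scales. Cauchy--Schwarz over these combinations gives the
  power of \<open>K\<close>, and the square of each block is one term of the energy.\<close>

lemma residual_sum_le_dyadic_energy:
  fixes R :: "'q::finite \<Rightarrow> real ^ 'p::finite \<Rightarrow> nat"
  assumes R [measurable]: "\<And>i. R i \<in> measurable borel (count_space UNIV)"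
    and n: "n \<le> N" "N < 2 ^ K" and v: "\<And>i. v i < 2 ^ K"
  shows "(\<Sum>j<n. residual m {s. \<forall>i. R i s < v i} (z j))\<^sup>2 \<le>
    real (K ^ Suc CARD('q)) * dyadic_energy m R K N z"
proof -
  let ?C = "PiE (UNIV :: 'q set) (\<lambda>_. {..<K})" and ?D = "PiE (UNIV :: 'q set) (\<lambda>_. {..<2 ^ K :: nat})"
  let ?P = "{..<K} \<times> ?C"
  define A where "A \<kappa> = {s. \<forall>i. R i s \<in> dyad (\<kappa> i) (v i)}" for \<kappa>
  define E where "E a \<kappa> = (\<Sum>b<2 ^ K. \<Sum>\<beta>\<in>?D.
     (\<Sum>j | j < N \<and> j div 2 ^ a = b. residual m (dyadic_cell R \<kappa> \<beta>) (z j))\<^sup>2)" for a \<kappa>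
  have fin: "finite ?C" "finite ?D" by (auto intro: finite_PiE)
  have nK: "n < 2 ^ K" using n by simp
  have [measurable]: "A \<kappa> \<in> sets borel" for \<kappa> unfolding A_def by measurable
  have ind: "(indicator {s. \<forall>i. R i s < v i} s :: real) = (\<Sum>\<kappa>\<in>?C. indicator (A \<kappa>) s)" for s
  proof -
    have p: "(indicator {s. \<forall>i. Q i s} s :: real) = (\<Prod>i\<in>UNIV. of_bool (Q i s))" for Q :: "'q \<Rightarrow> _ \<Rightarrow> bool"
      by (auto simp: indicator_def)
    have "(indicator {s. \<forall>i. R i s < v i} s :: real) = (\<Prod>i\<in>UNIV. \<Sum>k<K. of_bool (R i s \<in> dyad k (v i)))"
      unfolding p by (intro prod.cong refl lessThan_dyad v)
    also have "\<dots> = (\<Sum>\<kappa>\<in>?C. \<Prod>i\<in>UNIV. of_bool (R i s \<in> dyad (\<kappa> i) (v i)))"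
      by (rule prod_sum_PiE) auto
    also have "\<dots> = (\<Sum>\<kappa>\<in>?C. indicator (A \<kappa>) s)" unfolding A_def p ..
    finally show ?thesis .
  qed
  have res: "residual m {s. \<forall>i. R i s < v i} s = (\<Sum>\<kappa>\<in>?C. residual m (A \<kappa>) s)" for s
    by (rule residual_sum[OF fin(1) _ ind]) simp
  have "(\<Sum>j<n. residual m {s. \<forall>i. R i s < v i} (z j)) =
      (\<Sum>j<N. of_bool (j < n) * (\<Sum>\<kappa>\<in>?C. residual m (A \<kappa>) (z j)))"
    by (rule sum.mono_neutral_cong_left) (use n in \<open>auto simp: res\<close>)
  also have "\<dots> = (\<Sum>j<N. \<Sum>a<K. \<Sum>\<kappa>\<in>?C. of_bool (j \<in> dyad a n) * residual m (A \<kappa>) (z j))"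
    by (simp only: lessThan_dyad[OF nK] sum_product)
  also have "\<dots> = (\<Sum>a<K. \<Sum>\<kappa>\<in>?C. \<Sum>j<N. of_bool (j \<in> dyad a n) * residual m (A \<kappa>) (z j))"
    by (subst sum.swap, intro sum.cong refl, rule sum.swap)
  also have "\<dots> = (\<Sum>(a, \<kappa>)\<in>?P. \<Sum>j<N. of_bool (j \<in> dyad a n) * residual m (A \<kappa>) (z j))"
    by (rule sum.cartesian_product)
  finally have sq: "(\<Sum>j<n. residual m {s. \<forall>i. R i s < v i} (z j))\<^sup>2 \<le>
      (\<Sum>(a, \<kappa>)\<in>?P. (\<Sum>j<N. of_bool (j \<in> dyad a n) * residual m (A \<kappa>) (z j))\<^sup>2) * real (card ?P)"
    using sum_squared_le_sum_of_squares[of "\<lambda>(a, \<kappa>). \<Sum>j<N. of_bool (j \<in> dyad a n) * residual m (A \<kappa>) (z j)" ?P] fin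
    by (simp add: split_beta')
  have "(\<Sum>(a, \<kappa>)\<in>?P. (\<Sum>j<N. of_bool (j \<in> dyad a n) * residual m (A \<kappa>) (z j))\<^sup>2) \<le> (\<Sum>(a, \<kappa>)\<in>?P. E a \<kappa>)"
  proof (rule sum_mono)
    fix p :: "nat \<times> ('q \<Rightarrow> nat)"
    obtain a \<kappa> where p: "p = (a, \<kappa>)" by (cases p)
    have E0: "0 \<le> E a \<kappa>" by (auto simp: E_def intro!: sum_nonneg)
    \<comment> \<open>A digit 0 in time or in some coordinate makes the block empty, and its
      contribution is 0.\<close>
    consider "dyad a n = {}" | i where "dyad (\<kappa> i) (v i) = {}" | "dyad a n \<noteq> {}" "\<And>i. dyad (\<kappa> i) (v i) \<noteq> {}" by blast
    then have "(\<Sum>j<N. of_bool (j \<in> dyad a n) * residual m (A \<kappa>) (z j))\<^sup>2 \<le> E a \<kappa>"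
    proof cases
      case 1
      then show ?thesis using E0 by simp
    next
      case 2
      then have "A \<kappa> = {}" by (auto simp: A_def)
      then have "residual m (A \<kappa>) s = 0" for s by (simp add: residual_def coef_def)
      then show ?thesis using E0 by simp
    next
      case 3
      \<comment> \<open>The block of a digit 1 ends where the quotient of \<open>n\<close> begins,
        hence the index one below; likewise for \<open>\<beta>\<close>.\<close>
      define b where "b = n div 2 ^ a - 1"
      define \<beta> where "\<beta> i = v i div 2 ^ \<kappa> i - 1" for i
      have b: "b \<in> {..<2 ^ K}" unfolding b_def
        using nK div_le_dividend[of n "2 ^ a"] by (intro lessThan_iff[THEN iffD2]) linarith
      have \<beta>: "\<beta> \<in> ?D"
      proof -
        have "\<beta> i < 2 ^ K" for i
          unfolding \<beta>_def using v[of i] div_le_dividend[of "v i" "2 ^ \<kappa> i"] by linarith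
        then show ?thesis by auto
      qed
      have "A \<kappa> = dyadic_cell R \<kappa> \<beta>"
        using dyad_block[OF 3(2)] by (simp add: A_def dyadic_cell_def \<beta>_def)
      moreover have "{j\<in>{..<N}. j \<in> dyad a n} = {j. j < N \<and> j div 2 ^ a = b}"
        using dyad_block[OF 3(1)] by (auto simp: b_def)
      ultimately have "(\<Sum>j<N. of_bool (j \<in> dyad a n) * residual m (A \<kappa>) (z j)) =
         (\<Sum>j | j < N \<and> j div 2 ^ a = b. residual m (dyadic_cell R \<kappa> \<beta>) (z j))"
        by (intro sum.mono_neutral_cong_right) auto
      moreover have "(\<Sum>j | j < N \<and> j div 2 ^ a = b. residual m (dyadic_cell R \<kappa> \<beta>) (z j))\<^sup>2 \<le>
         (\<Sum>\<beta>\<in>?D. (\<Sum>j | j < N \<and> j div 2 ^ a = b. residual m (dyadic_cell R \<kappa> \<beta>) (z j))\<^sup>2)"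
        by (rule member_le_sum[OF \<beta>]) (auto simp: fin)
      moreover have "\<dots> \<le> E a \<kappa>"
        unfolding E_def by (rule member_le_sum[OF b]) (auto intro!: sum_nonneg)
      ultimately show ?thesis by simp
    qed
    then show "(case p of (a, \<kappa>) \<Rightarrow> (\<Sum>j<N. of_bool (j \<in> dyad a n) * residual m (A \<kappa>) (z j))\<^sup>2) \<le> (case p of (a, \<kappa>) \<Rightarrow> E a \<kappa>)"
      by (simp add: p)
  qed
  also have "(\<Sum>(a, \<kappa>)\<in>?P. E a \<kappa>) = dyadic_energy m R K N z"
    unfolding dyadic_energy_def E_def by (rule sum.cartesian_product[symmetric])
  finally show ?thesis
    using order_trans[OF sq mult_right_mono] by (simp add: card_cartesian_product card_PiE mult.commute)
qed

section \<open>Expectation of the dyadic energy\<close>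

context stationary_gaussian begin

lemma integrable_X_sq:
  fixes f :: "real ^ 'p \<Rightarrow> real"
  assumes "1 \<le> j" and [measurable]: "f \<in> borel_measurable borel" and "integrable gauss (\<lambda>x. (f x)\<^sup>2)"
  shows "integrable M (\<lambda>w. (f (X j w))\<^sup>2)"
    and "expectation (\<lambda>w. (f (X j w))\<^sup>2) = (LINT x|gauss. (f x)\<^sup>2)"
  using integrable_distr_eq[OF X_measurable[OF assms(1)], of "\<lambda>x. (f x)\<^sup>2"]
    integral_distr[OF X_measurable[OF assms(1)], of "\<lambda>x. (f x)\<^sup>2"] assms
  by (simp_all add: distr_X_gauss)

text \<open>The covariances are dominated by \<open>v\<close> times a Toeplitz matrix with 1 on the
  diagonal and values of \<open>b\<close> beside it, so a bound on its row sums suffices.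
  \<open>T\<close> is a general index set because it will be a dyadic block.\<close>

lemma
  fixes f :: "real ^ 'p \<Rightarrow> real"
  assumes f [measurable]: "f \<in> borel_measurable borel" and f2: "integrable gauss (\<lambda>x. (f x)\<^sup>2)"
    and v: "(LINT x|gauss. (f x)\<^sup>2) \<le> v"
    and b: "\<And>k. 1 \<le> k \<Longrightarrow> \<bar>LINT x|pair_law k. f (fst x) * f (snd x)\<bar> \<le> b k * v" "\<And>k. 0 \<le> b k"
    and T: "T \<subseteq> {..<N}"
  shows integrable_sum_sq: "integrable M (\<lambda>w. (\<Sum>j\<in>T. f (X (Suc j) w))\<^sup>2)"
    and second_moment_sum: "expectation (\<lambda>w. (\<Sum>j\<in>T. f (X (Suc j) w))\<^sup>2) \<le>
      real (card T) * (1 + 2 * (\<Sum>k\<in>{1..<N}. b k)) * v"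
proof -
  have v0: "0 \<le> v" using order_trans[OF _ v] by simp
  have i: "integrable M (\<lambda>w. f (X (Suc j) w) * f (X (Suc k) w))" for j k
    using X_measurable[of "Suc j"] X_measurable[of "Suc k"]
    by (intro integrable_mult_sq integrable_X_sq f f2) (auto intro: measurable_compose[OF _ f])
  have e: "(\<Sum>j\<in>T. f (X (Suc j) w))\<^sup>2 = (\<Sum>j\<in>T. \<Sum>k\<in>T. f (X (Suc j) w) * f (X (Suc k) w))" for w
    by (simp add: power2_eq_square sum_product)
  show "integrable M (\<lambda>w. (\<Sum>j\<in>T. f (X (Suc j) w))\<^sup>2)"
    unfolding e by (intro Bochner_Integration.integrable_sum i)
  have less: "expectation (\<lambda>w. f (X (Suc j) w) * f (X (Suc k) w)) \<le> b (k - j) * v" if "j < k" for j k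
  proof -
    have "expectation (\<lambda>w. f (X (Suc j) w) * f (X (Suc j + (k - j)) w)) = (LINT x|pair_law (k - j). f (fst x) * f (snd x))"
      using expectation_pair[of "\<lambda>x. f (fst x) * f (snd x)" "Suc j" "k - j"] that by simp
    moreover have "Suc j + (k - j) = Suc k" using that by simp
    ultimately show ?thesis using b(1)[of "k - j"] that by (simp add: abs_le_iff)
  qed
  define B where "B j k = (if j = k then 1 else if j < k then b (k - j) else b (j - k))" for j k
  have B0: "0 \<le> B j k" for j k using b(2) by (auto simp: B_def)
  have le: "expectation (\<lambda>w. f (X (Suc j) w) * f (X (Suc k) w)) \<le> B j k * v" for j k
  proof (cases j k rule: linorder_cases)
    case equal
    then show ?thesis using integrable_X_sq(2)[OF _ f f2, of "Suc j"] v by (simp add: B_def power2_eq_square)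
  next
    case greater
    then show ?thesis using less[of k j] by (simp add: B_def mult.commute)
  qed (use less in \<open>auto simp: B_def\<close>)
  have row: "(\<Sum>k\<in>T. B j k) \<le> 1 + 2 * (\<Sum>k\<in>{1..<N}. b k)" if "j \<in> T" for j
  proof -
    have j: "j < N" using that T by auto
    have "(\<Sum>k\<in>T. B j k) \<le> (\<Sum>k<N. B j k)" using T B0 by (intro sum_mono2) auto
    also have "\<dots> = (\<Sum>k\<in>{..<j}. B j k) + (\<Sum>k\<in>{j}. B j k) + (\<Sum>k\<in>{Suc j..<N}. B j k)"
    proof -
      have N: "{..<N} = ({..<j} \<union> {j}) \<union> {Suc j..<N}" using j by auto
      have "(\<Sum>k<N. B j k) = (\<Sum>k\<in>{..<j} \<union> {j}. B j k) + (\<Sum>k\<in>{Suc j..<N}. B j k)"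
        unfolding N by (rule sum.union_disjoint) auto
      also have "(\<Sum>k\<in>{..<j} \<union> {j}. B j k) = (\<Sum>k\<in>{..<j}. B j k) + (\<Sum>k\<in>{j}. B j k)"
        by (rule sum.union_disjoint) auto
      finally show ?thesis .
    qed
    also have "(\<Sum>k\<in>{j}. B j k) = 1" by (simp add: B_def)
    also have "(\<Sum>k\<in>{..<j}. B j k) \<le> (\<Sum>k\<in>{1..<N}. b k)"
    proof -
      have "(\<Sum>k\<in>{..<j}. B j k) = (\<Sum>k\<in>(\<lambda>k. j - k) ` {..<j}. b k)"
        by (subst sum.reindex) (auto simp: inj_on_def B_def)
      also have "\<dots> \<le> (\<Sum>k\<in>{1..<N}. b k)" using j b(2) by (intro sum_mono2) auto
      finally show ?thesis .
    qed
    also have "(\<Sum>k\<in>{Suc j..<N}. B j k) \<le> (\<Sum>k\<in>{1..<N}. b k)"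
    proof -
      have "(\<Sum>k\<in>{Suc j..<N}. B j k) = (\<Sum>k\<in>(\<lambda>k. k - j) ` {Suc j..<N}. b k)"
        by (subst sum.reindex) (auto simp: inj_on_def B_def)
      also have "\<dots> \<le> (\<Sum>k\<in>{1..<N}. b k)" using j b(2) by (intro sum_mono2) auto
      finally show ?thesis .
    qed
    finally show ?thesis by simp
  qed
  have "expectation (\<lambda>w. (\<Sum>j\<in>T. f (X (Suc j) w))\<^sup>2) =
      (\<Sum>j\<in>T. \<Sum>k\<in>T. expectation (\<lambda>w. f (X (Suc j) w) * f (X (Suc k) w)))"
    unfolding e by (simp add: i)
  also have "\<dots> \<le> (\<Sum>j\<in>T. \<Sum>k\<in>T. B j k * v)" by (intro sum_mono le)
  also have "\<dots> = (\<Sum>j\<in>T. (\<Sum>k\<in>T. B j k) * v)" by (simp add: sum_distrib_right)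
  also have "\<dots> \<le> (\<Sum>j\<in>T. (1 + 2 * (\<Sum>k\<in>{1..<N}. b k)) * v)"
    by (intro sum_mono mult_right_mono row v0)
  finally show "expectation (\<lambda>w. (\<Sum>j\<in>T. f (X (Suc j) w))\<^sup>2) \<le>
      real (card T) * (1 + 2 * (\<Sum>k\<in>{1..<N}. b k)) * v" by simp
qed

text \<open>At a fixed scale the cells are disjoint, so their measures add up to at most 1, and the
  sizes of the time blocks add up to at most \<open>N\<close>. Since the variance bound is linear in
  the measure, the number of cells does not enter; only the number of scales does.\<close>

lemma
  fixes R :: "'q::finite \<Rightarrow> real ^ 'p \<Rightarrow> nat"
  assumes R [measurable]: "\<And>i. R i \<in> measurable borel (count_space UNIV)"
    and b: "\<And>A k. A \<in> sets borel \<Longrightarrow> 1 \<le> k \<Longrightarrow>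
        \<bar>LINT x|pair_law k. residual m A (fst x) * residual m A (snd x)\<bar> \<le> b k * measure gauss A" "\<And>k. 0 \<le> b k"
  shows integrable_dyadic_energy: "integrable M (\<lambda>w. dyadic_energy m R K N (\<lambda>j. X (Suc j) w))"
    and expectation_dyadic_energy: "expectation (\<lambda>w. dyadic_energy m R K N (\<lambda>j. X (Suc j) w)) \<le>
      real (K ^ Suc CARD('q)) * real N * (1 + 2 * (\<Sum>k\<in>{1..<N}. b k))"
proof -
  let ?C = "PiE (UNIV :: 'q set) (\<lambda>_. {..<K})" and ?D = "PiE (UNIV :: 'q set) (\<lambda>_. {..<2 ^ K :: nat})"
  let ?W = "1 + 2 * (\<Sum>k\<in>{1..<N}. b k)"
  have fin: "finite ?C" "finite ?D" by (auto intro: finite_PiE)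
  have W: "0 \<le> ?W" using b(2) by (intro add_nonneg_nonneg mult_nonneg_nonneg sum_nonneg) auto
  note mc = dyadic_cell_measurable[OF R]
  have sub: "{j. j < N \<and> Q j} \<subseteq> {..<N}" for Q by auto
  have sm: "integrable M (\<lambda>w. (\<Sum>j | j < N \<and> Q j. residual m (dyadic_cell R \<kappa> \<beta>) (X (Suc j) w))\<^sup>2)"
    "expectation (\<lambda>w. (\<Sum>j | j < N \<and> Q j. residual m (dyadic_cell R \<kappa> \<beta>) (X (Suc j) w))\<^sup>2) \<le>
      real (card {j. j < N \<and> Q j}) * ?W * measure gauss (dyadic_cell R \<kappa> \<beta>)" for Q \<kappa> \<beta>
    by (rule integrable_sum_sq[OF residual_measurable integrable_residual_sq integral_residual_sq b(1) b(2) sub]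
          second_moment_sum[OF residual_measurable integrable_residual_sq integral_residual_sq b(1) b(2) sub]; (rule mc)?; assumption?)+
  show "integrable M (\<lambda>w. dyadic_energy m R K N (\<lambda>j. X (Suc j) w))"
    unfolding dyadic_energy_def by (intro Bochner_Integration.integrable_sum sm(1))
  have cells: "(\<Sum>\<beta>\<in>?D. measure gauss (dyadic_cell R \<kappa> \<beta>)) \<le> 1" for \<kappa>
  proof -
    have "(\<Sum>\<beta>\<in>?D. measure gauss (dyadic_cell R \<kappa> \<beta>)) = measure gauss (\<Union>\<beta>\<in>?D. dyadic_cell R \<kappa> \<beta>)"
      by (rule gauss.finite_measure_finite_Union[symmetric])
         (auto simp: fin mc disjoint_family_on_def dyadic_cell_def)
    then show ?thesis by simp
  qed
  have blocks: "(\<Sum>b<2 ^ K. card {j. j < N \<and> j div 2 ^ a = b}) \<le> N" for a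
  proof -
    have "(\<Sum>b<2 ^ K. card {j. j < N \<and> j div 2 ^ a = b}) = card (\<Union>b<(2::nat) ^ K. {j. j < N \<and> j div 2 ^ a = b})"
      by (rule card_UN_disjoint[symmetric]) auto
    also have "\<dots> \<le> card {..<N}" by (rule card_mono) auto
    finally show ?thesis by simp
  qed
  have "expectation (\<lambda>w. dyadic_energy m R K N (\<lambda>j. X (Suc j) w)) =
    (\<Sum>a<K. \<Sum>\<kappa>\<in>?C. \<Sum>b<2 ^ K. \<Sum>\<beta>\<in>?D.
      expectation (\<lambda>w. (\<Sum>j | j < N \<and> j div 2 ^ a = b. residual m (dyadic_cell R \<kappa> \<beta>) (X (Suc j) w))\<^sup>2))"
    unfolding dyadic_energy_def using sm(1) by (simp add: Bochner_Integration.integral_sum)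
  also have "\<dots> \<le> (\<Sum>a<K. \<Sum>\<kappa>\<in>?C. \<Sum>b<2 ^ K. \<Sum>\<beta>\<in>?D.
      real (card {j. j < N \<and> j div 2 ^ a = b}) * ?W * measure gauss (dyadic_cell R \<kappa> \<beta>))"
    by (intro sum_mono sm(2))
  also have "\<dots> = (\<Sum>a<K. \<Sum>\<kappa>\<in>?C. real (\<Sum>b<2 ^ K. card {j. j < N \<and> j div 2 ^ a = b}) * ?W *
      (\<Sum>\<beta>\<in>?D. measure gauss (dyadic_cell R \<kappa> \<beta>)))"
    by (simp only: sum_distrib_left[symmetric] sum_distrib_right[symmetric] of_nat_sum)
  also have "\<dots> \<le> (\<Sum>a<K. \<Sum>\<kappa>\<in>?C. real N * ?W * 1)"
    using W blocks cells
    by (intro sum_mono mult_mono) (auto intro!: mult_nonneg_nonneg sum_nonneg simp del: of_nat_sum)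
  also have "\<dots> = real (K ^ Suc CARD('q)) * real N * ?W"
    by (simp add: card_PiE)
  finally show "expectation (\<lambda>w. dyadic_energy m R K N (\<lambda>j. X (Suc j) w)) \<le>
      real (K ^ Suc CARD('q)) * real N * ?W" .
qed

end

subsection \<open>Bracketing by quantiles\<close>

text \<open>Counting both strict and weak level crossings isolates every atom of mass above \<open>1 / Q\<close> in a cell of
  its own.\<close>

definition quantile_rank :: "real measure \<Rightarrow> real \<Rightarrow> real \<Rightarrow> nat" where
  "quantile_rank \<nu> Q y = nat \<lfloor>Q * measure \<nu> {..<y}\<rfloor> + nat \<lfloor>Q * measure \<nu> {..y}\<rfloor>"

context
  fixes \<nu> :: "real measure" and Q :: real
  assumes \<nu>: "prob_space \<nu>" and sets_\<nu> [measurable_cong, simp]: "sets \<nu> = sets borel" and Q: "0 < Q"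
begin

interpretation prob_space \<nu> by (rule \<nu>)

lemma measure_ivl_mono:
  "y \<le> y' \<Longrightarrow> measure \<nu> {..<y} \<le> measure \<nu> {..<y'}"
  "y \<le> y' \<Longrightarrow> measure \<nu> {..y} \<le> measure \<nu> {..y'}"
  by (auto intro!: finite_measure_mono)

lemma quantile_rank_mono: "y \<le> y' \<Longrightarrow> quantile_rank \<nu> Q y \<le> quantile_rank \<nu> Q y'"
  unfolding quantile_rank_def using Q
  by (intro add_mono nat_mono floor_mono mult_left_mono measure_ivl_mono) auto

lemma quantile_rank_measurable: "quantile_rank \<nu> Q \<in> measurable borel (count_space UNIV)"
proof -
  have [measurable]: "(\<lambda>y. measure \<nu> {..<y}) \<in> borel_measurable borel" "(\<lambda>y. measure \<nu> {..y}) \<in> borel_measurable borel"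
    by (auto intro!: borel_measurable_mono monoI measure_ivl_mono)
  show ?thesis unfolding quantile_rank_def[abs_def] by measurable
qed

lemma quantile_rank_le: "quantile_rank \<nu> Q y \<le> 2 * nat \<lfloor>Q\<rfloor>"
proof -
  have "nat \<lfloor>Q * p\<rfloor> \<le> nat \<lfloor>Q\<rfloor>" if "p \<le> 1" for p
    using Q that mult_left_mono[of p 1 Q] by (intro nat_mono floor_mono) auto
  from this[OF prob_le_1[of "{..<y}"]] this[OF prob_le_1[of "{..y}"]] show ?thesis
    by (simp add: quantile_rank_def)
qed

text \<open>Both summands of the rank are monotone, so equal ranks force both integer parts to
  agree.\<close>

lemma quantile_rank_eq_diff:
  assumes le: "y \<le> y'" and eq: "quantile_rank \<nu> Q y = quantile_rank \<nu> Q y'"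
  shows "measure \<nu> {..<y'} - measure \<nu> {..<y} < 1 / Q" "measure \<nu> {..y'} - measure \<nu> {..y} < 1 / Q"
proof -
  have *: "a' - a < 1 / Q" if "nat \<lfloor>Q * a\<rfloor> = nat \<lfloor>Q * a'\<rfloor>" "0 \<le> a" "0 \<le> a'" for a a'
  proof -
    have "\<lfloor>Q * a\<rfloor> = \<lfloor>Q * a'\<rfloor>" using that Q by (simp add: nat_eq_iff)
    then have "Q * a' - Q * a < 1" by linarith
    then show ?thesis using Q by (simp add: field_simps)
  qed
  have "nat \<lfloor>Q * measure \<nu> {..<y}\<rfloor> \<le> nat \<lfloor>Q * measure \<nu> {..<y'}\<rfloor>"
    "nat \<lfloor>Q * measure \<nu> {..y}\<rfloor> \<le> nat \<lfloor>Q * measure \<nu> {..y'}\<rfloor>"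
    using Q le by (auto intro!: nat_mono floor_mono mult_left_mono measure_ivl_mono)
  with eq show "measure \<nu> {..<y'} - measure \<nu> {..<y} < 1 / Q" "measure \<nu> {..y'} - measure \<nu> {..y} < 1 / Q"
    by (auto intro!: * simp: quantile_rank_def)
qed

text \<open>A second point of the cell to the right of \<open>y\<close> bounds the atom at
  \<open>y\<close> through the strict distribution function, one to the left through the weak one.
  An interval with both ends in the cell then has mass at most 2 / Q. As the cell need not contain
  its end points, its mass is reached through compact subsets, which lie in such intervals.\<close>

lemma quantile_rank_cell:
  assumes z: "z \<noteq> y0" "quantile_rank \<nu> Q z = quantile_rank \<nu> Q y0"
  shows "measure \<nu> {y. quantile_rank \<nu> Q y = quantile_rank \<nu> Q y0} \<le> 2 / Q"
proof -
  let ?C = "{y. quantile_rank \<nu> Q y = quantile_rank \<nu> Q y0}"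
  have C: "?C \<in> sets borel"
    using measurable_sets[OF quantile_rank_measurable, of "{quantile_rank \<nu> Q y0}"] by (simp add: vimage_def)
  have le_less: "measure \<nu> {..a} \<le> measure \<nu> {..<b}" if "a < b" for a b :: real
    using that by (intro finite_measure_mono) auto
  have atom: "measure \<nu> {..y} - measure \<nu> {..<y} < 1 / Q" if y: "y \<in> ?C" for y
  proof -
    obtain z' where z': "z' \<in> ?C" "z' \<noteq> y" using z by (cases "y = y0") auto
    then have eq: "quantile_rank \<nu> Q y = quantile_rank \<nu> Q z'" using y by simp
    show ?thesis
    proof (cases "y < z'")
      case True
      then show ?thesis using quantile_rank_eq_diff(1)[OF _ eq] le_less[of y z'] by simp
    next
      case False
      with z' have "z' < y" by simp
      then show ?thesis using quantile_rank_eq_diff(2)[OF _ eq[symmetric]] le_less[of z' y] by simp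
    qed
  qed
  have ivl: "measure \<nu> {y..y'} \<le> 2 / Q" if "y \<in> ?C" "y' \<in> ?C" "y \<le> y'" for y y'
  proof -
    have "measure \<nu> {y..y'} = measure \<nu> ({..y'} - {..<y})"
      by (rule arg_cong[where f="measure \<nu>"]) auto
    also have "\<dots> = measure \<nu> {..y'} - measure \<nu> {..<y}"
      using \<open>y \<le> y'\<close> by (intro finite_measure_Diff) auto
    also have "\<dots> \<le> 1 / Q + 1 / Q"
      using atom[OF that(1)] quantile_rank_eq_diff(2)[OF that(3)] that by fastforce
    finally show ?thesis by simp
  qed
  have "emeasure \<nu> ?C = (SUP K\<in>{K. K \<subseteq> ?C \<and> compact K}. emeasure \<nu> K)"
    by (rule inner_regular) (use C in auto)
  also have "\<dots> \<le> ennreal (2 / Q)"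
  proof (rule SUP_least, safe)
    fix K assume K: "K \<subseteq> ?C" "compact K"
    show "emeasure \<nu> K \<le> ennreal (2 / Q)"
    proof (cases "K = {}")
      case False
      obtain y where y: "y \<in> K" "\<And>x. x \<in> K \<Longrightarrow> y \<le> x" using compact_attains_inf[OF K(2) False] by auto
      obtain y' where y': "y' \<in> K" "\<And>x. x \<in> K \<Longrightarrow> x \<le> y'" using compact_attains_sup[OF K(2) False] by auto
      have "emeasure \<nu> K \<le> emeasure \<nu> {y..y'}" using y y' by (intro emeasure_mono) auto
      also have "\<dots> \<le> ennreal (2 / Q)"
        using ivl[of y y'] y y' K(1) by (auto simp: emeasure_eq_measure intro!: ennreal_leI)
      finally show ?thesis .
    qed simp
  qed
  finally show ?thesis using Q by (simp add: emeasure_eq_measure)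
qed

text \<open>If the cell of a real threshold is a single point, the half line is exactly a union of
  cells, however heavy the atom. Otherwise that cell is the gap of the bracket. The number
  \<open>Suc (2 * nat \<lfloor>Q\<rfloor>)\<close> exceeds all ranks and serves the threshold
  \<infinity>.\<close>

lemma quantile_rank_bracket:
  obtains n0 n1 where "n0 \<le> Suc (2 * nat \<lfloor>Q\<rfloor>)" "n1 \<le> Suc (2 * nat \<lfloor>Q\<rfloor>)"
    "{y. quantile_rank \<nu> Q y < n0} \<subseteq> {y. ereal y \<le> x}" "{y. ereal y \<le> x} \<subseteq> {y. quantile_rank \<nu> Q y < n1}"
    "measure \<nu> {y. n0 \<le> quantile_rank \<nu> Q y \<and> quantile_rank \<nu> Q y < n1} \<le> 2 / Q"
proof (cases x)
  case PInf
  show ?thesis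
  proof (rule that[of "Suc (2 * nat \<lfloor>Q\<rfloor>)" "Suc (2 * nat \<lfloor>Q\<rfloor>)"])
    have e: "{y. Suc (2 * nat \<lfloor>Q\<rfloor>) \<le> quantile_rank \<nu> Q y \<and> quantile_rank \<nu> Q y < Suc (2 * nat \<lfloor>Q\<rfloor>)} = {}"
      by auto
    show "measure \<nu> {y. Suc (2 * nat \<lfloor>Q\<rfloor>) \<le> quantile_rank \<nu> Q y \<and> quantile_rank \<nu> Q y < Suc (2 * nat \<lfloor>Q\<rfloor>)} \<le> 2 / Q"
      unfolding e using Q by simp
  qed (use quantile_rank_le PInf in \<open>auto simp: less_Suc_eq_le\<close>)
next
  case MInf
  then show ?thesis using Q by (intro that[of 0 0]) auto
next
  case (real r)
  let ?k = "quantile_rank \<nu> Q r"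
  have less: "y \<le> r" if "quantile_rank \<nu> Q y < ?k" for y
    using quantile_rank_mono[of r y] that by linarith
  show ?thesis
  proof (cases "\<exists>z. z \<noteq> r \<and> quantile_rank \<nu> Q z = ?k")
    case True
    then have "measure \<nu> {y. quantile_rank \<nu> Q y = ?k} \<le> 2 / Q" using quantile_rank_cell by blast
    moreover have "{y. ?k \<le> quantile_rank \<nu> Q y \<and> quantile_rank \<nu> Q y < Suc ?k} = {y. quantile_rank \<nu> Q y = ?k}"
      by auto
    ultimately show ?thesis
      using quantile_rank_le[of r] less real quantile_rank_mono
      by (intro that[of ?k "Suc ?k"]) (auto simp: less_Suc_eq_le)
  next
    case False
    have "y \<le> r" if "quantile_rank \<nu> Q y < Suc ?k" for y
      using False less[of y] that by (metis less_SucE order_refl)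
    show ?thesis
    proof (rule that[of "Suc ?k" "Suc ?k"])
      have e: "{y. Suc ?k \<le> quantile_rank \<nu> Q y \<and> quantile_rank \<nu> Q y < Suc ?k} = {}" by auto
      show "measure \<nu> {y. Suc ?k \<le> quantile_rank \<nu> Q y \<and> quantile_rank \<nu> Q y < Suc ?k} \<le> 2 / Q"
        unfolding e using Q by simp
    qed (use \<open>\<And>y. quantile_rank \<nu> Q y < Suc ?k \<Longrightarrow> y \<le> r\<close> quantile_rank_le[of r] real quantile_rank_mono
        in \<open>auto simp: less_Suc_eq_le\<close>)
  qed
qed

end

lemma lower_set_measurable:
  fixes G :: "real ^ 'p::finite \<Rightarrow> real ^ 'q::finite"
  assumes [measurable]: "G \<in> borel_measurable borel"
  shows "{s. evec (G s) \<le> x} \<in> sets borel"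
  unfolding less_eq_vec_def evec_def vec_lambda_beta by measurable

text \<open>A point between the two boxes lies in the gap of at least one coordinate, so the gaps
  are added up over the coordinates.\<close>

lemma quantile_rank_bracket_vec:
  fixes G :: "real ^ 'p::finite \<Rightarrow> real ^ 'q::finite"
  assumes G [measurable]: "G \<in> borel_measurable borel" and Q: "0 < Q"
  defines "R \<equiv> \<lambda>i s. quantile_rank (distr gauss borel (\<lambda>s. G s $ i)) Q (G s $ i)"
  shows "\<And>i. R i \<in> measurable borel (count_space UNIV)"
    and "\<exists>n0 n1. (\<forall>i. n0 i \<le> Suc (2 * nat \<lfloor>Q\<rfloor>)) \<and> (\<forall>i. n1 i \<le> Suc (2 * nat \<lfloor>Q\<rfloor>)) \<and>
      {s. \<forall>i. R i s < n0 i} \<subseteq> {s. evec (G s) \<le> x} \<and> {s. evec (G s) \<le> x} \<subseteq> {s. \<forall>i. R i s < n1 i} \<and>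
      measure gauss ({s. \<forall>i. R i s < n1 i} - {s. \<forall>i. R i s < n0 i}) \<le> real CARD('q) * (2 / Q)"
proof -
  define \<nu> where "\<nu> i = distr gauss borel (\<lambda>s. G s $ i)" for i
  have \<nu>: "prob_space (\<nu> i)" "sets (\<nu> i) = sets borel" for i
    by (auto simp: \<nu>_def intro!: gauss.prob_space_distr)
  note [measurable] = quantile_rank_measurable[OF \<nu> Q]
  show Rm [measurable]: "R i \<in> measurable borel (count_space UNIV)" for i
    unfolding R_def \<nu>_def[symmetric] by measurable
  define P where "P i n0 n1 \<longleftrightarrow> n0 \<le> Suc (2 * nat \<lfloor>Q\<rfloor>) \<and> n1 \<le> Suc (2 * nat \<lfloor>Q\<rfloor>) \<and>
    {y. quantile_rank (\<nu> i) Q y < n0} \<subseteq> {y. ereal y \<le> x $ i} \<and> {y. ereal y \<le> x $ i} \<subseteq> {y. quantile_rank (\<nu> i) Q y < n1} \<and>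
    measure (\<nu> i) {y. n0 \<le> quantile_rank (\<nu> i) Q y \<and> quantile_rank (\<nu> i) Q y < n1} \<le> 2 / Q" for i n0 n1
  have "\<exists>n0 n1. P i n0 n1" for i
  proof -
    obtain n0 n1 where "n0 \<le> Suc (2 * nat \<lfloor>Q\<rfloor>)" "n1 \<le> Suc (2 * nat \<lfloor>Q\<rfloor>)"
      "{y. quantile_rank (\<nu> i) Q y < n0} \<subseteq> {y. ereal y \<le> x $ i}"
      "{y. ereal y \<le> x $ i} \<subseteq> {y. quantile_rank (\<nu> i) Q y < n1}"
      "measure (\<nu> i) {y. n0 \<le> quantile_rank (\<nu> i) Q y \<and> quantile_rank (\<nu> i) Q y < n1} \<le> 2 / Q"
      by (rule quantile_rank_bracket[OF \<nu> Q])
    then show ?thesis unfolding P_def by blast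
  qed
  then obtain n0 n1 where n: "\<And>i. P i (n0 i) (n1 i)" by metis
  let ?A = "{s. \<forall>i. R i s < n0 i}" and ?B = "{s. \<forall>i. R i s < n1 i}"
  let ?D = "\<lambda>i. {s. n0 i \<le> R i s \<and> R i s < n1 i}"
  have D: "measure gauss (?D i) \<le> 2 / Q" for i
  proof -
    have S: "{y. n0 i \<le> quantile_rank (\<nu> i) Q y \<and> quantile_rank (\<nu> i) Q y < n1 i} \<in> sets borel" by measurable
    have "measure (\<nu> i) {y. n0 i \<le> quantile_rank (\<nu> i) Q y \<and> quantile_rank (\<nu> i) Q y < n1 i} = measure gauss (?D i)"
      by (subst (1) \<nu>_def, subst measure_distr[OF _ S]) (auto simp: R_def \<nu>_def vimage_def)
    then show ?thesis using n[of i] by (simp add: P_def)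
  qed
  have "measure gauss (?B - ?A) \<le> measure gauss (\<Union>i\<in>UNIV. ?D i)"
    by (intro gauss.finite_measure_mono) (auto simp: not_less)
  also have "\<dots> \<le> (\<Sum>i\<in>UNIV. measure gauss (?D i))"
    by (intro gauss.finite_measure_subadditive_finite) auto
  also have "\<dots> \<le> (\<Sum>i\<in>(UNIV::'q set). 2 / Q)" by (intro sum_mono D)
  finally have m: "measure gauss (?B - ?A) \<le> real CARD('q) * (2 / Q)" by simp
  have E: "{s. evec (G s) \<le> x} = {s. \<forall>i. ereal (G s $ i) \<le> x $ i}" by (simp add: less_eq_vec_def evec_def)
  have "?A \<subseteq> {s. evec (G s) \<le> x}" "{s. evec (G s) \<le> x} \<subseteq> ?B"
    using n unfolding E P_def R_def \<nu>_def[symmetric] by blast+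
  then show "\<exists>n0 n1. (\<forall>i. n0 i \<le> Suc (2 * nat \<lfloor>Q\<rfloor>)) \<and> (\<forall>i. n1 i \<le> Suc (2 * nat \<lfloor>Q\<rfloor>)) \<and>
      {s. \<forall>i. R i s < n0 i} \<subseteq> {s. evec (G s) \<le> x} \<and> {s. evec (G s) \<le> x} \<subseteq> {s. \<forall>i. R i s < n1 i} \<and>
      measure gauss ({s. \<forall>i. R i s < n1 i} - {s. \<forall>i. R i s < n0 i}) \<le> real CARD('q) * (2 / Q)"
    using n m unfolding P_def by blast
qed

subsection \<open>Elementary estimates\<close>

text \<open>Young's inequality bounds (x - 1)^(1 - \<beta>) x^\<beta> by x - (1 - \<beta>); divided
  by x^\<beta> this says that the increment of x^(1 - \<beta>) is at least (1 - \<beta>)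
  x^(-\<beta>), and the increments telescope.\<close>

lemma sum_powr_le:
  assumes \<beta>: "0 < \<beta>" "\<beta> < 1"
  shows "(\<Sum>k\<in>{1..<N}. real k powr (- \<beta>)) \<le> real N powr (1 - \<beta>) / (1 - \<beta>)"
proof -
  have "(1 - \<beta>) * (\<Sum>k\<in>{1..n}. real k powr (- \<beta>)) \<le> real n powr (1 - \<beta>)" for n
  proof (induction n)
    case (Suc n)
    define x where "x = real (Suc n)"
    have x: "1 \<le> x" "real n = x - 1" by (auto simp: x_def)
    have *: "(x - 1) powr (1 - \<beta>) * x powr \<beta> \<le> (1 - \<beta>) * (x - 1) + \<beta> * x"
    proof (cases "x = 1")
      case False
      then show ?thesis using \<beta> x by (intro Youngs_inequality_0) auto
    qed (use \<beta> in auto)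
    have "(x - 1) powr (1 - \<beta>) = (x - 1) powr (1 - \<beta>) * x powr \<beta> * x powr (- \<beta>)"
      using x by (simp add: powr_minus field_simps)
    also have "\<dots> \<le> ((1 - \<beta>) * (x - 1) + \<beta> * x) * x powr (- \<beta>)"
      by (intro mult_right_mono *) auto
    also have "\<dots> = x powr (1 - \<beta>) - (1 - \<beta>) * x powr (- \<beta>)"
      using x by (simp add: powr_diff powr_minus field_simps)
    finally show ?case using Suc x(2) by (simp add: x_def[symmetric] algebra_simps)
  qed simp
  from this[of "N - 1"] have "(1 - \<beta>) * (\<Sum>k\<in>{1..<N}. real k powr (- \<beta>)) \<le> real (N - 1) powr (1 - \<beta>)"
  proof -
    have "{1..<N} = {1..N - 1}" by auto
    then show ?thesis using \<open>(1 - \<beta>) * (\<Sum>k\<in>{1..N - 1}. real k powr (- \<beta>)) \<le> _\<close> by simp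
  qed
  also have "\<dots> \<le> real N powr (1 - \<beta>)" using \<beta> by (intro powr_mono2) auto
  finally show ?thesis using \<beta> by (simp add: pos_le_divide_eq mult.commute)
qed

lemma double_sum_diff:
  fixes g :: "nat \<Rightarrow> real"
  shows "(\<Sum>j<N. \<Sum>k<N. g (if j < k then k - j else j - k)) = real N * g 0 + 2 * (\<Sum>k\<in>{1..<N}. real (N - k) * g k)"
proof (induction N)
  case (Suc N)
  have r: "(\<Sum>j<N. g (N - j)) = (\<Sum>k\<in>{1..<Suc N}. g k)"
  proof -
    have "(\<Sum>k\<in>{1..<Suc N}. g k) = (\<Sum>k\<in>(\<lambda>j. N - j) ` {..<N}. g k)"
    proof (rule sum.cong)
      show "{1..<Suc N} = (\<lambda>j. N - j) ` {..<N}"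
      proof (intro equalityI subsetI)
        fix k assume "k \<in> {1..<Suc N}"
        then show "k \<in> (\<lambda>j. N - j) ` {..<N}" by (intro image_eqI[of _ _ "N - k"]) auto
      qed auto
    qed simp
    also have "\<dots> = (\<Sum>j<N. g (N - j))" by (subst sum.reindex) (auto simp: inj_on_def)
    finally show ?thesis ..
  qed
  have "(\<Sum>j<Suc N. \<Sum>k<Suc N. g (if j < k then k - j else j - k)) =
      (\<Sum>j<N. \<Sum>k<N. g (if j < k then k - j else j - k)) + (\<Sum>j<N. g (N - j)) + (\<Sum>k<N. g (N - k)) + g 0"
    by (simp add: sum.distrib)
  also have "\<dots> = real N * g 0 + 2 * (\<Sum>k\<in>{1..<N}. real (N - k) * g k) + 2 * (\<Sum>k\<in>{1..<Suc N}. g k) + g 0"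
    unfolding Suc.IH r by simp
  \<comment> \<open>The additional index \<open>k = N\<close> carries weight 0.\<close>
  also have "(\<Sum>k\<in>{1..<N}. real (N - k) * g k) = (\<Sum>k\<in>{1..<Suc N}. real (N - k) * g k)"
    by (cases N) auto
  also have "real N * g 0 + 2 * (\<Sum>k\<in>{1..<Suc N}. real (N - k) * g k) + 2 * (\<Sum>k\<in>{1..<Suc N}. g k) + g 0 =
      real (Suc N) * g 0 + 2 * (\<Sum>k\<in>{1..<Suc N}. real (N - k) * g k + g k)"
    unfolding sum.distrib distrib_left of_nat_Suc distrib_right by simp
  also have "(\<Sum>k\<in>{1..<Suc N}. real (N - k) * g k + g k) = (\<Sum>k\<in>{1..<Suc N}. real (Suc N - k) * g k)"
    by (intro sum.cong refl) (auto simp: Suc_diff_le algebra_simps)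
  finally show ?case .
qed simp

text \<open>The first terms have unknown sign but lose at most k0 N, which is negligible because
  \<alpha> < 1. At least N / 4 of the terms below N / 2 contribute N / 2 times a N^(-\<alpha>) each;
  the terms from there on are nonnegative. This gives a / 8, half of which is given up for the first
  terms.\<close>

lemma weighted_sum_lower:
  fixes e :: "nat \<Rightarrow> real"
  assumes e: "\<And>k. 1 \<le> k \<Longrightarrow> \<bar>e k\<bar> \<le> 1" and a: "0 < a" and \<alpha>: "0 < \<alpha>" "\<alpha> < 1"
    and lower: "\<And>k. k0 \<le> k \<Longrightarrow> a * real k powr (- \<alpha>) \<le> e k"
  shows "\<exists>c>0. \<forall>\<^sub>F N in sequentially. c * real N powr (2 - \<alpha>) \<le> (\<Sum>k\<in>{1..<N}. real (N - k) * e k)"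
proof (intro exI conjI)
  show "0 < a / 16" using a by simp
  have "filterlim (\<lambda>N. real N powr (1 - \<alpha>)) at_top sequentially"
    using \<alpha> by (intro filterlim_compose[OF real_powr_at_top filterlim_real_sequentially]) simp
  \<comment> \<open>Makes the loss k0 N at most a / 16 times N^(2 - \<alpha>); the next condition
    leaves N / 4 indices between \<open>max 1 k0\<close> and N / 2.\<close>
  then have "\<forall>\<^sub>F N in sequentially. 16 * real k0 / a \<le> real N powr (1 - \<alpha>)" by (simp add: filterlim_at_top)
  moreover have "\<forall>\<^sub>F N in sequentially. 4 * k0 + 8 \<le> N" by (rule eventually_ge_at_top)
  ultimately show "\<forall>\<^sub>F N in sequentially. a / 16 * real N powr (2 - \<alpha>) \<le> (\<Sum>k\<in>{1..<N}. real (N - k) * e k)"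
  proof eventually_elim
    case (elim N)
    define h where "h = N div 2"
    have N: "0 < N" using elim by simp
    have h: "2 * h \<le> N" "N \<le> 2 * h + 1" by (auto simp: h_def)
    let ?k = "max 1 k0"
    have s1: "- (real k0 * real N) \<le> (\<Sum>k\<in>{1..<?k}. real (N - k) * e k)"
    proof -
      have "\<bar>\<Sum>k\<in>{1..<?k}. real (N - k) * e k\<bar> \<le> (\<Sum>k\<in>{1..<?k}. real N * 1)"
      proof (intro order_trans[OF sum_abs] sum_mono)
        fix k assume "k \<in> {1..<?k}"
        then show "\<bar>real (N - k) * e k\<bar> \<le> real N * 1"
          unfolding abs_mult using e[of k] by (intro mult_mono) auto
      qed
      also have "\<dots> \<le> real k0 * real N" by (auto simp: max_def intro!: mult_right_mono)
      finally show ?thesis by (simp add: abs_le_iff)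
    qed
    have s3: "0 \<le> (\<Sum>k\<in>{h..<N}. real (N - k) * e k)"
    proof (intro sum_nonneg mult_nonneg_nonneg)
      fix k assume "k \<in> {h..<N}"
      then have "a * real k powr (- \<alpha>) \<le> e k" using elim h by (intro lower) auto
      moreover have "0 \<le> a * real k powr (- \<alpha>)" using a by simp
      ultimately show "0 \<le> e k" by linarith
    qed simp
    have s2: "real (h - ?k) * (real N / 2 * (a * real N powr (- \<alpha>))) \<le> (\<Sum>k\<in>{?k..<h}. real (N - k) * e k)"
    proof -
      have "(\<Sum>k\<in>{?k..<h}. real N / 2 * (a * real N powr (- \<alpha>))) \<le> (\<Sum>k\<in>{?k..<h}. real (N - k) * e k)"
      proof (intro sum_mono mult_mono)
        fix k assume k: "k \<in> {?k..<h}"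
        then have "2 * k \<le> N" using h by auto
        then show "real N / 2 \<le> real (N - k)" by (auto simp: of_nat_diff)
        have "real N powr (- \<alpha>) \<le> real k powr (- \<alpha>)"
          using k h \<alpha> by (intro powr_mono2') auto
        then have "a * real N powr (- \<alpha>) \<le> a * real k powr (- \<alpha>)" using a by simp
        also have "\<dots> \<le> e k" using k by (intro lower) auto
        finally show "a * real N powr (- \<alpha>) \<le> e k" .
      qed (use a in auto)
      then show ?thesis by simp
    qed
    have q: "real N / 4 \<le> real (h - ?k)"
      using elim h by (auto simp: of_nat_diff)
    have p2: "real N powr (2 - \<alpha>) = real N * (real N * real N powr (- \<alpha>))"
      using N by (simp add: powr_diff powr_minus power2_eq_square field_simps)
    have p1: "real N powr (2 - \<alpha>) = real N * real N powr (1 - \<alpha>)"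
      using N by (simp add: powr_diff field_simps power2_eq_square)
    have "a / 8 * real N powr (2 - \<alpha>) \<le> real (h - ?k) * (real N / 2 * (a * real N powr (- \<alpha>)))"
      using mult_right_mono[OF q, of "real N / 2 * (a * real N powr (- \<alpha>))"] a
      by (simp add: p2 mult_ac)
    moreover have "real k0 * real N \<le> a / 16 * real N powr (2 - \<alpha>)"
      using elim(1) a N unfolding p1 by (simp add: field_simps)
    moreover have "(\<Sum>k\<in>{1..<N}. real (N - k) * e k) =
       (\<Sum>k\<in>{1..<?k}. real (N - k) * e k) + (\<Sum>k\<in>{?k..<h}. real (N - k) * e k) + (\<Sum>k\<in>{h..<N}. real (N - k) * e k)"
    proof -
      have "(\<Sum>k\<in>{1..<N}. real (N - k) * e k) = (\<Sum>k\<in>{1..<?k}. real (N - k) * e k) + (\<Sum>k\<in>{?k..<N}. real (N - k) * e k)"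
        using elim by (intro sum.atLeastLessThan_concat[symmetric]) auto
      also have "(\<Sum>k\<in>{?k..<N}. real (N - k) * e k) = (\<Sum>k\<in>{?k..<h}. real (N - k) * e k) + (\<Sum>k\<in>{h..<N}. real (N - k) * e k)"
        using elim h by (intro sum.atLeastLessThan_concat[symmetric]) auto
      finally show ?thesis by simp
    qed
    ultimately show ?case using s1 s2 s3 by linarith
  qed
qed

text \<open>\<open>K\<close> is a number of binary digits sufficient for all times up to
  \<open>N\<close> and for all thresholds used by \<open>quantile_rank_bracket\<close> at Q = N^2.
  It is logarithmic in \<open>N\<close>, hence below any power.\<close>

lemma dyadic_size:
  assumes \<eta>: "0 < \<eta>"
  shows "\<exists>C>0. \<forall>N\<ge>1. \<exists>K. 2 * N\<^sup>2 + 1 < 2 ^ K \<and> real K \<le> C * real N powr \<eta>"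
proof (rule exI[of _ "(2 + 2 / \<eta>) / ln 2"], rule conjI, goal_cases)
  case 1
  show "0 < (2 + 2 / \<eta>) / ln 2" using \<eta> by (intro divide_pos_pos add_pos_pos) auto
next
  case 2
  show ?case
  proof (intro allI impI)
    fix N :: nat assume N: "1 \<le> N"
    obtain k where k: "2 ^ k \<le> 2 * N\<^sup>2 + 1" "2 * N\<^sup>2 + 1 < 2 ^ (k + 1)"
      using ex_power_ivl1[of 2 "2 * N\<^sup>2 + 1"] by auto
    have "2 ^ (k + 1) \<le> 6 * N\<^sup>2"
    proof -
      have "1 \<le> N\<^sup>2" using N by simp
      then show ?thesis using k(1) by simp
    qed
    then have "real (2 ^ (k + 1)) \<le> real (6 * N\<^sup>2)" by (simp only: of_nat_le_iff)
    then have "ln (2 ^ (k + 1) :: real) \<le> ln (6 * (real N)\<^sup>2)" using N by (subst ln_le_cancel_iff) auto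
    then have 1: "real (k + 1) * ln 2 \<le> ln 6 + 2 * ln (real N)"
      using N by (simp add: ln_realpow ln_mult algebra_simps)
    have 2: "ln 6 \<le> (2::real)"
    proof -
      have "(6::real) \<le> (5/2)\<^sup>2" by (simp add: power2_eq_square)
      also have "\<dots> \<le> (exp 1)\<^sup>2" using exp_lower_Taylor_quadratic[of "1::real"] by (intro power_mono) auto
      also have "\<dots> = exp (2::real)" by (simp add: power2_eq_square exp_add[symmetric])
      finally have "ln 6 \<le> ln (exp (2::real))" by (subst ln_le_cancel_iff) auto
      then show ?thesis by simp
    qed
    have 3: "1 \<le> real N powr \<eta>" using N \<eta> by (simp add: ge_one_powr_ge_zero)
    have "ln (real N) \<le> real N powr \<eta> / \<eta>" using N \<eta> by (intro ln_powr_bound) auto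
    then have "real (k + 1) * ln 2 \<le> 2 * real N powr \<eta> + 2 * (real N powr \<eta> / \<eta>)" using 1 2 3 by linarith
    also have "\<dots> = (2 + 2 / \<eta>) * real N powr \<eta>" by (simp add: algebra_simps)
    finally have "real (k + 1) * ln 2 \<le> (2 + 2 / \<eta>) * real N powr \<eta>" .
    then have "real (k + 1) \<le> (2 + 2 / \<eta>) / ln 2 * real N powr \<eta>" by (simp add: field_simps)
    with k(2) show "\<exists>K. 2 * N\<^sup>2 + 1 < 2 ^ K \<and> real K \<le> (2 + 2 / \<eta>) / ln 2 * real N powr \<eta>" by blast
  qed
qed

subsection \<open>The norming factor and the maximal inequality\<close>

context stationary_gaussian begin

lemma variance_hermite_sum:
  assumes m: "1 \<le> m"
  shows "variance (\<lambda>w. \<Sum>j=1..N. hermite m (X j w $ i)) =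
    fact m * (real N + 2 * (\<Sum>k\<in>{1..<N}. real (N - k) * (c i i * t k) ^ m))"
proof -
  define l where "l = (\<lambda>i'. if i' = i then m else 0)"
  have hl: "hermite_multi l x = hermite m (x $ i)" for x :: "real ^ 'p"
    unfolding l_def by (rule hermite_multi_single)
  have l0: "l \<noteq> (\<lambda>_. 0)" using m by (auto simp: l_def fun_eq_iff intro!: exI[of _ i])
  have fl: "(\<Prod>i'\<in>UNIV. fact (l i')) = (fact m :: real)"
  proof -
    have "(\<Prod>i'\<in>UNIV. fact (l i')) = (\<Prod>i'\<in>UNIV. if i' = i then fact m else (1::real))"
      unfolding l_def by (intro prod.cong) auto
    then show ?thesis by simp
  qed
  define h where "h j w = hermite m (X (Suc j) w $ i)" for j w
  have h: "h j w = hermite_multi l (X (Suc j) w)" for j w by (simp add: h_def hl)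
  have hm [measurable]: "h j \<in> borel_measurable M" for j
    unfolding h[abs_def] by (rule measurable_compose[OF X_measurable hermite_multi_measurable]) simp
  have h2: "integrable M (\<lambda>w. (h j w)\<^sup>2)" "expectation (\<lambda>w. (h j w)\<^sup>2) = fact m" for j
    using integrable_X_sq[of "Suc j" "hermite_multi l"] integrable_hermite_multi_sq[of l]
      integral_hermite_multi_mult[of l l] by (simp_all add: h power2_eq_square fl)
  have hi: "integrable M (h j)" for j
    using integrable_mult_sq[OF hm[of j] borel_measurable_const[of 1] h2(1)] by simp
  have h0: "expectation (h j) = 0" for j
  proof -
    have "expectation (h j) = (LINT x|gauss. hermite_multi l x * hermite_multi (\<lambda>_. 0) x)"
      unfolding h[abs_def] distr_X_gauss[of "Suc j", symmetric, simplified]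
      by (subst integral_distr) (auto simp: X_measurable)
    also have "\<dots> = 0" using l0 by (subst integral_hermite_multi_mult) simp
    finally show ?thesis .
  qed
  define g where "g k = (if k = 0 then fact m else fact m * (c i i * t k) ^ m)" for k
  have less: "expectation (\<lambda>w. h j w * h k w) = g (k - j)" if "j < k" for j k
    using expectation_hermite_pair[of "Suc j" "k - j" m i] that by (simp add: h_def g_def)
  have E: "expectation (\<lambda>w. h j w * h k w) = g (if j < k then k - j else j - k)" for j k
  proof (cases j k rule: linorder_cases)
    case equal
    then show ?thesis using h2(2)[of j] by (simp add: g_def power2_eq_square)
  next
    case greater
    then show ?thesis using less[of k j] by (simp add: mult.commute)
  qed (use less in simp)
  have S: "(\<Sum>j=1..N. hermite m (X j w $ i)) = (\<Sum>j<N. h j w)" for w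
    by (simp add: h_def sum.atLeast1_atMost_eq)
  have hh: "integrable M (\<lambda>w. h j w * h k w)" for j k
    by (rule integrable_mult_sq) (auto intro: h2)
  have "variance (\<lambda>w. \<Sum>j=1..N. hermite m (X j w $ i)) = expectation (\<lambda>w. (\<Sum>j<N. h j w)\<^sup>2)"
    unfolding S using hi h0 by simp
  also have "\<dots> = (\<Sum>j<N. \<Sum>k<N. expectation (\<lambda>w. h j w * h k w))"
    unfolding power2_eq_square sum_product by (simp add: hh)
  also have "\<dots> = real N * g 0 + 2 * (\<Sum>k\<in>{1..<N}. real (N - k) * g k)"
    unfolding E by (rule double_sum_diff)
  also have "(\<Sum>k\<in>{1..<N}. real (N - k) * g k) = fact m * (\<Sum>k\<in>{1..<N}. real (N - k) * (c i i * t k) ^ m)"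
    unfolding sum_distrib_left by (intro sum.cong) (auto simp: g_def)
  finally show ?thesis by (simp add: g_def algebra_simps)
qed

lemma norm_factor_sq:
  assumes "1 \<le> m"
  shows "(norm_factor M X i m N)\<^sup>2 = fact m * (real N + 2 * (\<Sum>k\<in>{1..<N}. real (N - k) * (c i i * t k) ^ m))"
  unfolding norm_factor_def variance_hermite_sum[OF assms, symmetric] by (rule real_sqrt_pow2) simp

text \<open>If \<open>c i i ^ m\<close> were negative, the same growth estimate would make the variance negative.\<close>

lemma norm_factor_growth:
  assumes m: "1 \<le> m" and ci: "c i i \<noteq> 0" and \<alpha>: "0 < \<alpha>" "\<alpha> < 1"
    and t: "\<forall>\<^sub>F k in sequentially. real k powr (- \<alpha> / real m) \<le> t k"
  shows "\<exists>d>0. \<forall>\<^sub>F N in sequentially. d * real N powr (2 - \<alpha>) \<le> (norm_factor M X i m N)\<^sup>2"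
proof -
  define e where "e k = (c i i * t k) ^ m" for k
  have e1: "\<bar>e k\<bar> \<le> 1" if "1 \<le> k" for k
    using correlation_le_1[OF that, of i] by (simp add: e_def power_abs power_le_one)
  obtain k0 where k0: "\<And>k. k0 \<le> k \<Longrightarrow> real k powr (- \<alpha> / real m) \<le> t k"
    using t by (auto simp: eventually_sequentially)
  have tp: "real k powr (- \<alpha>) \<le> t k ^ m" if "max 1 k0 \<le> k" for k
  proof -
    have "real k powr (- \<alpha>) = (real k powr (- \<alpha> / real m)) ^ m"
      using that m by (simp add: powr_realpow[symmetric] powr_powr)
    also have "\<dots> \<le> t k ^ m" using k0[of k] that by (intro power_mono) auto
    finally show ?thesis .
  qed
  have nf: "(norm_factor M X i m N)\<^sup>2 = fact m * (real N + 2 * (\<Sum>k\<in>{1..<N}. real (N - k) * e k))" for N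
    unfolding e_def by (rule norm_factor_sq[OF m])
  consider "0 < c i i ^ m" | "c i i ^ m < 0" using ci by (metis linorder_neqE_linordered_idom power_not_zero)
  then show ?thesis
  proof cases
    case 1
    have "c i i ^ m * real k powr (- \<alpha>) \<le> e k" if "max 1 k0 \<le> k" for k
      unfolding e_def power_mult_distrib using tp[OF that] 1 by (intro mult_left_mono) auto
    from weighted_sum_lower[OF e1 1 \<alpha> this] obtain d where d: "0 < d"
      "\<forall>\<^sub>F N in sequentially. d * real N powr (2 - \<alpha>) \<le> (\<Sum>k\<in>{1..<N}. real (N - k) * e k)" by blast
    from d(2) have "\<forall>\<^sub>F N in sequentially. d * real N powr (2 - \<alpha>) \<le> (norm_factor M X i m N)\<^sup>2"
    proof eventually_elim
      case (elim N)
      have 0: "0 \<le> d * real N powr (2 - \<alpha>)" using d(1) by simp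
      have "d * real N powr (2 - \<alpha>) \<le> 1 * (real N + 2 * (\<Sum>k\<in>{1..<N}. real (N - k) * e k))"
        using elim 0 of_nat_0_le_iff[of N, where 'a=real] unfolding mult_1 by linarith
      also have "\<dots> \<le> fact m * (real N + 2 * (\<Sum>k\<in>{1..<N}. real (N - k) * e k))"
        using elim 0 by (intro mult_right_mono) auto
      finally show ?case unfolding nf .
    qed
    with d(1) show ?thesis by blast
  next
    case 2
    have "- (c i i ^ m) * real k powr (- \<alpha>) \<le> - e k" if "max 1 k0 \<le> k" for k
      using mult_left_mono[OF tp[OF that], of "- (c i i ^ m)"] 2 by (simp add: e_def power_mult_distrib)
    then have "\<exists>d>0. \<forall>\<^sub>F N in sequentially. d * real N powr (2 - \<alpha>) \<le> (\<Sum>k\<in>{1..<N}. real (N - k) * - e k)"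
      using e1 2 by (intro weighted_sum_lower[where a="- (c i i ^ m)" and ?k0.0="max 1 k0"] \<alpha>) auto
    then obtain d where d: "0 < d"
      "\<forall>\<^sub>F N in sequentially. d * real N powr (2 - \<alpha>) \<le> (\<Sum>k\<in>{1..<N}. real (N - k) * - e k)" by blast
    have "filterlim (\<lambda>N. real N powr (1 - \<alpha>)) at_top sequentially"
      using \<alpha> by (intro filterlim_compose[OF real_powr_at_top filterlim_real_sequentially]) simp
    then have "\<forall>\<^sub>F N in sequentially. 1 / d \<le> real N powr (1 - \<alpha>)" by (simp add: filterlim_at_top)
    \<comment> \<open>A nonnegative variance bounds the sum with - \<open>e k\<close> by N / 2,
      whereas the growth estimate makes it at least d N^(2 - \<alpha>), which is at least N for
      large \<open>N\<close>.\<close>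
    with d(2) eventually_gt_at_top[of 0] have "\<forall>\<^sub>F N::nat in sequentially. False"
    proof eventually_elim
      case (elim N)
      have "real N powr (2 - \<alpha>) = real N * real N powr (1 - \<alpha>)"
        using elim by (simp add: powr_diff field_simps power2_eq_square)
      then have "real N \<le> d * real N powr (2 - \<alpha>)"
        using mult_left_mono[OF elim(3), of "d * real N"] d(1) by (simp add: mult_ac)
      moreover have "(\<Sum>k\<in>{1..<N}. real (N - k) * - e k) = - (\<Sum>k\<in>{1..<N}. real (N - k) * e k)"
        by (simp add: sum_negf)
      moreover have "0 \<le> real N + 2 * (\<Sum>k\<in>{1..<N}. real (N - k) * e k)"
        using fact_gt_zero[of m, where 'a=real] zero_le_power2[of "norm_factor M X i m N"] unfolding nf by (smt (verit) mult_pos_neg fact_gt_zero)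
      ultimately show False using elim by linarith
    qed
    then show ?thesis by simp
  qed
qed

text \<open>Any lag with positive \<open>t\<close> can serve as reference; then \<rho>^2 = t k / t
  l' is at most 1 / 2 for large k, and the power m + 1 cancels the denominator of the exponent. For
  the finitely many other lags the trivial Cauchy--Schwarz bound is enough.\<close>

lemma residual_covariance_decay:
  assumes \<beta>: "0 < \<beta>" and t: "\<forall>\<^sub>F k in sequentially. 0 < t k \<and> t k \<le> real k powr (- \<beta> / real (Suc m))"
  shows "\<exists>C\<ge>0. \<forall>A\<in>sets borel. \<forall>k\<ge>1. \<bar>LINT x|pair_law k. residual m A (fst x) * residual m A (snd x)\<bar> \<le>
    C * real k powr (- \<beta>) * measure gauss A"
proof -
  define H where "H = real CARD('p) * 2 ^ CARD('p) + (real m + 1) ^ CARD('p)"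
  have H: "0 \<le> H" by (simp add: H_def)
  obtain l where l: "\<And>k. l \<le> k \<Longrightarrow> 0 < t k \<and> t k \<le> real k powr (- \<beta> / real (Suc m))"
    using t by (auto simp: eventually_sequentially)
  define l' where "l' = max 1 l"
  have l': "1 \<le> l'" "0 < t l'" using l[of l'] by (auto simp: l'_def)
  have "(\<lambda>k. real k powr (- \<beta> / real (Suc m))) \<longlonglongrightarrow> 0"
    using \<beta> by (intro tendsto_neg_powr filterlim_real_sequentially) (auto simp: field_simps)
  then have "\<forall>\<^sub>F k in sequentially. real k powr (- \<beta> / real (Suc m)) < t l' / 2"
    using l' by (intro order_tendstoD(2)) auto
  then obtain k1 where k1: "\<And>k. k1 \<le> k \<Longrightarrow> real k powr (- \<beta> / real (Suc m)) < t l' / 2"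
    by (auto simp: eventually_sequentially)
  define k2 where "k2 = max (max l k1) 1"
  \<comment> \<open>The first entry serves the lags from \<open>k2\<close> on, the second makes C
    k^(-\<beta>) at least 1 below \<open>k2\<close>.\<close>
  define C where "C = max (H / t l' ^ Suc m) (real k2 powr \<beta>)"
  have C: "0 \<le> C" by (simp add: C_def le_max_iff_disj)
  have "\<bar>LINT x|pair_law k. residual m A (fst x) * residual m A (snd x)\<bar> \<le> C * real k powr (- \<beta>) * measure gauss A"
    if A: "A \<in> sets borel" and k: "1 \<le> k" for A k
  proof -
    note res = residual_measurable[OF A] integrable_residual_sq[OF A, of m]
    have v: "(LINT x|gauss. (residual m A x)\<^sup>2) \<le> measure gauss A" by (rule integral_residual_sq[OF A])
    show ?thesis
    proof (cases "k2 \<le> k")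
      case True
      then have tk: "0 < t k" "t k \<le> real k powr (- \<beta> / real (Suc m))" "t k \<le> t l' / 2"
        using l[of k] k1[of k] by (auto simp: k2_def)
      define \<rho> where "\<rho> = sqrt (t k / t l')"
      have \<rho>2: "\<rho>\<^sup>2 = t k / t l'" using tk l' by (simp add: \<rho>_def)
      have "\<bar>LINT x|pair_law k. residual m A (fst x) * residual m A (snd x)\<bar> \<le> H * (\<rho>\<^sup>2) ^ Suc m * (LINT x|gauss. (residual m A x)\<^sup>2)"
        unfolding H_def
      proof (rule pair_law_covariance_bound[OF res _ k l'(1)])
        show "t k = \<rho>\<^sup>2 * t l'" "\<rho>\<^sup>2 \<le> 1 / 2" using tk l' by (auto simp: \<rho>2 field_simps)
      qed (use residual_orthogonal[OF A, of _ m] in \<open>simp add: multi_indices_def\<close>)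
      also have "\<dots> \<le> H * (\<rho>\<^sup>2) ^ Suc m * measure gauss A"
        using H v by (intro mult_left_mono) auto
      also have "H * (\<rho>\<^sup>2) ^ Suc m = H / t l' ^ Suc m * t k ^ Suc m" by (simp only: \<rho>2 power_divide) simp
      also have "H / t l' ^ Suc m * t k ^ Suc m * measure gauss A \<le> C * real k powr (- \<beta>) * measure gauss A"
      proof (intro mult_right_mono mult_mono)
        have "(real k powr a) ^ n = real k powr (real n * a)" for a n
          using k by (simp add: powr_power)
        then have "(real k powr (- \<beta> / real (Suc m))) ^ Suc m = real k powr (- \<beta>)"
          by (simp del: of_nat_Suc power_Suc)
        moreover have "t k ^ Suc m \<le> (real k powr (- \<beta> / real (Suc m))) ^ Suc m"
          using tk by (intro power_mono) auto
        ultimately show "t k ^ Suc m \<le> real k powr (- \<beta>)" by simp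
      qed (use C tk in \<open>auto simp: C_def\<close>)
      finally show ?thesis .
    next
      case False
      have "1 \<le> real k2 powr \<beta> * real k powr (- \<beta>)"
      proof -
        have "real k powr \<beta> \<le> real k2 powr \<beta>" using False \<beta> by (intro powr_mono2) auto
        then show ?thesis using k by (simp add: powr_minus field_simps)
      qed
      also have "\<dots> \<le> C * real k powr (- \<beta>)" by (intro mult_right_mono) (auto simp: C_def)
      finally have C1: "1 \<le> C * real k powr (- \<beta>)" .
      have "\<bar>LINT x|pair_law k. residual m A (fst x) * residual m A (snd x)\<bar> \<le> measure gauss A"
        using pair_law_Cauchy_Schwarz[OF res, of k] v by simp
      also have "\<dots> \<le> C * real k powr (- \<beta>) * measure gauss A"
        using mult_right_mono[OF C1, of "measure gauss A"] by simp
      finally show ?thesis .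
    qed
  qed
  then show ?thesis using C by blast
qed

text \<open>\<open>V\<close> controls the grid points in second moment and \<open>W\<close> the
  error of bracketing in first moment. Both depend on \<open>N\<close> but not on n and x, so the
  maximum and the supremum disappear before expectations are taken.\<close>

lemma maximal_residual_bound:
  fixes G :: "real ^ 'p \<Rightarrow> real ^ 'q::finite"
  assumes G: "G \<in> borel_measurable borel" and \<beta>: "0 < \<beta>" "\<beta> < 1" and \<eta>: "0 < \<eta>" and Cb: "0 \<le> Cb"
    and decay: "\<And>A k. A \<in> sets borel \<Longrightarrow> 1 \<le> k \<Longrightarrow>
      \<bar>LINT x|pair_law k. residual m A (fst x) * residual m A (snd x)\<bar> \<le> Cb * real k powr (- \<beta>) * measure gauss A"
  shows "\<exists>C>0. \<forall>N\<ge>1. \<exists>V W. integrable M V \<and> integrable M W \<and> (\<forall>w. 0 \<le> V w) \<and> (\<forall>w. 0 \<le> W w) \<and>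
    expectation V \<le> C * real N powr (2 - \<beta> + \<eta>) \<and> expectation W \<le> C \<and>
    (\<forall>w n x. n \<le> N \<longrightarrow> \<bar>\<Sum>j<n. residual m {s. evec (G s) \<le> x} (X (Suc j) w)\<bar> \<le> sqrt (V w) + W w)"
proof -
  let ?q = "CARD('q)"
  \<comment> \<open>The power K^(1 + q) occurs twice, from Cauchy--Schwarz over the scales and from
    the number of scales in the expected energy; this exponent turns the product into
    N^\<eta>.\<close>
  define \<eta>' where "\<eta>' = \<eta> / (2 * real (Suc ?q))"
  have "0 < \<eta>'" using \<eta> by (simp add: \<eta>'_def)
  from dyadic_size[OF this] obtain CK where CK: "0 < CK"
    "\<And>N. 1 \<le> N \<Longrightarrow> \<exists>K. 2 * N\<^sup>2 + 1 < 2 ^ K \<and> real K \<le> CK * real N powr \<eta>'" by blast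
  define C1 where "C1 = CK ^ (2 * Suc ?q) * (1 + 2 * Cb / (1 - \<beta>))"
  define C2 where "C2 = sqrt (2 * real ?q) * (\<Sum>l\<in>multi_indices m. LINT x|gauss. \<bar>hermite_multi l (x :: real ^ 'p)\<bar>)"
  define C where "C = max C1 C2"
  have C1: "0 < C1" using CK(1) \<beta> Cb by (auto simp: C1_def intro!: mult_pos_pos add_pos_nonneg)
  have C: "0 < C" "C1 \<le> C" "C2 \<le> C" using C1 by (auto simp: C_def)
  show ?thesis
  proof (intro exI[of _ C] conjI C(1) allI impI)
    fix N :: nat assume N: "1 \<le> N"
    \<comment> \<open>The gap of a bracket then has mass at most 2 q / N^2, whose square root
      cancels the \<open>N\<close> summands in \<open>W\<close>.\<close>
    define Q where "Q = (real N)\<^sup>2"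
    have Q: "0 < Q" using N by (simp add: Q_def)
    have fQ: "nat \<lfloor>Q\<rfloor> = N\<^sup>2" by (simp add: Q_def flip: of_nat_power)
    obtain K where K: "2 * N\<^sup>2 + 1 < 2 ^ K" "real K \<le> CK * real N powr \<eta>'" using CK(2)[OF N] by blast
    have NK: "N < 2 ^ K"
    proof -
      have "N * 1 \<le> N * N" using N by (intro mult_left_mono) auto
      then show ?thesis using K(1) unfolding power2_eq_square by linarith
    qed
    define R where "R i s = quantile_rank (distr gauss borel (\<lambda>s. G s $ i)) Q (G s $ i)" for i s
    note rank = quantile_rank_bracket_vec[OF G Q, folded R_def, unfolded fQ]
    define \<delta> where "\<delta> = real ?q * (2 / Q)"
    define V where "V w = real (K ^ Suc ?q) * dyadic_energy m R K N (\<lambda>j. X (Suc j) w)" for w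
    define W where "W w = sqrt \<delta> * (\<Sum>l\<in>multi_indices m. \<Sum>j<N. \<bar>hermite_multi l (X (Suc j) w)\<bar>)" for w
    have \<delta>: "0 \<le> \<delta>" using Q by (simp add: \<delta>_def)
    have sq\<delta>: "sqrt \<delta> * real N = sqrt (2 * real ?q)"
      using N by (simp add: \<delta>_def Q_def real_sqrt_divide real_sqrt_mult)
    define b where "b k = Cb * real k powr (- \<beta>)" for k
    have b: "\<And>k. 0 \<le> b k" using Cb by (simp add: b_def)
    note decay' = decay[folded b_def]
    have energy_int: "integrable M (\<lambda>w. dyadic_energy m R K N (\<lambda>j. X (Suc j) w))"
      by (rule integrable_dyadic_energy[OF rank(1) _ b], rule decay', assumption+)
    have energy_le: "expectation (\<lambda>w. dyadic_energy m R K N (\<lambda>j. X (Suc j) w)) \<le>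
        real (K ^ Suc ?q) * real N * (1 + 2 * (\<Sum>k\<in>{1..<N}. b k))"
      by (rule expectation_dyadic_energy[OF rank(1) _ b], rule decay', assumption+)
    have energy0: "0 \<le> dyadic_energy m R K N z" for z
      unfolding dyadic_energy_def by (intro sum_nonneg) auto
    have V0: "0 \<le> V w" for w unfolding V_def using energy0 by simp
    have W0: "0 \<le> W w" for w unfolding W_def using \<delta> by (intro mult_nonneg_nonneg sum_nonneg) auto
    have Vi: "integrable M V" unfolding V_def[abs_def] by (intro integrable_mult_right energy_int)
    have Hi: "integrable M (\<lambda>w. \<bar>hermite_multi l (X (Suc j) w)\<bar>)"
      "expectation (\<lambda>w. \<bar>hermite_multi l (X (Suc j) w)\<bar>) = (LINT x|gauss. \<bar>hermite_multi l x\<bar>)" for l j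
      using integrable_hermite_multi[of l] integrable_distr_eq[of "X (Suc j)" M borel "\<lambda>x. \<bar>hermite_multi l x\<bar>"]
        integral_distr[of "X (Suc j)" M borel "\<lambda>x. \<bar>hermite_multi l x\<bar>"] X_measurable[of "Suc j"] distr_X_gauss[of "Suc j"]
      by simp_all
    have Wi: "integrable M W"
      unfolding W_def[abs_def] by (intro integrable_mult_right Bochner_Integration.integrable_sum Hi)
    have EW: "expectation W \<le> C"
    proof -
      have "expectation W = sqrt \<delta> * (\<Sum>l\<in>multi_indices m. \<Sum>j<N. LINT x|gauss. \<bar>hermite_multi l (x :: real ^ 'p)\<bar>)"
        unfolding W_def[abs_def] using Hi by simp
      also have "\<dots> = (sqrt \<delta> * real N) * (\<Sum>l\<in>multi_indices m. LINT x|gauss. \<bar>hermite_multi l (x :: real ^ 'p)\<bar>)"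
        by (simp add: sum_distrib_left mult_ac)
      finally show ?thesis using C by (simp add: sq\<delta> C2_def)
    qed
    have EV: "expectation V \<le> C * real N powr (2 - \<beta> + \<eta>)"
    proof -
      have N1: "1 \<le> real N powr (1 - \<beta>)" using N \<beta> by (intro ge_one_powr_ge_zero) auto
      have "(\<Sum>k\<in>{1..<N}. b k) = Cb * (\<Sum>k\<in>{1..<N}. real k powr (- \<beta>))" by (simp add: b_def sum_distrib_left)
      also have "\<dots> \<le> Cb * (real N powr (1 - \<beta>) / (1 - \<beta>))" by (intro mult_left_mono sum_powr_le \<beta> Cb)
      finally have "(\<Sum>k\<in>{1..<N}. b k) \<le> Cb * (real N powr (1 - \<beta>) / (1 - \<beta>))" .
      then have bs: "1 + 2 * (\<Sum>k\<in>{1..<N}. b k) \<le> (1 + 2 * Cb / (1 - \<beta>)) * real N powr (1 - \<beta>)"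
      proof -
        have "(1 + 2 * Cb / (1 - \<beta>)) * real N powr (1 - \<beta>) = real N powr (1 - \<beta>) + 2 * (Cb * (real N powr (1 - \<beta>) / (1 - \<beta>)))"
          by (simp add: distrib_right)
        with N1 \<open>(\<Sum>k\<in>{1..<N}. b k) \<le> Cb * (real N powr (1 - \<beta>) / (1 - \<beta>))\<close> show ?thesis by linarith
      qed
      have Kq: "real (K ^ Suc ?q) * real (K ^ Suc ?q) \<le> CK ^ (2 * Suc ?q) * real N powr \<eta>"
      proof -
        have "real (K ^ Suc ?q) * real (K ^ Suc ?q) = real K ^ (2 * Suc ?q)"
          by (simp only: of_nat_power mult_2 power_add)
        also have "\<dots> \<le> (CK * real N powr \<eta>') ^ (2 * Suc ?q)" using K(2) by (intro power_mono) auto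
        also have "\<dots> = CK ^ (2 * Suc ?q) * (real N powr \<eta>') ^ (2 * Suc ?q)" by (rule power_mult_distrib)
        also have "(real N powr \<eta>') ^ (2 * Suc ?q) = real N powr (\<eta>' * real (2 * Suc ?q))"
          using N by (subst powr_realpow[symmetric]) (auto simp only: powr_powr powr_gt_zero of_nat_0_less_iff)
        also have "\<eta>' * real (2 * Suc ?q) = \<eta>" by (simp add: \<eta>'_def)
        finally show ?thesis .
      qed
      have "expectation V = real (K ^ Suc ?q) * expectation (\<lambda>w. dyadic_energy m R K N (\<lambda>j. X (Suc j) w))"
        by (simp add: V_def[abs_def])
      also have "\<dots> \<le> real (K ^ Suc ?q) * (real (K ^ Suc ?q) * real N * (1 + 2 * (\<Sum>k\<in>{1..<N}. b k)))"
        by (intro mult_left_mono energy_le) auto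
      also have "\<dots> = (real (K ^ Suc ?q) * real (K ^ Suc ?q)) * (real N * (1 + 2 * (\<Sum>k\<in>{1..<N}. b k)))" by (simp only: mult_ac)
      also have "\<dots> \<le> (CK ^ (2 * Suc ?q) * real N powr \<eta>) * (real N * ((1 + 2 * Cb / (1 - \<beta>)) * real N powr (1 - \<beta>)))"
        using b CK(1) by (intro mult_mono[OF Kq] mult_left_mono bs mult_nonneg_nonneg add_nonneg_nonneg sum_nonneg) auto
      also have "\<dots> = C1 * (real N powr \<eta> * (real N powr 1 * real N powr (1 - \<beta>)))"
        using N by (simp add: C1_def mult_ac)
      also have "\<dots> = C1 * real N powr (2 - \<beta> + \<eta>)"
        by (simp only: powr_add[symmetric]) (simp add: algebra_simps)
      also have "\<dots> \<le> C * real N powr (2 - \<beta> + \<eta>)" using C by (intro mult_right_mono) auto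
      finally show ?thesis .
    qed
    have bound: "\<bar>\<Sum>j<n. residual m {s. evec (G s) \<le> x} (X (Suc j) w)\<bar> \<le> sqrt (V w) + W w" if n: "n \<le> N" for w n x
    proof -
      obtain n0 n1 where b0: "\<And>i. n0 i \<le> Suc (2 * N\<^sup>2)" and b1: "\<And>i. n1 i \<le> Suc (2 * N\<^sup>2)"
        and br: "{s. \<forall>i. R i s < n0 i} \<subseteq> {s. evec (G s) \<le> x}" "{s. evec (G s) \<le> x} \<subseteq> {s. \<forall>i. R i s < n1 i}"
        and me: "measure gauss ({s. \<forall>i. R i s < n1 i} - {s. \<forall>i. R i s < n0 i}) \<le> \<delta>"
        using rank(2)[of x] unfolding \<delta>_def by blast
      have grid: "{s. \<forall>i. R i s < v i} \<in> sets borel"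
        "\<bar>\<Sum>j<n. residual m {s. \<forall>i. R i s < v i} (X (Suc j) w)\<bar> \<le> sqrt (V w)"
        if v: "\<And>i. v i \<le> Suc (2 * N\<^sup>2)" for v
      proof -
        have vK: "v i < 2 ^ K" for i using v[of i] K(1) by simp
        note [measurable] = rank(1)
        show "{s. \<forall>i. R i s < v i} \<in> sets borel" by measurable
        show "\<bar>\<Sum>j<n. residual m {s. \<forall>i. R i s < v i} (X (Suc j) w)\<bar> \<le> sqrt (V w)"
          using residual_sum_le_dyadic_energy[where m=m and z="\<lambda>j. X (Suc j) w", OF rank(1) n NK vK]
          unfolding V_def by (intro real_le_rsqrt) simp
      qed
      show ?thesis
        unfolding W_def
        by (rule residual_bracket[OF grid(1)[OF b0] lower_set_measurable[OF G] grid(1)[OF b1] br me n grid(2)[OF b0] grid(2)[OF b1]])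
    qed
    show "\<exists>V W. integrable M V \<and> integrable M W \<and> (\<forall>w. 0 \<le> V w) \<and> (\<forall>w. 0 \<le> W w) \<and>
      expectation V \<le> C * real N powr (2 - \<beta> + \<eta>) \<and> expectation W \<le> C \<and>
      (\<forall>w n x. n \<le> N \<longrightarrow> \<bar>\<Sum>j<n. residual m {s. evec (G s) \<le> x} (X (Suc j) w)\<bar> \<le> sqrt (V w) + W w)"
      by (intro exI[of _ V] exI[of _ W] conjI allI impI Vi Wi V0 W0 EV EW bound)
  qed
qed

end

subsection \<open>The reduction principle\<close>

lemma evec_le_iff: "evec y \<le> x \<longleftrightarrow> (\<forall>i. ereal (y $ i) \<le> x $ i)"
  by (simp add: less_eq_vec_def evec_def)

lemma evec_nth: "evec y $ i = ereal (y $ i)"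
  by (simp add: evec_def)

lemma ind_le_indicator: "ind_le G x = indicator {s. evec (G s) \<le> x}"
  by (auto simp: ind_le_def fun_eq_iff)

section \<open>The Hermite rank and the summands of the reduction principle\<close>

context stationary_gaussian begin

lemma expectation_X1:
  fixes g :: "real ^ 'p \<Rightarrow> real"
  assumes "g \<in> borel_measurable borel"
  shows "expectation (\<lambda>w. g (X 1 w)) = (LINT x|gauss. g x)"
  using integral_distr[OF X_measurable[of 1] assms] by (simp add: distr_X_gauss)

lemma J_coeff_eq_coef:
  fixes G :: "real ^ 'p \<Rightarrow> real ^ 'q::finite"
  assumes G: "G \<in> borel_measurable borel"
  shows "J_coeff M (X 1) G l x = coef l {s. evec (G s) \<le> x}"
proof -
  note [measurable] = lower_set_measurable[OF G, of x]
  show ?thesis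
    unfolding J_coeff_def coef_def ind_le_indicator by (rule expectation_X1) measurable
qed

lemma dist_fun_eq_coef:
  fixes G :: "real ^ 'p \<Rightarrow> real ^ 'q::finite"
  assumes G: "G \<in> borel_measurable borel"
  shows "dist_fun M (X 1) G x = coef (\<lambda>_. 0) {s. evec (G s) \<le> x}"
proof -
  have "dist_fun M (X 1) G x = measure (distr M borel (X 1)) {s. evec (G s) \<le> x}"
    unfolding dist_fun_def
    by (subst measure_distr) (auto simp: X_measurable lower_set_measurable[OF G] vimage_def Int_def conj_commute)
  then show ?thesis by (simp add: distr_X_gauss coef_def)
qed

text \<open>Hermite polynomials of positive degree have mean 0, so subtracting a constant affects
  degree 0 only.\<close>

lemma centred_coefficient:
  fixes G :: "real ^ 'p \<Rightarrow> real ^ 'q::finite"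
  assumes G: "G \<in> borel_measurable borel"
  shows "expectation (\<lambda>w. (ind_le G x (X 1 w) - dist_fun M (X 1) G x) * hermite_multi l (X 1 w)) =
    (if l = (\<lambda>_. 0) then 0 else coef l {s. evec (G s) \<le> x})"
proof -
  note [measurable] = lower_set_measurable[OF G, of x]
  let ?E = "{s. evec (G s) \<le> x}"
  have "expectation (\<lambda>w. (ind_le G x (X 1 w) - dist_fun M (X 1) G x) * hermite_multi l (X 1 w)) =
      (LINT s|gauss. (indicator ?E s - dist_fun M (X 1) G x) * hermite_multi l s)"
    unfolding ind_le_indicator by (rule expectation_X1) measurable
  also have "\<dots> = coef l ?E - dist_fun M (X 1) G x * (LINT s|gauss. hermite_multi l s)"
    unfolding left_diff_distrib coef_def
    by (simp add: integrable_indicator_hermite[OF lower_set_measurable[OF G]] integrable_hermite_multi)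
  also have "(LINT s|gauss. hermite_multi l (s :: real ^ 'p)) = (if l = (\<lambda>_. 0) then 1 else 0)"
    using integral_hermite_multi_mult[of l "\<lambda>_. 0"] by (auto cong: if_cong)
  finally show ?thesis unfolding dist_fun_eq_coef[OF G] by auto
qed

text \<open>Centring gives rank at least 1. The rank is an infimum over real thresholds while
  \<open>x\<close> is extended real, so the vanishing of coefficients is carried over by dominated
  convergence along real thresholds.\<close>

lemma
  fixes G :: "real ^ 'p \<Rightarrow> real ^ 'q::finite"
  assumes G: "G \<in> borel_measurable borel" and rank: "hermite_rank_family M (X 1) G = enat m"
  shows hermite_rank_family_ge_1: "1 \<le> m"
    and coef_below_rank: "(\<Sum>i\<in>UNIV. l i) < m \<Longrightarrow> l \<noteq> (\<lambda>_. 0) \<Longrightarrow> coef l {s. evec (G s) \<le> x} = 0"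
proof -
  define S where "S x = {enat k |k. \<forall>l. (\<Sum>i\<in>UNIV. l i) < k \<longrightarrow>
    expectation (\<lambda>w. (ind_le G (evec x) (X 1 w) - dist_fun M (X 1) G (evec x)) * hermite_multi l (X 1 w)) = 0}"
    for x :: "real ^ 'q"
  have rank': "(INF x. Sup (S x)) = enat m"
    using rank unfolding hermite_rank_family_def hermite_rank_def S_def .
  have "enat 1 \<in> S x" for x
    unfolding S_def centred_coefficient[OF G] by (auto simp: fun_eq_iff)
  then have "enat 1 \<le> Sup (S x)" for x by (rule Sup_upper)
  then have "enat 1 \<le> (INF x. Sup (S x))" by (intro INF_greatest)
  then show "1 \<le> m" unfolding rank' by simp
  show "coef l {s. evec (G s) \<le> x} = 0" if l: "(\<Sum>i\<in>UNIV. l i) < m" "l \<noteq> (\<lambda>_. 0)"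
  proof -
    have real: "coef l {s. evec (G s) \<le> evec y} = 0" for y
    proof -
      \<comment> \<open>A strict inequality below the supremum yields a member of \<open>S y\<close>
        above the degree of \<open>l\<close>, also when the supremum is \<infinity>.\<close>
      have "enat (\<Sum>i\<in>UNIV. l i) < Sup (S y)"
      proof (rule less_le_trans)
        show "enat (\<Sum>i\<in>UNIV. l i) < enat m" using l(1) by simp
        show "enat m \<le> Sup (S y)" unfolding rank'[symmetric] by (rule INF_lower) simp
      qed
      then obtain k where "(\<Sum>i\<in>UNIV. l i) < k" "enat k \<in> S y"
        unfolding less_Sup_iff by (auto simp: S_def)
      then show ?thesis using l(2) unfolding S_def centred_coefficient[OF G] by auto
    qed
    show ?thesis
    proof (cases "\<exists>i. x $ i = - \<infinity>")
      case True
      then obtain i where i: "x $ i = - \<infinity>" by blast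
      then have "{s. evec (G s) \<le> x} = {}" by (auto simp: evec_le_iff intro!: exI[of _ i])
      then show ?thesis by (simp add: coef_def)
    next
      case False
      \<comment> \<open>Infinite coordinates are replaced by n. For each fixed s the condition
        agrees with the one for \<open>x\<close> as soon as n exceeds the relevant coordinates of
        \<open>G s\<close>.\<close>
      define y where "y n = (\<chi> i. if x $ i = \<infinity> then real n else real_of_ereal (x $ i))" for n :: nat
      have ev: "\<forall>\<^sub>F n in sequentially. (evec (G s) \<le> evec (y n)) = (evec (G s) \<le> x)" for s
      proof -
        have "\<forall>\<^sub>F n in sequentially. (ereal (G s $ i) \<le> ereal (y n $ i)) = (ereal (G s $ i) \<le> x $ i)" for i
        proof (cases "x $ i")
          case PInf
          have "\<forall>\<^sub>F n in sequentially. G s $ i \<le> real n"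
            using filterlim_real_sequentially by (simp add: filterlim_at_top)
          then show ?thesis by eventually_elim (simp add: y_def PInf)
        qed (use False in \<open>auto simp: y_def\<close>)
        then have "\<forall>\<^sub>F n in sequentially. \<forall>i. (ereal (G s $ i) \<le> ereal (y n $ i)) = (ereal (G s $ i) \<le> x $ i)"
          by (intro eventually_all_finite)
        then show ?thesis by eventually_elim (simp add: evec_le_iff evec_nth)
      qed
      note meas = lower_set_measurable[OF G]
      have "(\<lambda>n. LINT s|gauss. indicator {s. evec (G s) \<le> evec (y n)} s * hermite_multi l s)
          \<longlonglongrightarrow> (LINT s|gauss. indicator {s. evec (G s) \<le> x} s * hermite_multi l s)"
      proof (rule integral_dominated_convergence[where w="\<lambda>s. \<bar>hermite_multi l s\<bar>"])
        show "AE s in gauss. (\<lambda>n. indicator {s. evec (G s) \<le> evec (y n)} s * hermite_multi l s)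
            \<longlonglongrightarrow> indicator {s. evec (G s) \<le> x} s * hermite_multi l s"
        proof (rule AE_I2, rule tendsto_eventually)
          fix s
          show "\<forall>\<^sub>F n in sequentially. indicator {s. evec (G s) \<le> evec (y n)} s * hermite_multi l s =
              indicator {s. evec (G s) \<le> x} s * hermite_multi l s"
            using ev[of s] by eventually_elim (simp add: indicator_def)
        qed
        show "(\<lambda>s. indicator {s. evec (G s) \<le> x} s * hermite_multi l s) \<in> borel_measurable gauss"
          by (rule borel_measurable_integrable[OF integrable_indicator_hermite[OF meas]])
        show "(\<lambda>s. indicator {s. evec (G s) \<le> evec (y n)} s * hermite_multi l s) \<in> borel_measurable gauss" for n
          by (rule borel_measurable_integrable[OF integrable_indicator_hermite[OF meas]])
      qed (auto simp: integrable_hermite_multi indicator_def)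
      then show ?thesis using real by (simp add: coef_def LIMSEQ_const_iff)
    qed
  qed
qed

lemma summand_eq_residual:
  fixes G :: "real ^ 'p \<Rightarrow> real ^ 'q::finite"
  assumes G: "G \<in> borel_measurable borel" and rank: "hermite_rank_family M (X 1) G = enat m"
  shows "ind_le G x s - dist_fun M (X 1) G x -
      (\<Sum>l | (\<Sum>i\<in>UNIV. l i) = m. J_coeff M (X 1) G l x / (\<Prod>i\<in>UNIV. fact (l i)) * hermite_multi l s) =
    residual m {s. evec (G s) \<le> x} s"
proof -
  let ?E = "{s. evec (G s) \<le> x}"
  let ?T = "\<lambda>l. coef l ?E / mfact l * hermite_multi l s"
  have m: "1 \<le> m" by (rule hermite_rank_family_ge_1[OF G rank])
  have "multi_indices m = {l. (\<Sum>i\<in>UNIV. l i) < m} \<union> {l :: 'p \<Rightarrow> nat. (\<Sum>i\<in>UNIV. l i) = m}"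
    by (auto simp: multi_indices_def)
  moreover have fin: "finite {l :: 'p \<Rightarrow> nat. (\<Sum>i\<in>UNIV. l i) < m}" "finite {l :: 'p \<Rightarrow> nat. (\<Sum>i\<in>UNIV. l i) = m}"
    by (rule finite_subset[OF _ finite_multi_indices[of m]], force simp: multi_indices_def)+
  ultimately have "(\<Sum>l\<in>multi_indices m. ?T l) =
      (\<Sum>l | (\<Sum>i\<in>UNIV. l i) < m. ?T l) + (\<Sum>l | (\<Sum>i\<in>UNIV. l i) = m. ?T l)"
    by (simp only:) (rule sum.union_disjoint, auto)
  also have "(\<Sum>l | (\<Sum>i\<in>UNIV. l i) < m. ?T l) = (\<Sum>l\<in>{\<lambda>_. 0}. ?T l)"
    using m fin(1) by (intro sum.mono_neutral_right) (auto simp: coef_below_rank[OF G rank])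
  also have "\<dots> = dist_fun M (X 1) G x" by (simp only: dist_fun_eq_coef[OF G]) (simp add: mfact_def)
  finally show ?thesis
    unfolding residual_def ind_le_indicator J_coeff_eq_coef[OF G] mfact_def by simp
qed

end

theorem theorem4:
  fixes M :: "'a measure"
    and X :: "nat \<Rightarrow> 'a \<Rightarrow> real ^ 'p::finite"
    and G :: "real ^ 'p \<Rightarrow> real ^ 'q::finite"
    and c :: "'p \<Rightarrow> 'p \<Rightarrow> real"
    and L :: "real \<Rightarrow> real"
    and D :: real
    and m :: nat
    and i1 :: 'p
  assumes "prob_space M"
    and "gaussian_process M X"
    and "stationary_process M X"
    and "\<And>i. prob_space.expectation M (\<lambda>\<omega>. X 1 \<omega> $ i) = 0"
    and "\<And>i j. prob_space.expectation M (\<lambda>\<omega>. X 1 \<omega> $ i * X 1 \<omega> $ j) = (if i = j then 1 else 0)"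
    and "\<And>i j k. 1 \<le> k \<Longrightarrow>
           prob_space.expectation M (\<lambda>\<omega>. X 1 \<omega> $ i * X (k + 1) \<omega> $ j)
             = c i j * L (real k) * real k powr (- D)"
    and "c i1 i1 \<noteq> 0"
    and "slowly_varying L"
    and "0 < D" and "D < 1"
    and "G \<in> borel_measurable borel"
    and "hermite_rank_family M (X 1) G = enat m"
    and "D < 1 / real m"
  shows "\<exists>C \<kappa>. 0 < C \<and> 0 < \<kappa> \<and> (\<forall>\<epsilon> N. 0 < \<epsilon> \<and> \<epsilon> \<le> 1 \<and> 1 \<le> N \<longrightarrow>
     measure M {\<omega> \<in> space M.
        ereal \<epsilon> < (MAX n\<in>{1..N}. SUP x::ereal ^ 'q. ereal (inverse (norm_factor M X i1 m N) *
           \<bar>\<Sum>j=1..n. (ind_le G x (X j \<omega>) - dist_fun M (X 1) G x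
              - (\<Sum>l | (\<Sum>i\<in>UNIV. l i) = m.
                   J_coeff M (X 1) G l x / (\<Prod>i\<in>UNIV. fact (l i))
                     * hermite_multi l (X j \<omega>)))\<bar>))}
     \<le> C * real N powr (- \<kappa>) * (1 + 1 / \<epsilon> ^ 3))"
proof -
  define t where "t k = L (real k) * real k powr (- D)" for k
  interpret stationary_gaussian M X c t
  proof -
    interpret prob_space M by fact
    show "stationary_gaussian M X c t"
      by unfold_locales (use assms in \<open>auto simp: t_def\<close>)
  qed
  have G: "G \<in> borel_measurable borel" and rank: "hermite_rank_family M (X 1) G = enat m" by fact+
  have m: "1 \<le> m" by (rule hermite_rank_family_ge_1[OF G rank])
  \<comment> \<open>Below 1 the sum of k^(-\<beta>) up to N is of order N^(1 - \<beta>); below (m +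
    1) D the covariance bound, of order t k^(m + 1), is dominated by k^(-\<beta>).\<close>
  define B where "B = min 1 (real (Suc m) * D)"
  have mD: "0 < real m * D" "real m * D < B"
    using m \<open>0 < D\<close> \<open>D < 1 / real m\<close> by (auto simp: B_def field_simps)
  \<comment> \<open>The interval from m D to \<open>B\<close> is cut into thirds, and \<kappa> is
    half of \<beta> - \<alpha>: one half pays for the powers of log N, the other remains as
    decay.\<close>
  define \<alpha> where "\<alpha> = (2 * (real m * D) + B) / 3"
  define \<beta> where "\<beta> = (real m * D + 2 * B) / 3"
  define \<kappa> where "\<kappa> = (\<beta> - \<alpha>) / 2"
  have ab: "real m * D < \<alpha>" "\<alpha> < \<beta>" "\<beta> < B" 
    by (simp_all add: \<alpha>_def \<beta>_def) (use mD in \<open>simp_all add: mult.commute\<close>)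
  have \<alpha>: "0 < \<alpha>" "\<alpha> < 1" and \<beta>: "0 < \<beta>" "\<beta> < 1" and \<kappa>: "0 < \<kappa>"
    using ab mD by (auto simp: B_def \<kappa>_def)
  have \<beta>D: "\<beta> < real (Suc m) * D" using ab by (simp add: B_def)
  have t_lower: "\<forall>\<^sub>F k in sequentially. real k powr (- \<alpha> / real m) \<le> t k"
  proof -
    \<comment> \<open>This slack in the exponent absorbs the slowly varying factor.\<close>
    have "0 < \<alpha> / real m - D" using ab m by (simp add: field_simps)
    from slowly_varying_bounds[OF \<open>slowly_varying L\<close> this]
    have "\<forall>\<^sub>F k in sequentially. real k powr (- (\<alpha> / real m - D)) \<le> L (real k)"
      by (rule eventually_mono[OF eventually_compose_filterlim[OF _ filterlim_real_sequentially]]) auto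
    then show ?thesis
    proof eventually_elim
      case (elim k)
      have "real k powr (- \<alpha> / real m) = real k powr (- (\<alpha> / real m - D)) * real k powr (- D)"
        by (simp add: powr_add[symmetric])
      also have "\<dots> \<le> t k" unfolding t_def using elim by (intro mult_right_mono) auto
      finally show ?case .
    qed
  qed
  have t_upper: "\<forall>\<^sub>F k in sequentially. 0 < t k \<and> t k \<le> real k powr (- \<beta> / real (Suc m))"
  proof -
    have "0 < D - \<beta> / real (Suc m)" using \<beta>D by (simp add: field_simps)
    from slowly_varying_bounds[OF \<open>slowly_varying L\<close> this]
    have "\<forall>\<^sub>F k in sequentially. L (real k) \<le> real k powr (D - \<beta> / real (Suc m))"
      by (rule eventually_mono[OF eventually_compose_filterlim[OF _ filterlim_real_sequentially]]) auto
    with t_lower eventually_gt_at_top[of 0] show ?thesis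
    proof eventually_elim
      case (elim k)
      have "t k \<le> real k powr (D - \<beta> / real (Suc m)) * real k powr (- D)"
        unfolding t_def using elim by (intro mult_right_mono) auto
      also have "\<dots> = real k powr (- \<beta> / real (Suc m))"
        by (simp add: powr_add[symmetric])
      finally have "t k \<le> real k powr (- \<beta> / real (Suc m))" .
      moreover have "0 < real k powr (- \<alpha> / real m)" using elim by simp
      ultimately show ?case using elim by linarith
    qed
  qed
  obtain d where d: "0 < d" "\<forall>\<^sub>F N in sequentially. d * real N powr (2 - \<alpha>) \<le> (norm_factor M X i1 m N)\<^sup>2"
    using norm_factor_growth[OF m \<open>c i1 i1 \<noteq> 0\<close> \<alpha> t_lower] by blast
  then obtain N0 where N0: "\<And>N. N0 \<le> N \<Longrightarrow> d * real N powr (2 - \<alpha>) \<le> (norm_factor M X i1 m N)\<^sup>2"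
    by (auto simp: eventually_sequentially)
  obtain Cb where Cb: "0 \<le> Cb" "\<And>A k. A \<in> sets borel \<Longrightarrow> 1 \<le> k \<Longrightarrow>
      \<bar>LINT x|pair_law k. residual m A (fst x) * residual m A (snd x)\<bar> \<le> Cb * real k powr (- \<beta>) * measure gauss A"
    using residual_covariance_decay[OF \<beta>(1) t_upper] by blast
  obtain C where C: "0 < C" and VW: "\<forall>N\<ge>1. \<exists>V W. integrable M V \<and> integrable M W \<and> (\<forall>w. 0 \<le> V w) \<and> (\<forall>w. 0 \<le> W w) \<and>
    expectation V \<le> C * real N powr (2 - \<beta> + \<kappa>) \<and> expectation W \<le> C \<and>
    (\<forall>w n x. n \<le> N \<longrightarrow> \<bar>\<Sum>j<n. residual m {s. evec (G s) \<le> x} (X (Suc j) w)\<bar> \<le> sqrt (V w) + W w)"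
    using maximal_residual_bound[OF G \<beta> \<kappa> Cb] by blast
  \<comment> \<open>The second entry makes the asserted bound at least 1 for the finitely many
    \<open>N\<close> below \<open>N0\<close>, where the norming factor is not controlled.\<close>
  define C' where "C' = max (4 * C / d + 2 * C / sqrt d) (real (Suc N0) powr \<kappa>)"
  have C': "0 < C'" by (simp add: C'_def less_max_iff_disj)
  let ?S = "\<lambda>n x w. \<Sum>j=1..n. (ind_le G x (X j w) - dist_fun M (X 1) G x
              - (\<Sum>l | (\<Sum>i\<in>UNIV. l i) = m. J_coeff M (X 1) G l x / (\<Prod>i\<in>UNIV. fact (l i)) * hermite_multi l (X j w)))"
  let ?event = "\<lambda>\<epsilon> N. {w \<in> space M. ereal \<epsilon> < (MAX n\<in>{1..N}. SUP x::ereal ^ 'q. ereal (inverse (norm_factor M X i1 m N) * \<bar>?S n x w\<bar>))}"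
  have main: "measure M (?event \<epsilon> N) \<le> C' * real N powr (- \<kappa>) * (1 + 1 / \<epsilon> ^ 3)"
    if \<epsilon>: "0 < \<epsilon>" "\<epsilon> \<le> 1" and N: "1 \<le> N" for \<epsilon> N
  proof (cases "N0 \<le> N")
    case False
    have "real N powr \<kappa> \<le> real (Suc N0) powr \<kappa>" using False \<kappa> by (intro powr_mono2) auto
    also have "\<dots> \<le> C'" by (simp add: C'_def)
    finally have "real N powr \<kappa> * real N powr (- \<kappa>) \<le> C' * real N powr (- \<kappa>)" by (intro mult_right_mono) auto
    then have "1 \<le> C' * real N powr (- \<kappa>)" using N by (simp add: powr_add[symmetric])
    moreover have "C' * real N powr (- \<kappa>) * 1 \<le> C' * real N powr (- \<kappa>) * (1 + 1 / \<epsilon> ^ 3)"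
      using C' \<epsilon> by (intro mult_left_mono) auto
    moreover have "measure M (?event \<epsilon> N) \<le> 1" by (rule prob_le_1)
    ultimately show ?thesis by linarith
  next
    case True
    define dN where "dN = norm_factor M X i1 m N"
    have "0 < d * real N powr (2 - \<alpha>)" using d N by simp
    then have dN2: "0 < dN\<^sup>2" "d * real N powr (2 - \<alpha>) \<le> dN\<^sup>2" using N0[OF True] by (auto simp: dN_def)
    have "0 \<le> dN" by (simp add: dN_def norm_factor_def)
    with dN2(1) have dN: "0 < dN" by (simp add: less_le)
    obtain V W where V: "integrable M V" "\<And>w. 0 \<le> V w" "expectation V \<le> C * real N powr (2 - \<beta> + \<kappa>)"
      and W: "integrable M W" "\<And>w. 0 \<le> W w" "expectation W \<le> C"
      and bound: "\<And>w n x. n \<le> N \<Longrightarrow> \<bar>\<Sum>j<n. residual m {s. evec (G s) \<le> x} (X (Suc j) w)\<bar> \<le> sqrt (V w) + W w"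
      using VW N by metis
    have S: "?S n x w = (\<Sum>j<n. residual m {s. evec (G s) \<le> x} (X (Suc j) w))" for n x w
      unfolding summand_eq_residual[OF G rank] by (simp add: sum.atLeast1_atMost_eq)
    \<comment> \<open>Half of the threshold for each of \<open>sqrt (V w)\<close> and
      \<open>W w\<close>.\<close>
    let ?u = "\<epsilon> * dN / 2"
    have u: "0 < ?u" using \<epsilon> dN by simp
    have "?event \<epsilon> N \<subseteq> {w\<in>space M. ?u\<^sup>2 \<le> V w} \<union> {w\<in>space M. ?u \<le> W w}"
    proof
      fix w assume w: "w \<in> ?event \<epsilon> N"
      then obtain n x where n: "n \<in> {1..N}" and "ereal \<epsilon> < ereal (inverse dN * \<bar>?S n x w\<bar>)"
        using N by (auto simp: less_SUP_iff Max_gr_iff dN_def)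
      then have "\<epsilon> * dN < \<bar>?S n x w\<bar>" using dN by (simp add: field_simps)
      also have "\<dots> \<le> sqrt (V w) + W w" unfolding S using n by (intro bound) auto
      finally have "?u \<le> sqrt (V w) \<or> ?u \<le> W w" by (auto simp: field_simps)
      moreover have "?u\<^sup>2 \<le> V w" if "?u \<le> sqrt (V w)"
        using power_mono[OF that, of 2] u V(2)[of w] by simp
      ultimately show "w \<in> {w\<in>space M. ?u\<^sup>2 \<le> V w} \<union> {w\<in>space M. ?u \<le> W w}" using w by auto
    qed
    moreover have [measurable]: "V \<in> borel_measurable M" "W \<in> borel_measurable M" using V W by auto
    \<comment> \<open>Monotonicity asks only the larger set to be measurable, so the supremum over
      uncountably many x raises no measurability question.\<close>
    ultimately have "measure M (?event \<epsilon> N) \<le> measure M ({w\<in>space M. ?u\<^sup>2 \<le> V w} \<union> {w\<in>space M. ?u \<le> W w})"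
      by (intro finite_measure_mono) auto
    also have "\<dots> \<le> measure M {w\<in>space M. ?u\<^sup>2 \<le> V w} + measure M {w\<in>space M. ?u \<le> W w}"
      by (rule measure_Un_le) measurable
    also have "\<dots> \<le> expectation V / ?u\<^sup>2 + expectation W / ?u"
      using u V W by (intro add_mono integral_Markov_inequality_measure[where A="{}"]) auto
    also have "\<dots> \<le> (4 * C / d) * (real N powr (- \<kappa>) / \<epsilon> ^ 3) + (2 * C / sqrt d) * (real N powr (- \<kappa>) / \<epsilon> ^ 3)"
    proof (rule add_mono)
      \<comment> \<open>Markov's inequality costs \<epsilon>^(-2) for \<open>V\<close> and
        \<epsilon>^(-1) for \<open>W\<close>; both are at most \<epsilon>^(-3).\<close>
      have \<epsilon>3: "\<epsilon> ^ 3 \<le> \<epsilon>\<^sup>2" "\<epsilon> ^ 3 \<le> \<epsilon>" using \<epsilon> power_decreasing[of 2 3 \<epsilon>] power_decreasing[of 1 3 \<epsilon>] by auto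
      have "expectation V / ?u\<^sup>2 = 4 * expectation V / (\<epsilon>\<^sup>2 * dN\<^sup>2)" by (simp add: power_mult_distrib power_divide)
      also have "\<dots> \<le> 4 * (C * real N powr (2 - \<beta> + \<kappa>)) / (\<epsilon> ^ 3 * (d * real N powr (2 - \<alpha>)))"
        using V \<epsilon> \<epsilon>3 dN2 d N C by (intro frac_le mult_mono mult_nonneg_nonneg) auto
      also have "\<dots> = (4 * C / d) * ((real N powr (2 - \<beta> + \<kappa>) / real N powr (2 - \<alpha>)) / \<epsilon> ^ 3)" by (simp add: mult_ac)
      also have "real N powr (2 - \<beta> + \<kappa>) / real N powr (2 - \<alpha>) = real N powr (- \<kappa>)"
        unfolding powr_diff[symmetric]
        by (rule arg_cong[where f="\<lambda>e. real N powr e"]) (simp add: \<kappa>_def field_simps)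
      finally show "expectation V / ?u\<^sup>2 \<le> (4 * C / d) * (real N powr (- \<kappa>) / \<epsilon> ^ 3)" .
      have "sqrt (d * real N powr (2 - \<alpha>)) \<le> sqrt (dN\<^sup>2)" using dN2 by (intro real_sqrt_le_mono)
      also have "sqrt (d * real N powr (2 - \<alpha>)) = sqrt d * real N powr ((2 - \<alpha>) / 2)"
        by (simp add: real_sqrt_mult powr_half_sqrt[symmetric] powr_powr)
      also have "sqrt (dN\<^sup>2) = dN" using dN by simp
      finally have "sqrt d * real N powr ((2 - \<alpha>) / 2) \<le> dN" .
      \<comment> \<open>Since \<kappa> = (\<beta> - \<alpha>) / 2 is below (2 - \<alpha>) / 2, the
        bounded mean of \<open>W\<close> is divided by at least a multiple of N^\<kappa>.\<close>
      moreover have "real N powr \<kappa> \<le> real N powr ((2 - \<alpha>) / 2)"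
        using N \<alpha> \<beta> by (intro powr_mono) (auto simp: \<kappa>_def)
      then have "sqrt d * real N powr \<kappa> \<le> sqrt d * real N powr ((2 - \<alpha>) / 2)" using d by simp
      ultimately have dl: "sqrt d * real N powr \<kappa> \<le> dN" by linarith
      have "expectation W / ?u = 2 * expectation W / (\<epsilon> * dN)" by simp
      also have "\<dots> \<le> 2 * C / (\<epsilon> ^ 3 * (sqrt d * real N powr \<kappa>))"
        using W \<epsilon> \<epsilon>3 dl dN d N C by (intro frac_le mult_mono mult_nonneg_nonneg) auto
      also have "\<dots> = (2 * C / sqrt d) * (real N powr (- \<kappa>) / \<epsilon> ^ 3)"
        by (simp add: powr_minus field_simps)
      finally show "expectation W / ?u \<le> (2 * C / sqrt d) * (real N powr (- \<kappa>) / \<epsilon> ^ 3)" .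
    qed
    also have "\<dots> = (4 * C / d + 2 * C / sqrt d) * (real N powr (- \<kappa>) * (1 / \<epsilon> ^ 3))"
      by (simp only: distrib_right times_divide_eq_right mult_1_right add_divide_distrib)
    also have "\<dots> \<le> C' * (real N powr (- \<kappa>) * (1 + 1 / \<epsilon> ^ 3))"
      using C' \<epsilon> by (intro mult_mono mult_left_mono) (auto simp: C'_def)
    finally show ?thesis by (simp add: mult.assoc)
  qed
  show ?thesis
    by (rule exI[of _ C'], rule exI[of _ \<kappa>]) (use C' \<kappa> main in blast)
qed

end
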